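(* There is a universal constant $c_1>0$ such that the following holds for the concrete cubical–triangulated encoding scheme with $\delta_\gamma\le\varepsilon$ and $\delta_F\le\delta_{\mathrm{st}}/(8C_* )$, $C_*=\max\{4,2C_{\mathrm{enc}}\}$. Let $\Delta,\tau>0$ and $0<\varepsilon\le c_1\min\{1,\tau\}$. Then every encoded $\varepsilon$-type realized by a pair in $\mathcal Z^{\mathrm{ess}}_{\Lambda,\Delta,\tau}(K)$ for some $\Lambda>0$ and some knot type $K$ is characteristic for the essential-surface type of that pair. Consequently, within the window $(\Delta,\tau,\varepsilon)$, distinct essential-surface types never share a code, and each visible type is recognized by any one of its realized codes.
   Context: Ambient conventions. Identify $S^3=\mathbb R^3\cup\{\infty\}$; all lengths, areas, distances and reaches are Euclidean. A representative of a knot type $K$ is a $C^{1,1}$ embedded closed curve $\gamma\subset\mathbb R^3$ of type $K$; $\operatorname{Len}(\gamma)$ is its length and $\operatorname{Thi}(\gamma)$ its thickness, the radius of the largest embedded normal tube (equivalently, the Federer reach of $\gamma$). Fix $\rho_0=\tfrac12$. For $\operatorname{Thi}(\gamma)\ge1$, $N_{\rho_0}(\gamma)$ is the closed normal tube of radius $\rho_0$ and $E(\gamma)=S^3\setminus\operatorname{int}N_{\rho_0}(\gamma)$ is the exterior. Compact surfaces in $E(\gamma)$ are taken disjoint from $\infty$. Relative thickness. Universal constants $0<c_0<1$ and $L_0\ge1$ are fixed once and for all. Let $F\subset E(\gamma)$ be a compact properly embedded $C^{1,1}$ surface (possibly disconnected, non-orientable, or with boundary), and let $T=\partial E(\gamma)$.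 $\operatorname{Thi}(F)\ge r$ means that the following hold: (i) the closed set $F\subset\mathbb R^3$ (with its boundary) has Federer reach at least $r$; (ii) for every $x\in F\setminus\partial F$, in rigid coordinates with $x=0$ and $T_xF$ horizontal, there is a $C^{1,1}$ function $u$ on the disk of radius $c_0r$ in $T_xF$ with $u(0)=0$, $Du(0)=0$, whose $C^1$-norm and Lipschitz norm of $Du$ are bounded by $L_0$ after scaling by $r^{-1}$, with $F\cap B(x,c_0r)\subseteq\operatorname{graph}(u)$ and $\operatorname{graph}(u|_{\text{disk of radius }c_0r/2})\subseteq F$; (iii) for every $x\in\partial F$ the same holds with half-disks, $\partial F$ corresponding to the boundary diameter; (iv) the inward conormal collar map $C_F:[0,c_0r]\times\partial F\to F$, $C_F(0,p)=p$, is an embedding; for $p,q$ on the same component of $\partial F$, with $d_{\partial F}$ arclength distance, $L_0^{-1}\min\{r,|s-t|+d_{\partial F}(p,q)\}\le|C_F(s,p)-C_F(t,q)|\le L_0(|s-t|+d_{\partial F}(p,q))$; for $p,q$ on different components $|C_F(s,p)-C_F(t,q)|\ge c_0r$; and after scaling by $r^{-1}$ the first derivative of $C_F$ is bounded by $L_0$ and $L_0$-Lipschitz; (v) $\operatorname{dist}(C_F(s,p),T)\ge c_0s$ for $0\le s\le c_0r$, and $\operatorname{dist}(F\setminus C_F([0,c_0r/2]\times\partial F),T)\ge\tfrac{c_0^2}{4}r$ (with $F$ itself in place of the complement if $F$ is closed). $\operatorname{Thi}(F)$ is the largest such $r$ ($0$ if there is none). For disconnected $F$ the clauses are imposed on the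 union and area means total area. Essential. A compact properly embedded surface or finite surface system in $E(\gamma)$ is essential if every component is incompressible, boundary-incompressible and not boundary-parallel; a $2$-sphere is essential only if it bounds no ball in $E(\gamma)$ (so sphere components never occur). Parallel duplicate components are not allowed. $\mathcal Z^{\mathrm{ess}}_{\Lambda,\Delta,\tau}(K)$ is the set of pairs $(\gamma,F)$ with $\gamma$ a representative of $K$ (modulo orientation-preserving rigid motions), $\operatorname{Thi}(\gamma)=1$, $\operatorname{Len}(\gamma)\le\Lambda$, $F\subset E(\gamma)$ essential, $\operatorname{Thi}(F)\ge\tau$, $\operatorname{Area}(F)\le\Delta$; codes are attached to geometric pairs. Essential-surface types. An essential-surface type is an equivalence class of pairs $(K,F)$, $K\subset S^3$ a knot and $F\subset E(K)$ a properly embedded essential surface or finite essential surface system, where $(K,F)\sim(K',F')$ if an ambient isotopy of $S^3$ carries $K$ to $K'$ and $F$ to $F'$. $\operatorname{type}(\gamma,F)$ is the type of a geometric pair. An encoded $\varepsilon$-type $w$ is characteristic for a type $\mathcal T$ (in the window $(\Delta,\tau,\varepsilon)$) if every essential geometric pair $(\gamma,F)$, of any knot type, with $\operatorname{Thi}(\gamma)=1$, $\operatorname{Thi}(F)\ge\tau$, $\operatorname{Area}(F)\le\Delta$ and encoded $\varepsilon$-type $w$ has $\operatorname{type}(\gamma,F)=\mathcal T$. A type is visible in the window if some such pair has it. Concrete cubical–triangulated encoding at resolution $\varepsilon$, with quantization scales $\delta_\gamma,\delta_F>0$. (a) Spatial labels are cubes of the fixed global lattice $\{\varepsilon(k+[-\tfrac12,\tfrac12)^3):k\in\mathbb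 Z^3\}$, after a rigid motion putting the barycenter of $\gamma$ at the origin. (b) Alphabets: a $\delta_\gamma$-net $\mathcal D_\gamma\subset S^2$ of oriented knot tangent directions, a $\delta_F$-net $\mathcal D_\partial\subset S^2$ of oriented boundary tangents, a $\delta_F$-net $\widehat{\mathcal D}_F\subset\mathbb{RP}^2$ of unoriented surface normal lines, a fixed finite set $\mathcal B$ of boundary-collar/sheet type symbols, and a fixed finite set $\mathcal J$ of incidence symbols. (c) Curve layer: the cyclic list of (cube, quantized tangent) along an arclength $\varepsilon/2$-net of $\gamma$. (d) Surface and boundary layers: a bounded-geometry triangulation of $F$ of mesh at most $\varepsilon$ with fixed shape-regularity constants; for each triangle the cube containing its barycenter, its quantized unoriented normal line, and its label in $\mathcal B$, together with triangle adjacency; and each boundary component as a cyclic list of samples of an arclength $\varepsilon/2$-net with their cubes and quantized tangents. (e) Relative-position layer: for each (curve edge, triangle) in equal or neighbouring cubes, a symbol in $\mathcal J$. (f) Admissible discretizations are those using $O(\operatorname{Len}(\gamma)/\varepsilon)$ curve cells and $O(\operatorname{Area}(F)/\varepsilon^2)$ surface cells, with fixed universal implied constants. The encoded $\varepsilon$-type of the pair is the shortlex-least word among all raw words obtained from all admissible choices (orientation-preserving rigid normalization, curve orientation, basepoints, nets, triangulations, orderings), for a fixed numbering of the global alphabet. Constants. $C_{\mathrm{enc}}\ge1$ is a fixed universal constant such that, for two essential pairs with the bounds above and the same code, corresponding knot tangents differ in angle by at most $C_{\mathrm{enc}}(\delta_\gamma+\varepsilon)$, and corresponding surface tangent planes and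 boundary tangents by at most $C_{\mathrm{enc}}(\delta_F+\varepsilon/\tau)$. $c_{\mathrm{st}},\delta_{\mathrm{st}}>0$ are fixed universal constants with the following property: for $\tau>0$ and two pairs $(\gamma_i,F_i)$ with $\operatorname{Thi}(\gamma_i)\ge1$, $F_i\subset E(\gamma_i)$ compact properly embedded, $\operatorname{Thi}(F_i)\ge\tau$, if for some $\eta\le c_{\mathrm{st}}\min\{1,\tau\}$, $\delta\le\delta_{\mathrm{st}}$ the cores are $\eta$-close in Hausdorff distance and tangent direction under nearest-point correspondence, the surfaces are $\eta$-close as closed sets with tangent planes $\delta$-close at corresponding nearby points, and (after identification by fixed-radius tube coordinates) the boundary systems are $\eta$-close in position and $\delta$-close in tangent direction, then some ambient isotopy of $S^3$ carries one pair to the other through proper pairs.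
   Formalization: In Thi(F), clause (ii) asks the half-radius graph to lie in F only where radial segments do not meet ∂F (the literal clause excludes every surface with boundary), and clause (iii) allows half-disks whose diameter is a C^{1,1} curve tangent to the straight one. *)

theory Defs
  imports "HOL-Analysis.Analysis"
begin

section \<open>The three-sphere, ambient isotopy, knots\<close>

text \<open>\<open>S^3 = R^3 \<union> {\<infinity>}\<close>; the point \<open>Some x\<close> is \<open>x \<in> R^3\<close> and \<open>None\<close> is \<open>\<infinity>\<close>.\<close>

type_synonym R3 = "real^3"
type_synonym spt = "R3 option"

definition S3 :: "spt topology" where
  "S3 = Alexandroff_compactification euclidean"

definition ambient_isotopy :: "(real \<Rightarrow> spt \<Rightarrow> spt) \<Rightarrow> bool" where
  "ambient_isotopy H \<longleftrightarrow>
     continuous_map (prod_topology (top_of_set {0..1}) S3) S3 (\<lambda>(t, x). H t x) \<and>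
     (\<forall>t\<in>{0..1}. homeomorphic_map S3 S3 (H t)) \<and> (\<forall>x. H 0 x = x)"

text \<open>\<open>N\<close> is a closed solid torus neighbourhood of its core \<open>K\<close>; having one is what makes
  \<open>K\<close> a (tame, unoriented) knot.\<close>

definition tubular_nbhd :: "spt set \<Rightarrow> spt set \<Rightarrow> bool" where
  "tubular_nbhd K N \<longleftrightarrow>
     (\<exists>h. embedding_map (prod_topology (top_of_set (sphere (0::real^2) 1)) (top_of_set (cball (0::real^2) 1))) S3 h \<and>
          K = h ` (sphere 0 1 \<times> {0}) \<and> N = h ` (sphere 0 1 \<times> cball 0 1))"

definition is_knot :: "spt set \<Rightarrow> bool" where
  "is_knot K \<longleftrightarrow> (\<exists>N. tubular_nbhd K N)"

definition knot_types :: "spt set set set" where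
  "knot_types = {{K'. \<exists>H. ambient_isotopy H \<and> H 1 ` K = K'} | K. is_knot K}"

definition exterior_of :: "spt set \<Rightarrow> spt set" where
  "exterior_of N = topspace S3 - S3 interior_of N"


section \<open>Properly embedded and essential surfaces in a knot exterior\<close>

text \<open>Topological (locally flat) proper embedding of a compact surface in the 3-manifold
  \<open>E \<subseteq> S^3\<close>: locally \<open>(E, F)\<close> is \<open>(R^3, plane)\<close> or \<open>(half-space, half-plane)\<close>.  Consequently
  the boundary of \<open>F\<close>, and of each of its components, is its intersection with the
  frontier of \<open>E\<close>.\<close>

definition proper_surface :: "spt set \<Rightarrow> spt set \<Rightarrow> bool" where
  "proper_surface E F \<longleftrightarrow> F \<noteq> {} \<and> F \<subseteq> E \<and> compactin S3 F \<and>
     (\<forall>x\<in>F. \<exists>U h. openin (subtopology S3 E) U \<and> x \<in> U \<and>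
        (homeomorphic_map (subtopology S3 U) (euclidean :: R3 topology) h \<and>
           h ` (F \<inter> U) = {z. z$3 = 0} \<or>
         homeomorphic_map (subtopology S3 U) (top_of_set {z::R3. z$2 \<ge> 0}) h \<and>
           h ` (F \<inter> U) = {z. z$2 \<ge> 0 \<and> z$3 = 0}))"

definition embedded_disk :: "(real^2 \<Rightarrow> spt) \<Rightarrow> bool" where
  "embedded_disk h \<longleftrightarrow> embedding_map (top_of_set (cball 0 1)) S3 h"

abbreviation upper_arc :: "(real^2) set" where
  "upper_arc \<equiv> {z \<in> sphere 0 1. z$2 \<ge> 0}"

abbreviation lower_arc :: "(real^2) set" where
  "lower_arc \<equiv> {z \<in> sphere 0 1. z$2 \<le> 0}"

definition incompressible :: "spt set \<Rightarrow> spt set \<Rightarrow> bool" where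
  "incompressible E G \<longleftrightarrow>
     (\<forall>h. embedded_disk h \<and> h ` cball 0 1 \<subseteq> E - S3 frontier_of E \<and>
          h ` cball 0 1 \<inter> G = h ` sphere 0 1 \<longrightarrow>
        (\<exists>h'. embedded_disk h' \<and> h' ` cball 0 1 \<subseteq> G \<and> h' ` sphere 0 1 = h ` sphere 0 1))"

definition boundary_incompressible :: "spt set \<Rightarrow> spt set \<Rightarrow> bool" where
  "boundary_incompressible E G \<longleftrightarrow>
     (\<forall>h. embedded_disk h \<and> h ` cball 0 1 \<subseteq> E \<and>
          h ` cball 0 1 \<inter> G = h ` upper_arc \<and>
          h ` cball 0 1 \<inter> S3 frontier_of E = h ` lower_arc \<longrightarrow>
        (\<exists>h'. embedded_disk h' \<and> h' ` cball 0 1 \<subseteq> G \<and> h' ` upper_arc = h ` upper_arc \<and>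
              h' ` cball 0 1 \<inter> S3 frontier_of E = h' ` lower_arc))"

text \<open>A product region \<open>G \<times> [0,1]\<close> in \<open>E\<close> based on \<open>G \<times> {0} = G\<close>, with \<open>\<partial>G \<times> [0,1]\<close> in \<open>\<partial>E\<close>.\<close>

definition product_region :: "spt set \<Rightarrow> spt set \<Rightarrow> (spt \<times> real \<Rightarrow> spt) \<Rightarrow> bool" where
  "product_region E G f \<longleftrightarrow>
     embedding_map (prod_topology (subtopology S3 G) (top_of_set {0..1})) S3 f \<and>
     f ` (G \<times> {0..1}) \<subseteq> E \<and> (\<forall>x\<in>G. f (x, 0) = x) \<and>
     f ` ((G \<inter> S3 frontier_of E) \<times> {0..1}) \<subseteq> S3 frontier_of E"

definition boundary_parallel :: "spt set \<Rightarrow> spt set \<Rightarrow> bool" where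
  "boundary_parallel E G \<longleftrightarrow>
     (\<exists>f. product_region E G f \<and> f ` (G \<times> {1}) \<subseteq> S3 frontier_of E)"

definition parallel_in :: "spt set \<Rightarrow> spt set \<Rightarrow> spt set \<Rightarrow> bool" where
  "parallel_in E G G' \<longleftrightarrow> (\<exists>f. product_region E G f \<and> f ` (G \<times> {1}) = G')"

definition bounds_ball :: "spt set \<Rightarrow> spt set \<Rightarrow> bool" where
  "bounds_ball E G \<longleftrightarrow>
     (\<exists>h. embedding_map (top_of_set (cball (0::R3) 1)) S3 h \<and>
          h ` cball 0 1 \<subseteq> E \<and> h ` sphere 0 1 = G)"

definition essential :: "spt set \<Rightarrow> spt set \<Rightarrow> bool" where
  "essential E F \<longleftrightarrow>
     (\<forall>G \<in> connected_components_of (subtopology S3 F).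
        incompressible E G \<and> boundary_incompressible E G \<and>
        \<not> boundary_parallel E G \<and> \<not> bounds_ball E G) \<and>
     (\<forall>G \<in> connected_components_of (subtopology S3 F).
      \<forall>G' \<in> connected_components_of (subtopology S3 F). G \<noteq> G' \<longrightarrow> \<not> parallel_in E G G')"

definition ess_pairs :: "(spt set \<times> spt set) set" where
  "ess_pairs = {(K, F). \<exists>N. tubular_nbhd K N \<and>
                  proper_surface (exterior_of N) F \<and> essential (exterior_of N) F}"

definition isotopic_pairs :: "spt set \<times> spt set \<Rightarrow> spt set \<times> spt set \<Rightarrow> bool" where
  "isotopic_pairs P Q \<longleftrightarrow>
     (\<exists>H. ambient_isotopy H \<and> H 1 ` fst P = fst Q \<and> H 1 ` snd P = snd Q)"

definition ess_type :: "R3 set \<Rightarrow> R3 set \<Rightarrow> (spt set \<times> spt set) set" where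
  "ess_type \<gamma> F = {Q \<in> ess_pairs. isotopic_pairs (Some ` \<gamma>, Some ` F) Q}"


section \<open>Tangent spaces and angles\<close>

text \<open>Federer's tangent cone.  Its span is the tangent line of an embedded curve and the tangent
  plane of an embedded surface, also at boundary points of the surface.\<close>

definition tan_cone :: "R3 set \<Rightarrow> R3 \<Rightarrow> R3 set" where
  "tan_cone S x = {v. \<exists>y t. (\<forall>n::nat. y n \<in> S \<and> (0::real) \<le> t n) \<and> y \<longlonglongrightarrow> x \<and>
                        (\<lambda>n. t n *\<^sub>R (y n - x)) \<longlonglongrightarrow> v}"

definition tan_space :: "R3 set \<Rightarrow> R3 \<Rightarrow> R3 set" where
  "tan_space S x = span (tan_cone S x)"

definition normal_space :: "R3 set \<Rightarrow> R3 \<Rightarrow> R3 set" where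
  "normal_space S x = orthogonal_comp (tan_space S x)"

definition dir_angle :: "R3 \<Rightarrow> R3 \<Rightarrow> real" where
  "dir_angle u v = arccos (u \<bullet> v / (norm u * norm v))"

text \<open>Unoriented angle between two lines through the origin.  The angle between two
  planes is the angle between their normal lines.\<close>

definition line_angle :: "R3 set \<Rightarrow> R3 set \<Rightarrow> real" where
  "line_angle U V = Inf {dir_angle u v | u v. u \<in> U - {0} \<and> v \<in> V - {0}}"


section \<open>Thick curves\<close>

definition arclength_param :: "(real \<Rightarrow> R3) \<Rightarrow> real \<Rightarrow> R3 set \<Rightarrow> bool" where
  "arclength_param c L \<gamma> \<longleftrightarrow> 0 < L \<and> \<gamma> = range c \<and> inj_on c {0..<L} \<and> (\<forall>s. c (s + L) = c s) \<and>
     (\<exists>c'. (\<forall>s. (c has_vector_derivative c' s) (at s) \<and> norm (c' s) = 1) \<and>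
           (\<exists>B. B-lipschitz_on UNIV c'))"

definition C11_closed_curve :: "R3 set \<Rightarrow> bool" where
  "C11_closed_curve \<gamma> \<longleftrightarrow> (\<exists>c L. arclength_param c L \<gamma>)"

definition curve_len :: "R3 set \<Rightarrow> real" where
  "curve_len \<gamma> = (THE L. \<exists>c. arclength_param c L \<gamma>)"

definition arc_dist :: "R3 set \<Rightarrow> R3 \<Rightarrow> R3 \<Rightarrow> real" where
  "arc_dist \<gamma> p q = Inf {\<bar>s - t\<bar> | s t. \<exists>c L. arclength_param c L \<gamma> \<and> c s = p \<and> c t = q}"

text \<open>Injectivity of the normal exponential map on the open normal disk bundle of radius \<open>r\<close>.\<close>

definition embedded_tube :: "R3 set \<Rightarrow> real \<Rightarrow> bool" where
  "embedded_tube \<gamma> r \<longleftrightarrow>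
     inj_on (\<lambda>(p, u). p + u) {(p, u). p \<in> \<gamma> \<and> u \<in> normal_space \<gamma> p \<and> norm u < r}"

definition Thi :: "R3 set \<Rightarrow> ereal" where
  "Thi \<gamma> = (SUP r \<in> {r. 0 \<le> r \<and> embedded_tube \<gamma> r}. ereal r)"

definition rho0 :: real where "rho0 = 1/2"

definition normal_tube :: "R3 set \<Rightarrow> R3 set" where
  "normal_tube \<gamma> = {p + u | p u. p \<in> \<gamma> \<and> u \<in> normal_space \<gamma> p \<and> norm u \<le> rho0}"

definition ext :: "R3 set \<Rightarrow> spt set" where
  "ext \<gamma> = exterior_of (Some ` normal_tube \<gamma>)"

definition tube_bd :: "R3 set \<Rightarrow> R3 set" where
  "tube_bd \<gamma> = frontier (normal_tube \<gamma>)"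


section \<open>\<open>C^{1,1}\<close> surfaces and relative thickness\<close>

definition C11_chart :: "(real^2) set \<Rightarrow> (real^2 \<Rightarrow> R3) \<Rightarrow> R3 set \<Rightarrow> R3 \<Rightarrow> bool" where
  "C11_chart D f F x \<longleftrightarrow> 0 \<in> D \<and> f 0 = x \<and> openin (top_of_set F) (f ` D) \<and>
     (\<exists>g. homeomorphism D (f ` D) f g) \<and>
     (\<exists>f' B. (\<forall>a\<in>D. (f has_derivative blinfun_apply (f' a)) (at a within D) \<and>
                     inj (blinfun_apply (f' a))) \<and> B-lipschitz_on D f')"

definition surf_int :: "R3 set \<Rightarrow> R3 set" where
  "surf_int F = {x \<in> F. \<exists>f. C11_chart (ball 0 1) f F x}"

definition surf_bd :: "R3 set \<Rightarrow> R3 set" where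
  "surf_bd F = F - surf_int F"

definition C11_surface :: "R3 set \<Rightarrow> bool" where
  "C11_surface F \<longleftrightarrow> F \<noteq> {} \<and> compact F \<and>
     (\<forall>x \<in> surf_bd F. \<exists>f. C11_chart {a \<in> ball 0 1. a$2 \<ge> 0} f F x)"

definition proper_C11_surface :: "R3 set \<Rightarrow> R3 set \<Rightarrow> bool" where
  "proper_C11_surface \<gamma> F \<longleftrightarrow> C11_surface F \<and> F \<subseteq> - interior (normal_tube \<gamma>) \<and>
     surf_bd F = F \<inter> tube_bd \<gamma>"

text \<open>Area is two-dimensional Hausdorff measure; \<open>\<pi>/4 * diam^2\<close> is the area of the disk of
  that diameter.\<close>

definition area :: "R3 set \<Rightarrow> ennreal" where
  "area F = (SUP d \<in> {0<..}. INF A \<in> {A :: nat \<Rightarrow> R3 set. F \<subseteq> (\<Union>i. A i) \<and>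
                                   (\<forall>i. bounded (A i) \<and> diameter (A i) \<le> d)}.
               (\<Sum>i. ennreal (pi / 4 * (diameter (A i))\<^sup>2)))"

definition reach_ge :: "R3 set \<Rightarrow> real \<Rightarrow> bool" where
  "reach_ge F r \<longleftrightarrow> (\<forall>x. infdist x F < r \<longrightarrow> (\<exists>!y. y \<in> F \<and> dist x y = infdist x F))"

text \<open>Normalized \<open>C^{1,1}\<close> function whose rescaling \<open>u(r .)/r\<close> has values, first derivatives
  and Lipschitz constant of the derivative bounded by \<open>L\<close>.\<close>

definition scaled_C11 ::
  "real \<Rightarrow> real \<Rightarrow> 'a::real_normed_vector set \<Rightarrow> ('a \<Rightarrow> real) \<Rightarrow> bool" where
  "scaled_C11 L r D u \<longleftrightarrow> u 0 = 0 \<and>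
     (\<exists>u'. u' 0 = 0 \<and>
        (\<forall>a\<in>D. (u has_derivative blinfun_apply (u' a)) (at a within D) \<and>
               \<bar>u a\<bar> \<le> L * r \<and> norm (u' a) \<le> L) \<and>
        (L / r)-lipschitz_on D u')"

definition graph_pt :: "R3 \<Rightarrow> real^3^3 \<Rightarrow> (real^2 \<Rightarrow> real) \<Rightarrow> real^2 \<Rightarrow> R3" where
  "graph_pt x Q u a = x + Q *v vector [a$1, a$2, u a]"

definition horizontal_frame :: "R3 set \<Rightarrow> R3 \<Rightarrow> real^3^3 \<Rightarrow> bool" where
  "horizontal_frame F x Q \<longleftrightarrow> orthogonal_matrix Q \<and> (*v) Q ` {v. v$3 = 0} = tan_space F x"

text \<open>At an interior point the graph over the half-radius disk lies in \<open>F\<close> as far as it is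
  not cut off by the boundary of \<open>F\<close>: a radial path in the graph can leave \<open>F\<close> only through
  \<open>\<partial>F\<close>.  For closed \<open>F\<close>, and wherever that graph does not meet \<open>\<partial>F\<close>, this is
  containment of the full disk.  Containment of the full disk at interior points
  arbitrarily close to a nonempty boundary is impossible.\<close>

definition interior_graphs :: "real \<Rightarrow> real \<Rightarrow> R3 set \<Rightarrow> real \<Rightarrow> bool" where
  "interior_graphs c0 L0 F r \<longleftrightarrow>
     (\<forall>x \<in> F - surf_bd F. \<exists>Q u.
        horizontal_frame F x Q \<and> scaled_C11 L0 r (ball 0 (c0 * r)) u \<and>
        F \<inter> ball x (c0 * r) \<subseteq> graph_pt x Q u ` ball 0 (c0 * r) \<and>
        (\<forall>a \<in> ball 0 (c0 * r / 2).
           (\<forall>t\<in>{0..1}. graph_pt x Q u (t *\<^sub>R a) \<notin> surf_bd F) \<longrightarrow> graph_pt x Q u a \<in> F))"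

text \<open>At a boundary point the domain is the half-disk bounded by the \<open>C^{1,1}\<close> curve
  \<open>a_2 = h(a_1)\<close> tangent to the diameter (\<open>h = 0\<close> is a straight half-disk), since \<open>\<partial>F\<close> is
  in general curved in the tangent plane of \<open>F\<close>.\<close>

definition boundary_graphs :: "real \<Rightarrow> real \<Rightarrow> R3 set \<Rightarrow> real \<Rightarrow> bool" where
  "boundary_graphs c0 L0 F r \<longleftrightarrow>
     (\<forall>x \<in> surf_bd F. \<exists>Q u h. let D = {a \<in> ball 0 (c0 * r). h (a$1) \<le> a$2} in
        horizontal_frame F x Q \<and>
        scaled_C11 L0 r {- (c0 * r) <..< c0 * r} h \<and> scaled_C11 L0 r D u \<and>
        F \<inter> ball x (c0 * r) \<subseteq> graph_pt x Q u ` D \<and>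
        graph_pt x Q u ` (D \<inter> ball 0 (c0 * r / 2)) \<subseteq> F \<and>
        (\<forall>a\<in>D. graph_pt x Q u a \<in> F \<and>
                (graph_pt x Q u a \<in> ball x (c0 * r) \<or> norm a < c0 * r / 2) \<longrightarrow>
                (graph_pt x Q u a \<in> surf_bd F \<longleftrightarrow> a$2 = h (a$1))))"

definition inward_conormal :: "R3 set \<Rightarrow> R3 \<Rightarrow> R3 \<Rightarrow> bool" where
  "inward_conormal F p v \<longleftrightarrow> norm v = 1 \<and> v \<in> tan_cone F p \<and> v \<in> normal_space (surf_bd F) p"

text \<open>\<open>C\<close> leaves the boundary in the direction of the inward unit conormal; its derivatives
  are taken in the coordinates \<open>(s, t)\<close> with \<open>t\<close> an arclength parameter of a boundary
  component.\<close>

definition conormal_collar :: "real \<Rightarrow> real \<Rightarrow> R3 set \<Rightarrow> real \<Rightarrow> (real \<Rightarrow> R3 \<Rightarrow> R3) \<Rightarrow> bool" where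
  "conormal_collar c0 L0 F r C \<longleftrightarrow>
     (\<forall>p \<in> surf_bd F. C 0 p = p) \<and>
     (\<lambda>(s, p). C s p) ` ({0..c0 * r} \<times> surf_bd F) \<subseteq> F \<and>
     (\<exists>g. homeomorphism ({0..c0 * r} \<times> surf_bd F)
            ((\<lambda>(s, p). C s p) ` ({0..c0 * r} \<times> surf_bd F)) (\<lambda>(s, p). C s p) g) \<and>
     (\<forall>B \<in> components (surf_bd F). \<forall>p\<in>B. \<forall>q\<in>B. \<forall>s\<in>{0..c0 * r}. \<forall>t\<in>{0..c0 * r}.
        min r (\<bar>s - t\<bar> + arc_dist B p q) / L0 \<le> dist (C s p) (C t q) \<and>
        dist (C s p) (C t q) \<le> L0 * (\<bar>s - t\<bar> + arc_dist B p q)) \<and>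
     (\<forall>B \<in> components (surf_bd F). \<forall>B' \<in> components (surf_bd F). B \<noteq> B' \<longrightarrow>
        (\<forall>p\<in>B. \<forall>q\<in>B'. \<forall>s\<in>{0..c0 * r}. \<forall>t\<in>{0..c0 * r}. c0 * r \<le> dist (C s p) (C t q))) \<and>
     (\<forall>B \<in> components (surf_bd F). \<forall>c L. arclength_param c L B \<longrightarrow>
        (\<exists>C'. (\<forall>z \<in> {0..c0 * r} \<times> UNIV.
                 ((\<lambda>(s, t). C s (c t)) has_derivative blinfun_apply (C' z))
                   (at z within {0..c0 * r} \<times> UNIV) \<and> norm (C' z) \<le> L0) \<and>
              (L0 / r)-lipschitz_on ({0..c0 * r} \<times> UNIV) C' \<and>
              (\<forall>t. inward_conormal F (c t) (blinfun_apply (C' (0, t)) (1, 0)))))"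

text \<open>\<open>rel_thi_ge c0 L0 \<gamma> F r\<close> is \<open>Thi(F) \<ge> r\<close> for \<open>F\<close> in the exterior of \<open>\<gamma>\<close>.\<close>

definition rel_thi_ge :: "real \<Rightarrow> real \<Rightarrow> R3 set \<Rightarrow> R3 set \<Rightarrow> real \<Rightarrow> bool" where
  "rel_thi_ge c0 L0 \<gamma> F r \<longleftrightarrow>
     reach_ge F r \<and> interior_graphs c0 L0 F r \<and> boundary_graphs c0 L0 F r \<and>
     (\<exists>C. conormal_collar c0 L0 F r C \<and>
        (\<forall>p \<in> surf_bd F. \<forall>s \<in> {0..c0 * r}. c0 * s \<le> infdist (C s p) (tube_bd \<gamma>)) \<and>
        (\<forall>x \<in> F - (\<lambda>(s, p). C s p) ` ({0..c0 * r / 2} \<times> surf_bd F).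
           c0\<^sup>2 / 4 * r \<le> infdist x (tube_bd \<gamma>)))"


section \<open>Geometric pairs\<close>

definition rigid :: "(R3 \<Rightarrow> R3) \<Rightarrow> bool" where
  "rigid g \<longleftrightarrow> (\<exists>Q a. rotation_matrix Q \<and> g = (\<lambda>x. Q *v x + a))"

definition rigid_class :: "R3 set \<Rightarrow> R3 set \<Rightarrow> (R3 set \<times> R3 set) set" where
  "rigid_class \<gamma> F = {(g ` \<gamma>, g ` F) | g. rigid g}"

definition window_pair :: "real \<Rightarrow> real \<Rightarrow> real \<Rightarrow> real \<Rightarrow> R3 set \<Rightarrow> R3 set \<Rightarrow> bool" where
  "window_pair c0 L0 \<Delta> \<tau> \<gamma> F \<longleftrightarrow>
     C11_closed_curve \<gamma> \<and> Thi \<gamma> = 1 \<and>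
     proper_C11_surface \<gamma> F \<and> essential (ext \<gamma>) (Some ` F) \<and>
     rel_thi_ge c0 L0 \<gamma> F \<tau> \<and> area F \<le> ennreal \<Delta>"

definition Zess :: "real \<Rightarrow> real \<Rightarrow> real \<Rightarrow> real \<Rightarrow> real \<Rightarrow> spt set set \<Rightarrow>
    (R3 set \<times> R3 set) set set" where
  "Zess c0 L0 \<Lambda> \<Delta> \<tau> K =
     {rigid_class \<gamma> F | \<gamma> F. Some ` \<gamma> \<in> K \<and> window_pair c0 L0 \<Delta> \<tau> \<gamma> F \<and> curve_len \<gamma> \<le> \<Lambda>}"


section \<open>The cubical-triangulated encoding\<close>

text \<open>Constants of the scheme that are universal: bi-Lipschitz constant and vertex degree of
  admissible triangulations, the implied constants of the cell counts, and the finite symbol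
  sets \<open>\<B>\<close> and \<open>\<J>\<close>.\<close>

record enc_consts =
  shape :: real
  degree :: nat
  curve_cells :: real
  surf_cells :: real
  Bsyms :: "nat set"
  Jsyms :: "nat set"

definition valid_consts :: "enc_consts \<Rightarrow> bool" where
  "valid_consts A \<longleftrightarrow> 1 \<le> shape A \<and> 0 < degree A \<and> 0 < curve_cells A \<and> 0 < surf_cells A \<and>
     finite (Bsyms A) \<and> Bsyms A \<noteq> {} \<and> finite (Jsyms A) \<and> Jsyms A \<noteq> {}"

text \<open>Indices in \<open>Adj\<close> and \<open>Inc\<close> are positions in the lists of curve edges and triangles.\<close>

datatype letter =
    Curve "int^3" R3
  | Tri "int^3" "R3 set" nat
  | Adj nat nat
  | BdStart
  | Bd "int^3" R3
  | Inc nat nat nat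

text \<open>Scheme at a given resolution: nets, quantization maps into them, the rules assigning the
  symbols in \<open>\<B>\<close> (to curve, surface, triangle) and \<open>\<J>\<close> (to curve, surface, curve edge,
  triangle), and the numbering of the alphabet.  A point of \<open>RP^2\<close> is a line through the
  origin.\<close>

record scheme =
  eps :: real
  dgam :: real
  dF :: real
  Dgam :: "R3 set"
  Dbd :: "R3 set"
  DF :: "R3 set set"
  qgam :: "R3 \<Rightarrow> R3"
  qbd :: "R3 \<Rightarrow> R3"
  qF :: "R3 set \<Rightarrow> R3 set"
  Blab :: "R3 set \<Rightarrow> R3 set \<Rightarrow> R3 set \<Rightarrow> nat"
  Jlab :: "R3 set \<Rightarrow> R3 set \<Rightarrow> R3 set \<Rightarrow> R3 set \<Rightarrow> nat"
  num :: "letter \<Rightarrow> nat"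

definition RP2 :: "R3 set set" where
  "RP2 = {U. subspace U \<and> dim U = 1}"

definition alphabet :: "enc_consts \<Rightarrow> scheme \<Rightarrow> letter set" where
  "alphabet A S =
     {Curve k v | k v. v \<in> Dgam S} \<union> {Tri k l b | k l b. l \<in> DF S \<and> b \<in> Bsyms A} \<union>
     {Adj i j | i j. True} \<union> {BdStart} \<union> {Bd k v | k v. v \<in> Dbd S} \<union>
     {Inc i j b | i j b. b \<in> Jsyms A}"

definition valid_scheme :: "enc_consts \<Rightarrow> scheme \<Rightarrow> bool" where
  "valid_scheme A S \<longleftrightarrow>
     0 < eps S \<and> 0 < dgam S \<and> 0 < dF S \<and>
     finite (Dgam S) \<and> Dgam S \<subseteq> sphere 0 1 \<and>
     finite (Dbd S) \<and> Dbd S \<subseteq> sphere 0 1 \<and>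
     finite (DF S) \<and> DF S \<subseteq> RP2 \<and>
     (\<forall>v \<in> sphere 0 1. qgam S v \<in> Dgam S \<and> dir_angle v (qgam S v) \<le> dgam S) \<and>
     (\<forall>v \<in> sphere 0 1. qbd S v \<in> Dbd S \<and> dir_angle v (qbd S v) \<le> dF S) \<and>
     (\<forall>l \<in> RP2. qF S l \<in> DF S \<and> line_angle l (qF S l) \<le> dF S) \<and>
     (\<forall>\<gamma> F t. Blab S \<gamma> F t \<in> Bsyms A) \<and> (\<forall>\<gamma> F e t. Jlab S \<gamma> F e t \<in> Jsyms A) \<and>
     inj_on (num S) (alphabet A S)"

text \<open>The lattice cube \<open>\<epsilon>(k + [-1/2, 1/2)^3)\<close> containing \<open>x\<close> has index \<open>k\<close>.\<close>

definition cube_of :: "real \<Rightarrow> R3 \<Rightarrow> int^3" where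
  "cube_of e x = (\<chi> i. \<lfloor>x$i / e + 1/2\<rfloor>)"

definition close_cubes :: "int^3 \<Rightarrow> int^3 \<Rightarrow> bool" where
  "close_cubes k l \<longleftrightarrow> (\<forall>i. \<bar>k$i - l$i\<bar> \<le> 1)"

abbreviation std_vertices :: "(real^2) set" where
  "std_vertices \<equiv> {0, axis 1 1, axis 2 1}"

abbreviation std_tri :: "(real^2) set" where
  "std_tri \<equiv> convex hull std_vertices"

definition tri_center :: "(real^2 \<Rightarrow> R3) \<Rightarrow> R3" where
  "tri_center f = f (\<chi> i. 1/3)"

text \<open>A triangulation of \<open>F\<close> is an ordered list of parametrized curved triangles; two distinct
  ones meet in a common face (possibly empty) of dimension at most 1.  Shape regularity: each
  triangle is, up to scale, uniformly bi-Lipschitz to the standard one, and vertex degrees are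
  bounded.\<close>

definition triangulates :: "enc_consts \<Rightarrow> real \<Rightarrow> R3 set \<Rightarrow> (real^2 \<Rightarrow> R3) list \<Rightarrow> bool" where
  "triangulates A e F fs \<longleftrightarrow>
     F = (\<Union>f\<in>set fs. f ` std_tri) \<and>
     (\<forall>f\<in>set fs. diameter (f ` std_tri) \<le> e \<and>
        (\<exists>s>0. \<forall>a\<in>std_tri. \<forall>b\<in>std_tri.
            s / shape A * dist a b \<le> dist (f a) (f b) \<and>
            dist (f a) (f b) \<le> s * shape A * dist a b)) \<and>
     (\<forall>i<length fs. \<forall>j<length fs. i \<noteq> j \<longrightarrow>
        (\<exists>V W. V \<subset> std_vertices \<and> W \<subset> std_vertices \<and> card V = card W \<and>
           (fs!i) ` std_tri \<inter> (fs!j) ` std_tri = (fs!i) ` (convex hull V) \<and>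
           (fs!i) ` std_tri \<inter> (fs!j) ` std_tri = (fs!j) ` (convex hull W))) \<and>
     (\<forall>x. card {i. i < length fs \<and> x \<in> (fs!i) ` std_vertices} \<le> degree A)"

definition share_edge :: "(real^2 \<Rightarrow> R3) \<Rightarrow> (real^2 \<Rightarrow> R3) \<Rightarrow> bool" where
  "share_edge f g \<longleftrightarrow>
     (\<exists>V \<subseteq> std_vertices. card V = 2 \<and> f ` std_tri \<inter> g ` std_tri = f ` (convex hull V))"

text \<open>Cyclically ordered samples \<open>c s\<close>, \<open>s \<in> set ss\<close>, forming an arclength \<open>e\<close>-net.\<close>

definition cyclic_net :: "real \<Rightarrow> real \<Rightarrow> real list \<Rightarrow> bool" where
  "cyclic_net L e ss \<longleftrightarrow> ss \<noteq> [] \<and> sorted_wrt (<) ss \<and> set ss \<subseteq> {0..<L} \<and>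
     (\<forall>t. \<exists>s\<in>set ss. \<exists>m::int. \<bar>t - (s + of_int m * L)\<bar> \<le> e)"

definition curve_edge :: "(real \<Rightarrow> R3) \<Rightarrow> real \<Rightarrow> real list \<Rightarrow> nat \<Rightarrow> R3 set" where
  "curve_edge c L ss i =
     c ` {ss!i .. (if Suc i < length ss then ss ! Suc i else ss!0 + L)}"

text \<open>Choices made in discretizing a pair.  The parametrizations carry orientation and basepoint;
  \<open>bds\<close> lists the boundary components with parametrization, length and samples.\<close>

record discretization =
  cpar :: "real \<Rightarrow> R3"
  clen :: real
  csam :: "real list"
  tris :: "(real^2 \<Rightarrow> R3) list"
  bds :: "((real \<Rightarrow> R3) \<times> real \<times> real list) list"

definition admissible ::
  "enc_consts \<Rightarrow> scheme \<Rightarrow> R3 set \<Rightarrow> R3 set \<Rightarrow> discretization \<Rightarrow> bool" where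
  "admissible A S \<gamma> F d \<longleftrightarrow>
     arclength_param (cpar d) (clen d) \<gamma> \<and> cyclic_net (clen d) (eps S / 2) (csam d) \<and>
     triangulates A (eps S) F (tris d) \<and>
     distinct (map (\<lambda>(c, L, ss). range c) (bds d)) \<and>
     set (map (\<lambda>(c, L, ss). range c) (bds d)) = components (surf_bd F) \<and>
     (\<forall>(c, L, ss) \<in> set (bds d). arclength_param c L (range c) \<and> cyclic_net L (eps S / 2) ss) \<and>
     real (length (csam d)) \<le> curve_cells A * clen d / eps S \<and>
     ennreal (real (length (tris d) + (\<Sum>(c, L, ss)\<leftarrow>bds d. length ss)) * (eps S)\<^sup>2)
       \<le> ennreal (surf_cells A) * area F"

definition tangent_at :: "(real \<Rightarrow> R3) \<Rightarrow> real \<Rightarrow> R3" where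
  "tangent_at c s = vector_derivative c (at s)"

definition raw_word :: "scheme \<Rightarrow> R3 set \<Rightarrow> R3 set \<Rightarrow> discretization \<Rightarrow> letter list" where
  "raw_word S \<gamma> F d =
     map (\<lambda>s. Curve (cube_of (eps S) (cpar d s)) (qgam S (tangent_at (cpar d) s))) (csam d) @
     map (\<lambda>f. Tri (cube_of (eps S) (tri_center f)) (qF S (normal_space F (tri_center f)))
                  (Blab S \<gamma> F (f ` std_tri))) (tris d) @
     [Adj i j. i \<leftarrow> [0..<length (tris d)], j \<leftarrow> [Suc i..<length (tris d)],
               share_edge (tris d ! i) (tris d ! j)] @
     concat (map (\<lambda>(c, L, ss).
               BdStart # map (\<lambda>s. Bd (cube_of (eps S) (c s)) (qbd S (tangent_at c s))) ss) (bds d)) @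
     [Inc i j (Jlab S \<gamma> F (curve_edge (cpar d) (clen d) (csam d) i) ((tris d ! j) ` std_tri)).
        i \<leftarrow> [0..<length (csam d)], j \<leftarrow> [0..<length (tris d)],
        close_cubes (cube_of (eps S) (cpar d (csam d ! i))) (cube_of (eps S) (tri_center (tris d ! j)))]"

text \<open>Rigid normalization: the barycenter \<open>(1/L) \<integral>\<gamma> ds\<close> is moved to the origin.\<close>

definition normalizes :: "(R3 \<Rightarrow> R3) \<Rightarrow> R3 set \<Rightarrow> bool" where
  "normalizes g \<gamma> \<longleftrightarrow> rigid g \<and>
     (\<exists>c L. arclength_param c L (g ` \<gamma>) \<and> (1 / L) *\<^sub>R integral {0..L} c = 0)"

definition encodes ::
  "enc_consts \<Rightarrow> scheme \<Rightarrow> R3 set \<Rightarrow> R3 set \<Rightarrow> (R3 \<Rightarrow> R3) \<Rightarrow> discretization \<Rightarrow> letter list \<Rightarrow> bool"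
  where
  "encodes A S \<gamma> F g d w \<longleftrightarrow>
     normalizes g \<gamma> \<and> admissible A S (g ` \<gamma>) (g ` F) d \<and> w = raw_word S (g ` \<gamma>) (g ` F) d"

definition raw_words :: "enc_consts \<Rightarrow> scheme \<Rightarrow> R3 set \<Rightarrow> R3 set \<Rightarrow> letter list set" where
  "raw_words A S \<gamma> F = {w. \<exists>g d. encodes A S \<gamma> F g d w}"

text \<open>A relation rather than a function, so that a pair without admissible discretization has no
  code.\<close>

definition encoded_type :: "enc_consts \<Rightarrow> scheme \<Rightarrow> R3 set \<Rightarrow> R3 set \<Rightarrow> letter list \<Rightarrow> bool" where
  "encoded_type A S \<gamma> F w \<longleftrightarrow> w \<in> raw_words A S \<gamma> F \<and>
     (\<forall>w' \<in> raw_words A S \<gamma> F. w' \<noteq> w \<longrightarrow>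
        (map (num S) w, map (num S) w') \<in> lenlex less_than)"

definition characteristic ::
  "real \<Rightarrow> real \<Rightarrow> enc_consts \<Rightarrow> scheme \<Rightarrow> real \<Rightarrow> real \<Rightarrow> letter list \<Rightarrow> (spt set \<times> spt set) set \<Rightarrow> bool"
  where
  "characteristic c0 L0 A S \<Delta> \<tau> w \<T> \<longleftrightarrow>
     (\<forall>\<gamma> F. window_pair c0 L0 \<Delta> \<tau> \<gamma> F \<and> encoded_type A S \<gamma> F w \<longrightarrow> ess_type \<gamma> F = \<T>)"

definition visible :: "real \<Rightarrow> real \<Rightarrow> real \<Rightarrow> real \<Rightarrow> (spt set \<times> spt set) set \<Rightarrow> bool" where
  "visible c0 L0 \<Delta> \<tau> \<T> \<longleftrightarrow> (\<exists>\<gamma> F. window_pair c0 L0 \<Delta> \<tau> \<gamma> F \<and> ess_type \<gamma> F = \<T>)"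

text \<open>\<open>w\<close> is a code realized by a pair of type \<open>\<T>\<close> in the window.\<close>

definition realized_code ::
  "real \<Rightarrow> real \<Rightarrow> enc_consts \<Rightarrow> scheme \<Rightarrow> real \<Rightarrow> real \<Rightarrow> (spt set \<times> spt set) set \<Rightarrow> letter list \<Rightarrow> bool"
  where
  "realized_code c0 L0 A S \<Delta> \<tau> \<T> w \<longleftrightarrow>
     (\<exists>\<gamma> F. window_pair c0 L0 \<Delta> \<tau> \<gamma> F \<and> ess_type \<gamma> F = \<T> \<and> encoded_type A S \<gamma> F w)"


section \<open>The encoding and stability constants\<close>

text \<open>Corresponding points are points of cells with the same position in the common code: the
  arcs within \<open>\<epsilon>/2\<close> of the \<open>i\<close>-th sample (of the curve or of a boundary component), and the
  \<open>k\<close>-th triangles, for any two normalized discretizations producing that code.\<close>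

definition corr_tangents :: "real \<Rightarrow> real \<Rightarrow> (real \<Rightarrow> R3) \<Rightarrow> real list \<Rightarrow> (real \<Rightarrow> R3) \<Rightarrow> real list \<Rightarrow> bool"
  where
  "corr_tangents e \<alpha> c ss c' ss' \<longleftrightarrow>
     (\<forall>i < length ss. \<forall>s s'. \<bar>s - ss!i\<bar> \<le> e / 2 \<and> \<bar>s' - ss'!i\<bar> \<le> e / 2 \<longrightarrow>
        dir_angle (tangent_at c s) (tangent_at c' s') \<le> \<alpha>)"

definition encoding_constant :: "real \<Rightarrow> real \<Rightarrow> enc_consts \<Rightarrow> real \<Rightarrow> bool" where
  "encoding_constant c0 L0 A Cenc \<longleftrightarrow> 1 \<le> Cenc \<and>
     (\<forall>S \<Delta> \<tau> \<gamma> F \<gamma>' F' g g' d d' w.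
        valid_scheme A S \<and> 0 < \<Delta> \<and> 0 < \<tau> \<and>
        window_pair c0 L0 \<Delta> \<tau> \<gamma> F \<and> window_pair c0 L0 \<Delta> \<tau> \<gamma>' F' \<and>
        encoded_type A S \<gamma> F w \<and> encoded_type A S \<gamma>' F' w \<and>
        encodes A S \<gamma> F g d w \<and> encodes A S \<gamma>' F' g' d' w \<longrightarrow>
          corr_tangents (eps S) (Cenc * (dgam S + eps S)) (cpar d) (csam d) (cpar d') (csam d') \<and>
          (\<forall>k < length (tris d). \<forall>x \<in> (tris d ! k) ` std_tri. \<forall>y \<in> (tris d' ! k) ` std_tri.
             line_angle (normal_space (g ` F) x) (normal_space (g' ` F') y)
               \<le> Cenc * (dF S + eps S / \<tau>)) \<and>
          (\<forall>j < length (bds d).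
             corr_tangents (eps S) (Cenc * (dF S + eps S / \<tau>))
               (fst (bds d ! j)) (snd (snd (bds d ! j)))
               (fst (bds d' ! j)) (snd (snd (bds d' ! j)))))"

definition hausdorff_close :: "real \<Rightarrow> R3 set \<Rightarrow> R3 set \<Rightarrow> bool" where
  "hausdorff_close \<eta> X Y \<longleftrightarrow> (\<forall>x\<in>X. \<exists>y\<in>Y. dist x y \<le> \<eta>) \<and> (\<forall>y\<in>Y. \<exists>x\<in>X. dist x y \<le> \<eta>)"

definition cores_close :: "real \<Rightarrow> R3 set \<Rightarrow> R3 set \<Rightarrow> bool" where
  "cores_close \<eta> \<gamma> \<gamma>' \<longleftrightarrow> hausdorff_close \<eta> \<gamma> \<gamma>' \<and>
     (\<forall>x\<in>\<gamma>. \<forall>y\<in>\<gamma>'. dist x y = infdist x \<gamma>' \<or> dist x y = infdist y \<gamma> \<longrightarrow>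
        line_angle (tan_space \<gamma> x) (tan_space \<gamma>' y) \<le> \<eta>)"

definition surfaces_close :: "real \<Rightarrow> real \<Rightarrow> R3 set \<Rightarrow> R3 set \<Rightarrow> bool" where
  "surfaces_close \<eta> \<delta> F F' \<longleftrightarrow>
     (let R = (\<lambda>x y. dist x y \<le> \<eta> \<and> line_angle (normal_space F x) (normal_space F' y) \<le> \<delta>)
      in (\<forall>x\<in>F. \<exists>y\<in>F'. R x y) \<and> (\<forall>y\<in>F'. \<exists>x\<in>F. R x y))"

text \<open>Fixed-radius tube coordinates: \<open>p + u\<close> on the tube about \<open>\<gamma>\<close> is identified with \<open>p' + u'\<close>
  on the tube about \<open>\<gamma>'\<close>, where \<open>p'\<close> is the nearest core point and \<open>u'\<close> is the orthogonal
  projection of \<open>u\<close> to the normal plane at \<open>p'\<close>, rescaled to the tube radius.\<close>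

definition tube_ident :: "R3 set \<Rightarrow> R3 set \<Rightarrow> R3 \<Rightarrow> R3 \<Rightarrow> bool" where
  "tube_ident \<gamma> \<gamma>' x x' \<longleftrightarrow>
     (\<exists>p u p' v. p \<in> \<gamma> \<and> u \<in> normal_space \<gamma> p \<and> norm u = rho0 \<and> x = p + u \<and>
        p' \<in> \<gamma>' \<and> dist p p' = infdist p \<gamma>' \<and>
        v \<in> normal_space \<gamma>' p' \<and> v \<noteq> 0 \<and> u - v \<in> tan_space \<gamma>' p' \<and>
        x' = p' + (rho0 / norm v) *\<^sub>R v)"

definition boundaries_close ::
  "real \<Rightarrow> real \<Rightarrow> R3 set \<Rightarrow> R3 set \<Rightarrow> R3 set \<Rightarrow> R3 set \<Rightarrow> bool" where
  "boundaries_close \<eta> \<delta> \<gamma> F \<gamma>' F' \<longleftrightarrow>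
     (let R = (\<lambda>x y. (\<exists>x'. tube_ident \<gamma> \<gamma>' x x' \<and> dist x' y \<le> \<eta>) \<and>
                     line_angle (tan_space (surf_bd F) x) (tan_space (surf_bd F') y) \<le> \<delta>)
      in (\<forall>x \<in> surf_bd F. \<exists>y \<in> surf_bd F'. R x y) \<and> (\<forall>y \<in> surf_bd F'. \<exists>x \<in> surf_bd F. R x y))"

definition proper_pair :: "spt set \<Rightarrow> spt set \<Rightarrow> bool" where
  "proper_pair K F \<longleftrightarrow> (\<exists>N. tubular_nbhd K N \<and> proper_surface (exterior_of N) F)"

definition stability_constants :: "real \<Rightarrow> real \<Rightarrow> real \<Rightarrow> real \<Rightarrow> bool" where
  "stability_constants c0 L0 cst dst \<longleftrightarrow> 0 < cst \<and> 0 < dst \<and>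
     (\<forall>\<tau> \<gamma> F \<gamma>' F' \<eta> \<delta>.
        0 < \<tau> \<and> C11_closed_curve \<gamma> \<and> C11_closed_curve \<gamma>' \<and> 1 \<le> Thi \<gamma> \<and> 1 \<le> Thi \<gamma>' \<and>
        proper_C11_surface \<gamma> F \<and> proper_C11_surface \<gamma>' F' \<and>
        rel_thi_ge c0 L0 \<gamma> F \<tau> \<and> rel_thi_ge c0 L0 \<gamma>' F' \<tau> \<and>
        \<eta> \<le> cst * min 1 \<tau> \<and> \<delta> \<le> dst \<and>
        cores_close \<eta> \<gamma> \<gamma>' \<and> surfaces_close \<eta> \<delta> F F' \<and> boundaries_close \<eta> \<delta> \<gamma> F \<gamma>' F' \<longrightarrow>
        (\<exists>H. ambient_isotopy H \<and>
             H 1 ` Some ` \<gamma> = Some ` \<gamma>' \<and> H 1 ` Some ` F = Some ` F' \<and>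
             (\<forall>t\<in>{0..1}. proper_pair (H t ` Some ` \<gamma>) (H t ` Some ` F))))"

end

theory Submission
  imports Defs
begin

text \<open>Two pairs in the window with the same code are compared after the rigid motions that normalize
  them; all thickness hypotheses are invariant under these, and a rigid motion is isotopic to the
  identity.  Samples in the same cube are \<open>O(\<epsilon>)\<close> apart, and the encoding constant bounds the angles
  between tangents at corresponding points.  The stability property, however, asks for tangent angles
  at nearest points.  A nearest point is \<open>O(\<epsilon>)\<close> from the corresponding one, and on a curve of
  thickness at least \<open>1\<close> the tangent line is Lipschitz with respect to the chordal distance, by
  Federer's inequality for the normals of a set of positive reach.  The boundary systems are compared
  in tube coordinates by projecting the normal vector of the core to the nearby normal plane.  So with
  \<open>C\<close> the encoding constant, \<open>\<eta> = 200 C \<epsilon>\<close> and \<open>\<delta> = C(\<delta>\<^sub>F + \<epsilon>/\<tau>)\<close> stability applies once \<open>\<epsilon>\<close> is small.\<close>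

section \<open>Ambient isotopies\<close>

text \<open>The three closeness conditions differ in difficulty. For surfaces and boundary curves,
  stability only asks that every point has some nearby partner with a close tangent line or plane,
  so points of cells in the same position of the word serve directly. Nearest points occur for the
  cores and for the core points that define tube coordinates, and only there is the Lipschitz
  estimate used. That estimate compares two tangent lines through the chord joining their base
  points, so it fixes a tangent only up to sign; this is harmless because stability measures
  unoriented angles. For rigid motions the obstacle is infinity: an isotopy of the sphere must be
  continuous there as well. A path of invertible linear maps with a common lower bound achieves
  this, and it need not stay inside the rotation group.\<close>

lemma openin_S3:
  "openin S3 U \<longleftrightarrow> (\<exists>V. open V \<and> U = Some ` V) \<or> (\<exists>C. compact C \<and> U = insert None (Some ` (- C)))"
proof -
  have "compactin euclidean C \<and> closedin euclidean C \<longleftrightarrow> compact C" for C :: "R3 set"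
    using compact_imp_closed by (auto simp: compactin_euclidean_iff)
  then show ?thesis
    unfolding S3_def openin_Alexandroff_compactification
    by (simp add: Compl_eq_Diff_UNIV flip: conj_assoc)
qed

lemma topspace_S3 [simp]: "topspace S3 = UNIV"
  by (simp add: S3_def topspace_Alexandroff_compactification UNIV_option_conv)

text \<open>The growth bound is uniform in \<open>t\<close> and takes care of infinity: if a compact
  set lies in the ball of radius \<open>B\<close>, every \<open>M t\<close> sends points of norm
  greater than \<open>(B + b) / m\<close> outside it, so one neighbourhood of infinity works for all
  \<open>t\<close>.\<close>

lemma continuous_map_S3_family:
  fixes M :: "real \<Rightarrow> R3 \<Rightarrow> R3"
  assumes cont: "continuous_on ({0..1} \<times> UNIV) (\<lambda>(t, x). M t x)"
    and m: "0 < m" "\<And>t x. t \<in> {0..1} \<Longrightarrow> m * norm x \<le> norm (M t x) + b"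
  shows "continuous_map (prod_topology (top_of_set {0..1}) S3) S3 (\<lambda>(t, x). map_option (M t) x)"
proof -
  have finite_nbhd: "\<exists>T W. openin (top_of_set {0..1}) T \<and> openin S3 W \<and> t \<in> T \<and> Some x \<in> W \<and>
      T \<times> W \<subseteq> {z \<in> {0..1} \<times> UNIV. (\<lambda>(t, x). map_option (M t) x) z \<in> Some ` V}"
    if V: "open V" "t \<in> {0..1}" "M t x \<in> V" for V t x
  proof -
    have "openin (top_of_set ({0..1} \<times> UNIV)) (({0..1} \<times> UNIV) \<inter> (\<lambda>(t, x). M t x) -` V)"
      using cont V(1) continuous_openin_preimage_gen by blast
    then have "openin (prod_topology (top_of_set {0..1}) (euclidean :: R3 topology))
        (({0..1} \<times> UNIV) \<inter> (\<lambda>(t, x). M t x) -` V)"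
      by (metis prod_topology_subtopology_eu subtopology_UNIV)
    from this[unfolded openin_prod_topology_alt, rule_format, of t x] V
    obtain T W where "openin (top_of_set {0..1}) T" "open W" "t \<in> T" "x \<in> W"
        and sub: "T \<times> W \<subseteq> ({0..1} \<times> UNIV) \<inter> (\<lambda>(t, x). M t x) -` V"
      by auto
    moreover have "openin S3 (Some ` W)" using \<open>open W\<close> openin_S3 by blast
    ultimately show ?thesis
      by (intro exI[of _ T] exI[of _ "Some ` W"]) (use sub in auto)
  qed
  have "openin (prod_topology (top_of_set {0..1}) S3)
      {z \<in> {0..1} \<times> UNIV. (\<lambda>(t, x). map_option (M t) x) z \<in> U}" if U: "openin S3 U" for U
    unfolding openin_prod_topology_alt
  proof (intro allI impI)
    fix t y assume ty: "(t, y) \<in> {z \<in> {0..1} \<times> UNIV. (\<lambda>(t, x). map_option (M t) x) z \<in> U}"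
    show "\<exists>T W. openin (top_of_set {0..1}) T \<and> openin S3 W \<and> t \<in> T \<and> y \<in> W \<and>
       T \<times> W \<subseteq> {z \<in> {0..1} \<times> UNIV. (\<lambda>(t, x). map_option (M t) x) z \<in> U}"
    proof (cases y)
      case (Some x)
      have mem: "Some (M t x) \<in> U" and t: "t \<in> {0..1}" using ty Some by auto
      \<comment> \<open>Removing infinity from a neighbourhood of a finite point leaves an open
        subset of \<open>R3\<close>, for either kind of open set.\<close>
      have "\<exists>V. open V \<and> M t x \<in> V \<and> Some ` V \<subseteq> U"
        using U unfolding openin_S3
      proof (elim disjE exE conjE)
        fix V assume "open V" "U = Some ` V"
        then show ?thesis using mem by (intro exI[of _ V]) auto
      next
        fix C assume "compact C" "U = insert None (Some ` (- C))"
        then show ?thesis using mem by (intro exI[of _ "- C"]) (auto simp: compact_imp_closed)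
      qed
      then obtain V where V: "open V" "M t x \<in> V" "Some ` V \<subseteq> U" by blast
      obtain T W where TW: "openin (top_of_set {0..1}) T" "openin S3 W" "t \<in> T" "Some x \<in> W"
        "T \<times> W \<subseteq> {z \<in> {0..1} \<times> UNIV. (\<lambda>(t, x). map_option (M t) x) z \<in> Some ` V}"
        using finite_nbhd[OF V(1) t V(2)] by (elim exE conjE) (rule that)
      have "T \<times> W \<subseteq> {z \<in> {0..1} \<times> UNIV. (\<lambda>(t, x). map_option (M t) x) z \<in> U}"
        using TW(5) V(3) by blast
      with TW(1-4) show ?thesis unfolding Some by (intro exI conjI)
    next
      case None
      then obtain C where C: "compact C" "U = insert None (Some ` (- C))"
        using U ty unfolding openin_S3 by auto
      obtain B where B: "\<And>x. x \<in> C \<Longrightarrow> norm x \<le> B"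
        using C(1) compact_imp_bounded bounded_iff by metis
      let ?R = "(B + b) / m"
      have "M s x \<notin> C" if "s \<in> {0..1}" "?R < norm x" for s x
        using B[of "M s x"] m(2)[OF that(1), of x] that(2) m(1)
        by (auto simp: field_simps)
      then have "{0..1} \<times> insert None (Some ` (- cball 0 ?R))
          \<subseteq> {z \<in> {0..1} \<times> UNIV. (\<lambda>(t, x). map_option (M t) x) z \<in> U}"
        using C(2) by auto
      moreover have "openin S3 (insert None (Some ` (- cball 0 ?R)))"
        unfolding openin_S3 by (intro disjI2 exI[of _ "cball 0 ?R"] conjI compact_cball refl)
      moreover have "openin (top_of_set {0..1}) {0..1::real}" by simp
      moreover have "t \<in> {0..1}" "y \<in> insert None (Some ` (- cball 0 ?R))" using ty None by auto
      ultimately show ?thesis by (intro exI conjI)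
    qed
  qed
  then show ?thesis unfolding continuous_map_def by simp
qed

text \<open>This is the constant family, restricted to the slice \<open>t = 0\<close>.\<close>

lemma continuous_map_S3:
  fixes f :: "R3 \<Rightarrow> R3"
  assumes "continuous_on UNIV f" "0 < m" "\<And>x. m * norm x \<le> norm (f x) + b"
  shows "continuous_map S3 S3 (map_option f)"
proof -
  have "continuous_on ({0..1::real} \<times> UNIV) (\<lambda>(t, x). f x)"
    unfolding case_prod_beta
    by (rule continuous_on_compose2[OF assms(1)]) (auto intro: continuous_intros)
  then have "continuous_map (prod_topology (top_of_set {0..1}) S3) S3
      (\<lambda>(t::real, x). map_option f x)"
    using continuous_map_S3_family[of "\<lambda>_. f"] assms by blast
  moreover have "continuous_map S3 (prod_topology (top_of_set {0..1::real}) S3) (\<lambda>x. (0, x))"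
    by (intro continuous_map_pairedI) auto
  ultimately have "continuous_map S3 S3 ((\<lambda>(t::real, x). map_option f x) \<circ> (\<lambda>x. (0, x)))"
    by (rule continuous_map_compose[rotated])
  then show ?thesis by (simp add: o_def)
qed

text \<open>An injective linear map in finite dimension is bounded below, which is the growth bound
  with \<open>b\<close> the norm of the translation; the inverse is affine of the same kind.\<close>

lemma homeomorphic_map_S3_affine:
  fixes l :: "R3 \<Rightarrow> R3"
  assumes l: "linear l" "inj l"
  shows "homeomorphic_map S3 S3 (map_option (\<lambda>x. l x + a))"
proof -
  have affine_cont: "continuous_map S3 S3 (map_option (\<lambda>x. k x + c))"
    if k: "linear k" "inj k" for k :: "R3 \<Rightarrow> R3" and c
  proof -
    obtain B where B: "0 < B" "\<And>x. B * norm x \<le> norm (k x)"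
      using linear_inj_bounded_below_pos[OF k] by metis
    show ?thesis
    proof (rule continuous_map_S3[OF _ B(1), where b = "norm c"])
      show "continuous_on UNIV (\<lambda>x. k x + c)"
        using k(1) by (intro continuous_intros linear_continuous_on linear_linear[THEN iffD2])
          (auto simp: linear_conv_bounded_linear)
      show "B * norm x \<le> norm (k x + c) + norm c" for x
        using B(2)[of x] norm_triangle_ineq4[of "k x + c" c] by simp
    qed
  qed
  obtain k where k: "linear k" "\<And>x. k (l x) = x" "\<And>x. l (k x) = x"
    using linear_injective_isomorphism[OF l] by metis
  have "inj k" using k by (metis injI)
  have "homeomorphic_maps S3 S3 (map_option (\<lambda>x. l x + a)) (map_option (\<lambda>y. k y + - k a))"
    unfolding homeomorphic_maps_def
  proof (intro conjI ballI)
    show "map_option (\<lambda>y. k y + - k a) (map_option (\<lambda>x. l x + a) x) = x" for x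
      by (cases x) (simp_all add: linear_add[OF k(1)] k)
    show "map_option (\<lambda>x. l x + a) (map_option (\<lambda>y. k y + - k a) x) = x" for x
      by (cases x) (simp_all add: linear_diff[OF l(1)] k)
  qed (rule affine_cont[OF l] affine_cont[OF k(1) \<open>inj k\<close>])+
  then show ?thesis using homeomorphic_map_maps by blast
qed

text \<open>A lower bound \<open>m\<close> common to all \<open>t\<close> is the minimum of
  \<open>norm (l t x)\<close> over the compact set where \<open>t\<close> is in the unit interval
  and \<open>norm x = 1\<close>; injectivity makes it positive. The translation is switched on
  linearly and costs at most \<open>norm a\<close>.\<close>

lemma ambient_isotopy_linear_path:
  fixes l :: "real \<Rightarrow> R3 \<Rightarrow> R3"
  assumes lin: "\<And>t. linear (l t)" and inj: "\<And>t x. t \<in> {0..1} \<Longrightarrow> l t x = 0 \<Longrightarrow> x = 0"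
    and cont: "continuous_on UNIV (\<lambda>(t, x). l t x)" and l0: "\<And>x. l 0 x = x"
  shows "ambient_isotopy (\<lambda>t. map_option (\<lambda>x. l t x + t *\<^sub>R a))"
proof -
  have "compact ({0..1::real} \<times> sphere (0::R3) 1)" by (intro compact_Times) auto
  moreover have "continuous_on ({0..1::real} \<times> sphere (0::R3) 1) (\<lambda>z. norm ((\<lambda>(t, x). l t x) z))"
    by (intro continuous_on_norm continuous_on_subset[OF cont]) auto
  moreover have ne: "{0..1::real} \<times> sphere (0::R3) 1 \<noteq> {}"
    by auto
  ultimately obtain z where z: "z \<in> {0..1} \<times> sphere 0 1"
    "\<And>y. y \<in> {0..1} \<times> sphere 0 1 \<Longrightarrow> norm ((\<lambda>(t, x). l t x) z) \<le> norm ((\<lambda>(t, x). l t x) y)"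
    using continuous_attains_inf by (metis (no_types, lifting))
  define m where "m = norm ((\<lambda>(t, x). l t x) z)"
  have "0 < m" using z(1) inj unfolding m_def by (cases z) fastforce
  have bound: "m * norm x \<le> norm (l t x)" if t: "t \<in> {0..1}" for t x
  proof (cases "x = 0")
    case False
    have "m \<le> norm (l t (x /\<^sub>R norm x))"
      using z(2)[of "(t, x /\<^sub>R norm x)"] t False unfolding m_def by auto
    then show ?thesis
      using False by (simp add: linear_cmul[OF lin] field_simps)
  qed auto
  have "continuous_map (prod_topology (top_of_set {0..1}) S3) S3
      (\<lambda>(t, x). map_option ((\<lambda>x. l t x + t *\<^sub>R a)) x)"
  proof (rule continuous_map_S3_family[OF _ \<open>0 < m\<close>, where b = "norm a"])
    show "continuous_on ({0..1} \<times> UNIV) (\<lambda>(t, x). l t x + t *\<^sub>R a)"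
      using continuous_on_subset[OF cont, of "{0..1} \<times> UNIV"]
      by (auto simp: case_prod_beta intro!: continuous_intros)
    fix t :: real and x assume t: "t \<in> {0..1}"
    have "norm (t *\<^sub>R a) \<le> norm a" using t by (auto intro: mult_left_le_one_le)
    then show "m * norm x \<le> norm (l t x + t *\<^sub>R a) + norm a"
      using bound[OF t, of x] norm_triangle_ineq4[of "l t x + t *\<^sub>R a" "t *\<^sub>R a"] by simp
  qed
  moreover have "homeomorphic_map S3 S3 (map_option (\<lambda>x. l t x + t *\<^sub>R a))" if "t \<in> {0..1}" for t
    using inj[OF that] by (intro homeomorphic_map_S3_affine lin) (simp add: linear_injective_0[OF lin])
  ultimately show ?thesis
    unfolding ambient_isotopy_def by (simp add: l0 option.map_ident)
qed

section \<open>Joining a rotation to the identity by invertible linear maps\<close>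

lemma rotation_matrix_transformation:
  "rotation_matrix Q \<Longrightarrow> orthogonal_transformation ((*v) Q)"
  for Q :: "real^'n^'n"
  by (simp add: orthogonal_transformation_matrix rotation_matrix_def)

lemma rotation_matrix_norm: "rotation_matrix Q \<Longrightarrow> norm (Q *v x) = norm x"
  for Q :: "real^'n^'n"
  by (simp add: rotation_matrix_transformation orthogonal_transformation_norm)

lemma rotation_matrix_inner: "rotation_matrix Q \<Longrightarrow> (Q *v x) \<bullet> (Q *v y) = x \<bullet> y"
  for Q :: "real^'n^'n"
  by (metis rotation_matrix_transformation orthogonal_transformation_def)

text \<open>Euler's rotation theorem: \<open>Q\<close> times the transpose of
  \<open>Q - mat 1\<close> is \<open>mat 1 - Q\<close>, and \<open>det Q = 1\<close>, so
  \<open>Q - mat 1\<close> and its negative have equal determinants; in odd dimension this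
  determinant must be zero.\<close>

lemma rotation_axis:
  fixes Q :: "real^3^3"
  assumes Q: "rotation_matrix Q"
  obtains w where "norm w = 1" "Q *v w = w"
proof -
  have "Q ** transpose (Q - mat 1) = mat 1 - Q"
    using Q by (simp add: rotation_matrix_def orthogonal_matrix_def transpose_def
        matrix_matrix_mult_def vec_eq_iff mat_def right_diff_distrib sum_subtractf) (simp add: if_distrib cong: if_cong)
  then have "det (mat 1 - Q) = det (Q - mat 1)"
    using Q by (metis det_mul det_transpose mult_1 rotation_matrix_def)
  moreover have "det (mat 1 - Q) = - det (Q - mat 1)"
    by (simp add: det_3 mat_def algebra_simps)
  ultimately obtain w where w: "w \<noteq> 0" "(Q - mat 1) *v w = 0"
    using invertible_det_nz[of "Q - mat 1"] invertible_left_inverse[of "Q - mat 1"] matrix_left_invertible_ker[of "Q - mat 1"] by auto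
  then have "Q *v w = w" by (simp add: matrix_vector_mult_diff_rdistrib)
  with w(1) that[of "w /\<^sub>R norm w"] show thesis by (simp add: matrix_vector_mult_scaleR)
qed

text \<open>The segment from the identity to a rotation \<open>Q\<close> consists of invertible maps unless \<open>Q\<close> is a
  half-turn; then adding a multiple of the infinitesimal rotation about its axis repairs it.\<close>

lemma rotation_linear_path:
  fixes Q :: "real^3^3"
  assumes Q: "rotation_matrix Q"
  obtains w where "\<And>t x. t \<in> {0..1} \<Longrightarrow>
    (1 - t) *\<^sub>R x + t *\<^sub>R (Q *v x) + (t * (1 - t)) *\<^sub>R cross3 w x = 0 \<Longrightarrow> x = 0"
proof (cases "\<exists>v. v \<noteq> 0 \<and> Q *v v = - v")
  case False
  show ?thesis
  proof (rule that[of 0])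
    fix t x assume t: "t \<in> {0..1::real}"
      and "(1 - t) *\<^sub>R x + t *\<^sub>R (Q *v x) + (t * (1 - t)) *\<^sub>R cross3 0 x = 0"
    then have eq: "(1 - t) *\<^sub>R x = - (t *\<^sub>R (Q *v x))" by (simp add: eq_neg_iff_add_eq_0)
    \<comment> \<open>Rotations preserve norms, so a nonzero \<open>x\<close> in the kernel forces
      \<open>t = 1/2\<close> and then \<open>Q *v x = - x\<close>, which this case excludes.\<close>
    then have "norm ((1 - t) *\<^sub>R x) = norm (t *\<^sub>R (Q *v x))" by simp
    then have "(1 - t) * norm x = t * norm x" using t rotation_matrix_norm[OF Q, of x] by simp
    show "x = 0"
    proof (rule ccontr)
      assume "x \<noteq> 0"
      then have half: "t = 1/2" using \<open>(1 - t) * norm x = t * norm x\<close> by simp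
      have "(1/2) *\<^sub>R (Q *v x) = (1/2) *\<^sub>R (- x)" using eq unfolding half by simp
      then have "Q *v x = - x" unfolding scaleR_cancel_left by simp
      then show False using False \<open>x \<noteq> 0\<close> by blast
    qed
  qed
next
  case True
  then obtain v0 where v0: "v0 \<noteq> 0" "Q *v v0 = - v0" by blast
  define v where "v = v0 /\<^sub>R norm v0"
  have v: "norm v = 1" "Q *v v = - v"
    using v0 by (simp_all add: v_def matrix_vector_mult_scaleR)
  obtain w where w: "norm w = 1" "Q *v w = w" using rotation_axis[OF Q] by metis
  have wv: "w \<bullet> v = 0" using rotation_matrix_inner[OF Q, of w v] v w by simp
  \<comment> \<open>The third vector of an orthonormal frame in which \<open>Q\<close> fixes
    \<open>w\<close> and negates \<open>v\<close> and \<open>z\<close>.\<close>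
  define z where "z = cross3 w v"
  have Qz: "Q *v z = - z"
    using cross_rotation_matrix[OF Q, of w v] v w by (simp add: z_def)
  show ?thesis
  proof (rule that[of w])
    fix t x assume t: "t \<in> {0..1::real}"
      and eq: "(1 - t) *\<^sub>R x + t *\<^sub>R (Q *v x) + (t * (1 - t)) *\<^sub>R cross3 w x = 0"
    have coord: "(1 - t) * (x \<bullet> y) + t * ((Q *v x) \<bullet> y) + (t * (1 - t)) * (cross3 w x \<bullet> y) = 0" for y
      using arg_cong[OF eq, of "\<lambda>z. z \<bullet> y"] by (simp add: inner_add_left)
    have xw: "x \<bullet> w = 0"
      using coord[of w] rotation_matrix_inner[OF Q, of x w] w
      by (simp add: dot_cross_self algebra_simps)
    have "(Q *v x) \<bullet> v = - (x \<bullet> v)" "(Q *v x) \<bullet> z = - (x \<bullet> z)"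
      using rotation_matrix_inner[OF Q, of x v] rotation_matrix_inner[OF Q, of x z] v Qz
      by auto
    moreover have "cross3 w x \<bullet> v = - (x \<bullet> z)"
      unfolding z_def by (simp add: cross3_simps)
    moreover have "cross3 w x \<bullet> z = x \<bullet> v"
    proof -
      have "cross3 w x \<bullet> z = (w \<bullet> w) * (x \<bullet> v) - (w \<bullet> v) * (x \<bullet> w)"
        unfolding z_def by (simp add: dot_cross inner_commute)
      then show ?thesis using w(1) wv by (simp add: norm_eq_1)
    qed
    ultimately have e: "(1 - 2 * t) * (x \<bullet> v) = t * (1 - t) * (x \<bullet> z)"
        "(1 - 2 * t) * (x \<bullet> z) = - (t * (1 - t) * (x \<bullet> v))"
      using coord[of v] coord[of z] by (simp_all add: algebra_simps)
    \<comment> \<open>The determinant of the linear system \<open>e\<close> in the coordinates of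
      \<open>x\<close> along \<open>v\<close> and \<open>z\<close>. It never vanishes: the first
      square is zero only at \<open>t = 1/2\<close>, where the second is positive.\<close>
    let ?s = "(1 - 2 * t)\<^sup>2 + (t * (1 - t))\<^sup>2"
    have "?s * (x \<bullet> v) = 0" "?s * (x \<bullet> z) = 0"
      using e by algebra+
    moreover have "?s \<noteq> 0"
      by (auto simp: sum_power2_eq_zero_iff)
    ultimately have 0: "x \<bullet> v = 0" "x \<bullet> z = 0" by auto
    \<comment> \<open>Being orthogonal to \<open>w\<close> and \<open>v\<close>, the vector
      \<open>x\<close> is parallel to \<open>z\<close>; but it is orthogonal to \<open>z\<close> as
      well.\<close>
    have "cross3 x z = (x \<bullet> v) *\<^sub>R w - (x \<bullet> w) *\<^sub>R v"
      unfolding z_def by (rule Lagrange)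
    then have "cross3 x z = 0" using 0 xw by simp
    moreover have "z \<noteq> 0"
      using w(1) v(1) wv norm_and_cross_eq_0[of w v] by (auto simp: z_def)
    ultimately show "x = 0" using 0(2) norm_and_cross_eq_0 by blast
  qed
qed

section \<open>Isotopy of pairs as an equivalence relation\<close>

lemma ambient_isotopy_compose:
  assumes H: "ambient_isotopy H" and K: "ambient_isotopy K"
  shows "ambient_isotopy (\<lambda>t x. K t (H t x))"
proof -
  let ?X = "prod_topology (top_of_set {0..1::real}) S3"
  have "continuous_map ?X ?X (\<lambda>z. (fst z, (\<lambda>(t, x). H t x) z))"
    using H unfolding ambient_isotopy_def
    by (intro continuous_map_pairedI continuous_map_fst) auto
  then have "continuous_map ?X S3 ((\<lambda>(t, x). K t x) \<circ> (\<lambda>z. (fst z, (\<lambda>(t, x). H t x) z)))"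
    using K unfolding ambient_isotopy_def by (intro continuous_map_compose) auto
  moreover have "homeomorphic_map S3 S3 (\<lambda>x. K t (H t x))" if "t \<in> {0..1}" for t
    using homeomorphic_map_compose[of S3 S3 "H t" S3 "K t"] H K that
    unfolding ambient_isotopy_def by (simp add: o_def)
  ultimately show ?thesis
    using H K unfolding ambient_isotopy_def by (simp add: o_def case_prod_unfold)
qed

text \<open>Run \<open>H\<close> backwards from its final map: \<open>H (1 - t)\<close> after the
  inverse of \<open>H 1\<close> is the identity at \<open>t = 0\<close> and that inverse at
  \<open>t = 1\<close>.\<close>

lemma ambient_isotopy_reverse:
  assumes H: "ambient_isotopy H"
  obtains K where "ambient_isotopy K" "\<And>x. K 1 (H 1 x) = x"
proof -
  let ?X = "prod_topology (top_of_set {0..1::real}) S3"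
  obtain g where g: "homeomorphic_maps S3 S3 (H 1) g"
    using H unfolding ambient_isotopy_def homeomorphic_map_maps by force
  then have cont: "continuous_map S3 S3 g" and inv: "\<And>x. g (H 1 x) = x" "\<And>x. H 1 (g x) = x"
    unfolding homeomorphic_maps_def by auto
  have homeo: "homeomorphic_map S3 S3 g"
    using g homeomorphic_maps_sym homeomorphic_map_maps by blast
  have "continuous_map (top_of_set {0..1::real}) (top_of_set {0..1}) (\<lambda>t. 1 - t)"
    by (auto intro!: continuous_intros)
  then have "continuous_map ?X (top_of_set {0..1::real}) ((\<lambda>t. 1 - t) \<circ> fst)"
    using continuous_map_compose continuous_map_fst by blast
  moreover have "continuous_map ?X S3 (g \<circ> snd)"
    using continuous_map_compose continuous_map_snd cont by blast
  ultimately have "continuous_map ?X ?X (\<lambda>z. (((\<lambda>t. 1 - t) \<circ> fst) z, (g \<circ> snd) z))"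
    by (rule continuous_map_pairedI)
  then have "continuous_map ?X S3 ((\<lambda>(t, x). H t x) \<circ> (\<lambda>z. (((\<lambda>t. 1 - t) \<circ> fst) z, (g \<circ> snd) z)))"
    using H unfolding ambient_isotopy_def by (intro continuous_map_compose) auto
  then have "continuous_map ?X S3 (\<lambda>(t, x). H (1 - t) (g x))"
    by (simp add: o_def case_prod_unfold)
  moreover have "homeomorphic_map S3 S3 (\<lambda>x. H (1 - t) (g x))" if "t \<in> {0..1}" for t
    using homeomorphic_map_compose[of S3 S3 g S3 "H (1 - t)"] H homeo that
    unfolding ambient_isotopy_def by (simp add: o_def)
  ultimately have "ambient_isotopy (\<lambda>t x. H (1 - t) (g x))"
    using inv unfolding ambient_isotopy_def by simp
  then show ?thesis using that[of "\<lambda>t x. H (1 - t) (g x)"] H inv unfolding ambient_isotopy_def by simp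
qed

lemma isotopic_pairs_sym:
  assumes "isotopic_pairs P Q" shows "isotopic_pairs Q P"
proof -
  obtain H where H: "ambient_isotopy H" "H 1 ` fst P = fst Q" "H 1 ` snd P = snd Q"
    using assms unfolding isotopic_pairs_def by blast
  obtain K where K: "ambient_isotopy K" "\<And>x. K 1 (H 1 x) = x"
    using ambient_isotopy_reverse[OF H(1)] by metis
  show ?thesis unfolding isotopic_pairs_def
    using K(1) by (intro exI[of _ K]) (auto simp: image_image K(2) simp flip: H(2,3))
qed

lemma isotopic_pairs_trans:
  assumes "isotopic_pairs P Q" "isotopic_pairs Q R" shows "isotopic_pairs P R"
proof -
  obtain H where H: "ambient_isotopy H" "H 1 ` fst P = fst Q" "H 1 ` snd P = snd Q"
    using assms(1) unfolding isotopic_pairs_def by blast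
  obtain K where K: "ambient_isotopy K" "K 1 ` fst Q = fst R" "K 1 ` snd Q = snd R"
    using assms(2) unfolding isotopic_pairs_def by blast
  show ?thesis unfolding isotopic_pairs_def
    using ambient_isotopy_compose[OF H(1) K(1)]
    by (intro exI[of _ "\<lambda>t x. K t (H t x)"]) (simp add: H K flip: image_image[of "K 1" "H 1"])
qed

lemma isotopic_pairs_rigid:
  assumes "rigid g"
  shows "isotopic_pairs (Some ` X, Some ` Y) (Some ` g ` X, Some ` g ` Y)"
proof -
  obtain Q a where Q: "rotation_matrix Q" and g: "g = (\<lambda>x. Q *v x + a)"
    using assms unfolding rigid_def by blast
  obtain w where w: "\<And>t x. t \<in> {0..1} \<Longrightarrow>
    (1 - t) *\<^sub>R x + t *\<^sub>R (Q *v x) + (t * (1 - t)) *\<^sub>R cross3 w x = 0 \<Longrightarrow> x = 0"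
    using rotation_linear_path[OF Q] by metis
  \<comment> \<open>The correction carries the factor \<open>t * (1 - t)\<close>, so the path still
    starts at the identity and ends at \<open>Q\<close>.\<close>
  let ?l = "\<lambda>t x. (1 - t) *\<^sub>R x + t *\<^sub>R (Q *v x) + (t * (1 - t)) *\<^sub>R cross3 w x"
  have lin: "linear (?l t)" for t
    by (rule linearI) (simp_all add: algebra_simps matrix_vector_right_distrib
        matrix_vector_mult_scaleR cross_add_right cross_mult_right)
  have cont: "continuous_on UNIV (\<lambda>(t, x). ?l t x)"
    unfolding case_prod_beta
    by (intro continuous_intros continuous_on_cross
        bounded_linear.continuous_on[OF matrix_vector_mul_bounded_linear])
  have iso: "ambient_isotopy (\<lambda>t. map_option (\<lambda>x. ?l t x + t *\<^sub>R a))"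
    by (rule ambient_isotopy_linear_path[where l = ?l, OF lin w cont]) simp_all
  show ?thesis
    unfolding isotopic_pairs_def
    by (intro exI[of _ "\<lambda>t. map_option (\<lambda>x. ?l t x + t *\<^sub>R a)"])
       (simp add: iso g image_image)
qed

lemma ess_type_eq_if_isotopic:
  assumes "isotopic_pairs (Some ` \<gamma>, Some ` F) (Some ` \<gamma>', Some ` F')"
  shows "ess_type \<gamma> F = ess_type \<gamma>' F'"
proof -
  have "isotopic_pairs (Some ` \<gamma>, Some ` F) Q \<longleftrightarrow> isotopic_pairs (Some ` \<gamma>', Some ` F') Q" for Q
    using isotopic_pairs_trans[OF assms] isotopic_pairs_trans[OF isotopic_pairs_sym[OF assms]]
    by (intro iffI)
  then show ?thesis unfolding ess_type_def by simp
qed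

section \<open>Invariance under rigid motions\<close>

declare transpose_matrix_vector [simp del]

text \<open>The linear part \<open>Q\<close> is named because it is what acts on tangent and normal
  vectors; the translation is \<open>g 0\<close>.\<close>

definition rigid_with :: "real^3^3 \<Rightarrow> (R3 \<Rightarrow> R3) \<Rightarrow> bool" where
  "rigid_with Q g \<longleftrightarrow> rotation_matrix Q \<and> (\<forall>x. g x = Q *v x + g 0)"

lemma rigid_imp_rigid_with: "rigid g \<Longrightarrow> \<exists>Q. rigid_with Q g"
  unfolding rigid_def rigid_with_def by fastforce

lemma rigid_with_diff: "rigid_with Q g \<Longrightarrow> g y - g x = Q *v (y - x)"
  unfolding rigid_with_def by (metis add_diff_cancel_right matrix_vector_mult_diff_distrib)

lemma rigid_with_add: "rigid_with Q g \<Longrightarrow> g (x + u) = g x + Q *v u"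
  using rigid_with_diff[of Q g "x + u" x] by (simp add: algebra_simps)

lemma rigid_with_rotation: "rigid_with Q g \<Longrightarrow> rotation_matrix Q"
  unfolding rigid_with_def by simp

lemmas rigid_with_norm = rotation_matrix_norm[OF rigid_with_rotation]
lemmas rigid_with_inner = rotation_matrix_inner[OF rigid_with_rotation]

lemma rigid_with_dist: "rigid_with Q g \<Longrightarrow> dist (g x) (g y) = dist x y"
  by (simp add: dist_norm rigid_with_diff rigid_with_norm)

text \<open>An inclusion proved for all rigid motions becomes an equality when it is applied to the
  inverse motion too. Interiors, tangent cones, arc distances and interior points of surfaces are
  treated in this way.\<close>

lemma rigid_with_inverse:
  assumes "rigid_with Q g"
  obtains h where "rigid_with (transpose Q) h" "\<And>x. g (h x) = x" "\<And>x. h (g x) = x"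
    "\<And>v. transpose Q *v (Q *v v) = v" "\<And>v. Q *v (transpose Q *v v) = v"
proof -
  have Q: "rotation_matrix Q" and g: "\<And>x. g x = Q *v x + g 0"
    using assms unfolding rigid_with_def by blast+
  have QT: "rotation_matrix (transpose Q)"
    using Q by (simp add: rotation_matrix_def orthogonal_matrix_transpose)
  have inv: "transpose Q *v (Q *v v) = v" "Q *v (transpose Q *v v) = v" for v
    using Q by (simp_all add: rotation_matrix_def orthogonal_matrix_def matrix_vector_mul_assoc)
  define h where "h x = transpose Q *v x - transpose Q *v g 0" for x
  show thesis
  proof (rule that[of h])
    show "rigid_with (transpose Q) h"
      unfolding rigid_with_def h_def using QT by simp
    show "g (h x) = x" for x
      by (subst g) (simp add: h_def inv matrix_vector_mult_diff_distrib)
    show "h (g x) = x" for x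
      unfolding h_def by (subst g) (simp add: inv matrix_vector_right_distrib)
  qed (rule inv)+
qed

lemma rigid_with_inj: "rigid_with Q g \<Longrightarrow> inj g"
  by (metis injI rigid_with_inverse)

lemma rigid_with_mem_image_iff: "rigid_with Q g \<Longrightarrow> g x \<in> g ` S \<longleftrightarrow> x \<in> S"
  using rigid_with_inj inj_image_mem_iff by metis

lemma rigid_with_has_derivative:
  assumes "rigid_with Q g" shows "(g has_derivative (*v) Q) F"
proof -
  have "((\<lambda>x. Q *v x + g 0) has_derivative (\<lambda>x. Q *v x + 0)) F"
    by (intro has_derivative_add has_derivative_const
        bounded_linear_imp_has_derivative matrix_vector_mul_bounded_linear)
  moreover have "(\<lambda>x. Q *v x + g 0) = g"
    using assms unfolding rigid_with_def by (intro ext) (rule sym, blast)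
  ultimately show ?thesis by simp
qed

lemma rigid_with_continuous: "rigid_with Q g \<Longrightarrow> continuous_on S g"
  by (rule has_derivative_continuous_on) (rule rigid_with_has_derivative)

lemma rigid_with_homeomorphism:
  assumes "rigid_with Q g" obtains h where "homeomorphism S (g ` S) g h"
proof -
  obtain h where h: "rigid_with (transpose Q) h" "\<And>x. g (h x) = x" "\<And>x. h (g x) = x"
    using rigid_with_inverse[OF assms] by metis
  have "homeomorphism S (g ` S) g h"
    unfolding homeomorphism_def
    using h rigid_with_continuous[OF assms] rigid_with_continuous[OF h(1)] by (auto simp: image_image)
  then show thesis by (rule that)
qed

lemma infdist_rigid_with: "rigid_with Q g \<Longrightarrow> infdist (g x) (g ` S) = infdist x S"
  unfolding infdist_def by (simp add: image_image rigid_with_dist)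

lemma interior_rigid_with:
  assumes "rigid_with Q g" shows "interior (g ` S) = g ` interior S"
proof -
  have sub: "g ` interior S \<subseteq> interior (g ` S)" if g: "rigid_with Q g" for Q g S
  proof -
    obtain h where h: "rigid_with (transpose Q) h" "\<And>x. g (h x) = x" "\<And>x. h (g x) = x"
      using rigid_with_inverse[OF g] by metis
    have "g ` interior S = h -` interior S"
      using h by (auto simp: image_iff) metis
    then have "open (g ` interior S)"
      using rigid_with_continuous[OF h(1)] by (simp add: continuous_on_open_vimage open_vimage)
    then show ?thesis by (intro interior_maximal image_mono interior_subset)
  qed
  obtain h where h: "rigid_with (transpose Q) h" "\<And>x. g (h x) = x" "\<And>x. h (g x) = x"
    using rigid_with_inverse[OF assms] by metis
  have "h ` interior (g ` S) \<subseteq> interior S"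
    using sub[OF h(1), of "g ` S"] h by (simp add: image_image)
  then have "g ` h ` interior (g ` S) \<subseteq> g ` interior S" by blast
  then show ?thesis using sub[OF assms] h(2) by (simp add: image_image subset_antisym)
qed

lemma image_Compl_rigid_with:
  assumes "rigid_with Q g" shows "g ` (- S) = - g ` S"
proof -
  obtain h where h: "\<And>x. g (h x) = x" "\<And>x. h (g x) = x"
    using rigid_with_inverse[OF assms] by metis
  have "surj g" using h(1) by (metis surjI)
  then show ?thesis using rigid_with_inj[OF assms] by (simp add: bij_def bij_image_Compl_eq)
qed

lemma frontier_rigid_with:
  assumes "rigid_with Q g" shows "frontier (g ` S) = g ` frontier S"
proof -
  have "closure (g ` S) = g ` closure S"
    unfolding closure_interior image_Compl_rigid_with[OF assms, symmetric]
      interior_rigid_with[OF assms] ..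
  then show ?thesis
    unfolding frontier_def interior_rigid_with[OF assms] image_set_diff[OF rigid_with_inj[OF assms]]
    by simp
qed

section \<open>Tangent cones, curves and tubes under rigid motions\<close>

lemma tan_cone_rigid_with:
  assumes "rigid_with Q g" shows "tan_cone (g ` S) (g x) = (*v) Q ` tan_cone S x"
proof -
  have sub: "(*v) Q ` tan_cone S x \<subseteq> tan_cone (g ` S) (g x)" if g: "rigid_with Q g" for Q g S x
  proof clarify
    fix v assume "v \<in> tan_cone S x"
    then obtain y t where yt: "\<And>n::nat. y n \<in> S \<and> 0 \<le> t n" "y \<longlonglongrightarrow> x"
        "(\<lambda>n. t n *\<^sub>R (y n - x)) \<longlonglongrightarrow> v"
      unfolding tan_cone_def by blast
    have "(\<lambda>n. g (y n)) \<longlonglongrightarrow> g x"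
      using continuous_on_tendsto_compose[OF rigid_with_continuous[OF g, of UNIV] yt(2)] by simp
    moreover have "(\<lambda>n. t n *\<^sub>R (g (y n) - g x)) \<longlonglongrightarrow> Q *v v"
      using bounded_linear.tendsto[OF matrix_vector_mul_bounded_linear yt(3), of Q]
      by (simp add: rigid_with_diff[OF g] matrix_vector_mult_scaleR)
    ultimately show "Q *v v \<in> tan_cone (g ` S) (g x)"
      unfolding tan_cone_def using yt(1) by (intro CollectI exI[of _ "\<lambda>n. g (y n)"] exI[of _ t]) blast
  qed
  obtain h where h: "rigid_with (transpose Q) h" "\<And>x. g (h x) = x" "\<And>x. h (g x) = x"
      "\<And>v. Q *v (transpose Q *v v) = v"
    using rigid_with_inverse[OF assms] by metis
  have "(*v) (transpose Q) ` tan_cone (g ` S) (g x) \<subseteq> tan_cone S x"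
    using sub[OF h(1), of "g ` S" "g x"] h by (simp add: image_image)
  then have "(*v) Q ` (*v) (transpose Q) ` tan_cone (g ` S) (g x) \<subseteq> (*v) Q ` tan_cone S x" by blast
  then show ?thesis using sub[OF assms] h(4) by (simp add: image_image subset_antisym)
qed

lemma tan_space_rigid_with:
  "rigid_with Q g \<Longrightarrow> tan_space (g ` S) (g x) = (*v) Q ` tan_space S x"
  unfolding tan_space_def by (simp add: tan_cone_rigid_with linear_span_image)

lemma normal_space_rigid_with:
  assumes "rigid_with Q g" shows "normal_space (g ` S) (g x) = (*v) Q ` normal_space S x"
proof -
  have inv: "\<And>v. Q *v (transpose Q *v v) = v"
    using rigid_with_inverse[OF assms] by metis
  have mem: "Q *v v \<in> normal_space (g ` S) (g x) \<longleftrightarrow> v \<in> normal_space S x" for v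
    unfolding normal_space_def orthogonal_comp_def tan_space_rigid_with[OF assms]
    by (simp add: orthogonal_def rigid_with_inner[OF assms])
  show ?thesis
  proof (intro set_eqI iffI)
    fix v assume "v \<in> normal_space (g ` S) (g x)"
    then show "v \<in> (*v) Q ` normal_space S x"
      using mem[of "transpose Q *v v"] inv[of v] by (metis imageI)
  qed (use mem in blast)
qed

lemma arclength_param_rigid_with:
  assumes g: "rigid_with Q g" and "arclength_param c L \<gamma>"
  shows "arclength_param (g \<circ> c) L (g ` \<gamma>)"
proof -
  obtain c' B where c: "0 < L" "\<gamma> = range c" "inj_on c {0..<L}" "\<And>s. c (s + L) = c s"
     "\<And>s. (c has_vector_derivative c' s) (at s)" "\<And>s. norm (c' s) = 1" "B-lipschitz_on UNIV c'"
    using assms(2) unfolding arclength_param_def by blast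
  have "(g \<circ> c has_vector_derivative Q *v c' s) (at s)" for s
  proof -
    have "(g \<circ> c has_derivative (*v) Q \<circ> (\<lambda>t. t *\<^sub>R c' s)) (at s)"
      using c(5)[of s] rigid_with_has_derivative[OF g] unfolding has_vector_derivative_def
      by (intro diff_chain_at) auto
    then show ?thesis
      unfolding has_vector_derivative_def by (simp add: o_def matrix_vector_mult_scaleR)
  qed
  moreover have "B-lipschitz_on UNIV (\<lambda>s. Q *v c' s)"
    using c(7) unfolding lipschitz_on_def dist_norm
    by (simp add: rigid_with_norm[OF g] flip: matrix_vector_mult_diff_distrib)
  moreover have "inj_on (g \<circ> c) {0..<L}"
    using c(3) rigid_with_inj[OF g] by (meson comp_inj_on inj_on_subset subset_UNIV)
  ultimately show ?thesis
    unfolding arclength_param_def using c(1,2,4,6)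
    by (auto simp: rigid_with_norm[OF g] image_comp intro!: exI[of _ "\<lambda>s. Q *v c' s"])
qed

lemma embedded_tube_rigid_with:
  assumes g: "rigid_with Q g" and e: "embedded_tube \<gamma> r"
  shows "embedded_tube (g ` \<gamma>) r"
  unfolding embedded_tube_def
proof (rule inj_onI, clarify)
  fix p u q v
  assume uv: "u \<in> normal_space (g ` \<gamma>) (g p)" "v \<in> normal_space (g ` \<gamma>) (g q)"
    "norm u < r" "norm v < r" and pq: "p \<in> \<gamma>" "q \<in> \<gamma>" and eq: "g p + u = g q + v"
  obtain u' v' where u': "u = Q *v u'" "u' \<in> normal_space \<gamma> p" and v': "v = Q *v v'" "v' \<in> normal_space \<gamma> q"
    using uv unfolding normal_space_rigid_with[OF g] by blast
  have "norm u' < r" "norm v' < r" using uv u' v' rigid_with_norm[OF g] by simp_all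
  moreover have "g (p + u') = g (q + v')" using eq u' v' by (simp add: rigid_with_add[OF g])
  then have "p + u' = q + v'" using rigid_with_inj[OF g] by (simp add: inj_eq)
  ultimately have "(p, u') = (q, v')"
    using e u' v' pq unfolding embedded_tube_def
    by (intro inj_onD[of "\<lambda>(p, u). p + u" _ "(p, u')" "(q, v')"]) auto
  then show "g p = g q \<and> u = v" using u' v' by simp
qed

text \<open>The inequality is the form in which stability uses thickness: it asks for at least
  \<open>1\<close> on the normalized curves.\<close>

lemma Thi_rigid_with: "rigid_with Q g \<Longrightarrow> Thi \<gamma> \<le> Thi (g ` \<gamma>)"
  unfolding Thi_def by (intro SUP_subset_mono) (auto intro: embedded_tube_rigid_with)

lemma normal_tube_rigid_with:
  assumes g: "rigid_with Q g" shows "normal_tube (g ` \<gamma>) = g ` normal_tube \<gamma>"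
proof -
  have "x \<in> g ` normal_tube \<gamma>" if x: "x \<in> normal_tube (g ` \<gamma>)" for x
  proof -
    obtain p u where pu: "x = g p + u" "p \<in> \<gamma>" "u \<in> normal_space (g ` \<gamma>) (g p)" "norm u \<le> rho0"
      using x unfolding normal_tube_def by blast
    then obtain v where v: "u = Q *v v" "v \<in> normal_space \<gamma> p"
      unfolding normal_space_rigid_with[OF g] by blast
    have "x = g (p + v)" using pu v by (simp add: rigid_with_add[OF g])
    moreover have "p + v \<in> normal_tube \<gamma>"
      unfolding normal_tube_def using pu v rigid_with_norm[OF g, of v] by auto
    ultimately show ?thesis by blast
  qed
  moreover have "g x \<in> normal_tube (g ` \<gamma>)" if x: "x \<in> normal_tube \<gamma>" for x
  proof -
    obtain p u where pu: "x = p + u" "p \<in> \<gamma>" "u \<in> normal_space \<gamma> p" "norm u \<le> rho0"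
      using x unfolding normal_tube_def by blast
    then have "Q *v u \<in> normal_space (g ` \<gamma>) (g p)"
      unfolding normal_space_rigid_with[OF g] by blast
    then show ?thesis
      using pu unfolding normal_tube_def pu(1) rigid_with_add[OF g] mem_Collect_eq
      by (intro exI[of _ "g p"] exI[of _ "Q *v u"]) (simp add: rigid_with_norm[OF g])
  qed
  ultimately show ?thesis by blast
qed

lemma tube_bd_rigid_with: "rigid_with Q g \<Longrightarrow> tube_bd (g ` \<gamma>) = g ` tube_bd \<gamma>"
  unfolding tube_bd_def by (simp add: normal_tube_rigid_with frontier_rigid_with)

lemma reach_ge_rigid_with:
  assumes g: "rigid_with Q g" and r: "reach_ge F r" shows "reach_ge (g ` F) r"
  unfolding reach_ge_def
proof (intro allI impI)
  fix x assume x: "infdist x (g ` F) < r"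
  obtain y where y: "x = g y" using rigid_with_inverse[OF g] by metis
  have "infdist y F < r" using x by (simp add: y infdist_rigid_with[OF g])
  then obtain z where z: "z \<in> F" "dist y z = infdist y F"
      "\<And>z'. z' \<in> F \<Longrightarrow> dist y z' = infdist y F \<Longrightarrow> z' = z"
    using r unfolding reach_ge_def by metis
  show "\<exists>!w. w \<in> g ` F \<and> dist x w = infdist x (g ` F)"
    by (rule ex1I[of _ "g z"]) (auto simp: y infdist_rigid_with[OF g] rigid_with_dist[OF g] z(1,2) dest: z(3))
qed

lemma arc_dist_rigid_with:
  assumes g: "rigid_with Q g" shows "arc_dist (g ` \<gamma>) (g p) (g q) = arc_dist \<gamma> p q"
proof -
  have sub: "{\<bar>s - t\<bar> | s t. \<exists>c L. arclength_param c L \<gamma> \<and> c s = p \<and> c t = q}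
     \<subseteq> {\<bar>s - t\<bar> | s t. \<exists>c L. arclength_param c L (g ` \<gamma>) \<and> c s = g p \<and> c t = g q}"
    if "rigid_with Q g" for Q g \<gamma> p q
  proof clarify
    fix s t c L assume "arclength_param c L \<gamma>"
    then have "arclength_param (g \<circ> c) L (g ` \<gamma>)" by (rule arclength_param_rigid_with[OF that])
    then show "\<exists>s' t'. \<bar>s - t\<bar> = \<bar>s' - t'\<bar> \<and>
        (\<exists>c' L. arclength_param c' L (g ` \<gamma>) \<and> c' s' = g (c s) \<and> c' t' = g (c t))"
      by (metis comp_apply)
  qed
  obtain h where h: "rigid_with (transpose Q) h" "\<And>x. h (g x) = x"
    using rigid_with_inverse[OF g] by metis
  have "{\<bar>s - t\<bar> | s t. \<exists>c L. arclength_param c L (g ` \<gamma>) \<and> c s = g p \<and> c t = g q}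
      \<subseteq> {\<bar>s - t\<bar> | s t. \<exists>c L. arclength_param c L \<gamma> \<and> c s = p \<and> c t = q}"
    using sub[OF h(1), where \<gamma> = "g ` \<gamma>" and p = "g p" and q = "g q"]
    by (simp add: h(2) image_image)
  from subset_antisym[OF this sub[OF g, where \<gamma> = \<gamma> and p = p and q = q]] show ?thesis
    unfolding arc_dist_def by (rule arg_cong)
qed

lemma components_rigid_with:
  assumes g: "rigid_with Q g" shows "components (g ` S) = (`) g ` components S"
proof -
  obtain h where "homeomorphism S (g ` S) g h" using rigid_with_homeomorphism[OF g] by metis
  then have "homeomorphic_map (top_of_set S) (top_of_set (g ` S)) g"
    unfolding homeomorphic_map_maps homeomorphic_maps_def homeomorphism_def by auto
  from homeomorphic_map_connected_components_of[OF this] show ?thesis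
    unfolding connected_components_of_def components_def connected_component_of_def[abs_def]
      connected_component_def[abs_def]
    by (simp add: connectedin_subtopology conj_assoc)
qed

section \<open>Charts and proper surfaces under rigid motions\<close>

text \<open>By the chain rule the new derivative is the old one followed by \<open>Q\<close>. The
  Lipschitz constant of a chart is existentially quantified, so the crude factor
  \<open>norm q\<close> is harmless.\<close>

lemma C11_chart_rigid_with:
  assumes g: "rigid_with Q g" and "C11_chart D f F x"
  shows "C11_chart D (g \<circ> f) (g ` F) (g x)"
proof -
  obtain k f' B where f: "0 \<in> D" "f 0 = x" "openin (top_of_set F) (f ` D)" "homeomorphism D (f ` D) f k"
    and f': "\<And>a. a \<in> D \<Longrightarrow> (f has_derivative blinfun_apply (f' a)) (at a within D)"
      "\<And>a. a \<in> D \<Longrightarrow> inj (blinfun_apply (f' a))" and B: "B-lipschitz_on D f'"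
    using assms(2) unfolding C11_chart_def by blast
  obtain h where "homeomorphism F (g ` F) g h" using rigid_with_homeomorphism[OF g] .
  then have "openin (top_of_set (g ` F)) (g ` f ` D)"
    using f(3) by (rule homeomorphism_imp_open_map)
  moreover obtain h' where "homeomorphism (f ` D) (g ` f ` D) g h'" using rigid_with_homeomorphism[OF g] .
  then have "homeomorphism D (g ` f ` D) (g \<circ> f) (k \<circ> h')"
    using f(4) homeomorphism_compose by blast
  moreover define q where "q = Blinfun ((*v) Q)"
  have q: "blinfun_apply q = (*v) Q"
    unfolding q_def by (intro bounded_linear_Blinfun_apply matrix_vector_mul_bounded_linear)
  have comp: "blinfun_apply (q o\<^sub>L f' a) = (*v) Q \<circ> blinfun_apply (f' a)" for a
    by (simp add: fun_eq_iff q)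
  have "(g \<circ> f has_derivative blinfun_apply (q o\<^sub>L f' a)) (at a within D)" if "a \<in> D" for a
    unfolding comp by (intro diff_chain_within f'(1) that rigid_with_has_derivative[OF g])
  moreover have "inj (blinfun_apply (q o\<^sub>L f' a))" if "a \<in> D" for a
  proof -
    have "inj ((*v) Q)"
      using rigid_with_inverse[OF g] by (metis injI)
    then show ?thesis
      unfolding comp using f'(2)[OF that] by (rule inj_compose)
  qed
  moreover have "(norm q * B)-lipschitz_on D (\<lambda>a. q o\<^sub>L f' a)"
  proof (rule lipschitz_onI)
    show "0 \<le> norm q * B" using lipschitz_on_nonneg[OF B] by simp
    fix a b assume ab: "a \<in> D" "b \<in> D"
    have "dist (q o\<^sub>L f' a) (q o\<^sub>L f' b) = norm (q o\<^sub>L (f' a - f' b))"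
      by (simp add: dist_norm bounded_bilinear.diff_right[OF bounded_bilinear_blinfun_compose])
    also have "\<dots> \<le> norm q * dist (f' a) (f' b)"
      by (simp add: dist_norm norm_blinfun_compose)
    also have "\<dots> \<le> norm q * (B * dist a b)"
      using lipschitz_onD[OF B ab] by (intro mult_left_mono) auto
    finally show "dist (q o\<^sub>L f' a) (q o\<^sub>L f' b) \<le> norm q * B * dist a b" by simp
  qed
  ultimately show ?thesis
    unfolding C11_chart_def using f(1,2)
    by (simp add: image_comp)
       (intro conjI exI[of _ "k \<circ> h'"] exI[of _ "\<lambda>a. q o\<^sub>L f' a"] exI[of _ "norm q * B"] ballI; blast)
qed

lemma surf_int_rigid_with:
  assumes g: "rigid_with Q g" shows "surf_int (g ` F) = g ` surf_int F"
proof -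
  have sub: "g ` surf_int F \<subseteq> surf_int (g ` F)" if "rigid_with Q g" for Q g F
    unfolding surf_int_def using C11_chart_rigid_with[OF that, of "ball 0 1"] by blast
  obtain h where h: "rigid_with (transpose Q) h" "\<And>x. g (h x) = x" "\<And>x. h (g x) = x"
    using rigid_with_inverse[OF g] by metis
  have "h ` surf_int (g ` F) \<subseteq> surf_int F"
    using sub[OF h(1), of "g ` F"] h by (simp add: image_image)
  then have "g ` h ` surf_int (g ` F) \<subseteq> g ` surf_int F" by (rule image_mono)
  then show ?thesis using sub[OF g, of F] h(2) by (simp add: image_image subset_antisym)
qed

lemma surf_bd_rigid_with:
  assumes g: "rigid_with Q g" shows "surf_bd (g ` F) = g ` surf_bd F"
  unfolding surf_bd_def surf_int_rigid_with[OF g] image_set_diff[OF rigid_with_inj[OF g]] ..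

lemma proper_C11_surface_rigid_with:
  assumes g: "rigid_with Q g" and F: "proper_C11_surface \<gamma> F"
  shows "proper_C11_surface (g ` \<gamma>) (g ` F)"
proof -
  have "compact (g ` F)"
    using F rigid_with_continuous[OF g] unfolding proper_C11_surface_def C11_surface_def
    by (intro compact_continuous_image) blast+
  moreover have "\<exists>f. C11_chart {a \<in> ball 0 1. a$2 \<ge> 0} f (g ` F) x" if x: "x \<in> surf_bd (g ` F)" for x
  proof -
    obtain y where y: "y \<in> surf_bd F" "x = g y" using x unfolding surf_bd_rigid_with[OF g] by blast
    then obtain f where "C11_chart {a \<in> ball 0 1. a$2 \<ge> 0} f F y"
      using F unfolding proper_C11_surface_def C11_surface_def by blast
    from C11_chart_rigid_with[OF g this] y show ?thesis by blast
  qed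
  moreover have "g ` F \<subseteq> - interior (normal_tube (g ` \<gamma>))"
    using F unfolding proper_C11_surface_def normal_tube_rigid_with[OF g] interior_rigid_with[OF g]
      image_Compl_rigid_with[OF g, symmetric] by (intro image_mono) blast
  moreover have "surf_bd (g ` F) = g ` F \<inter> tube_bd (g ` \<gamma>)"
    using F unfolding proper_C11_surface_def surf_bd_rigid_with[OF g] tube_bd_rigid_with[OF g]
    by (simp add: image_Int[OF rigid_with_inj[OF g]])
  ultimately show ?thesis
    using F unfolding proper_C11_surface_def C11_surface_def by blast
qed

section \<open>The clauses of relative thickness under rigid motions\<close>

text \<open>The rotation is absorbed by the frame, \<open>R\<close> becoming \<open>Q ** R\<close>,
  so the height function \<open>u\<close> and all its bounds stay the same.\<close>

lemma graph_pt_rigid_with: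
  "rigid_with Q g \<Longrightarrow> graph_pt (g x) (Q ** R) u a = g (graph_pt x R u a)"
  unfolding graph_pt_def by (simp add: rigid_with_add matrix_vector_mul_assoc)

lemma image_graph_pt_rigid_with:
  "rigid_with Q g \<Longrightarrow> graph_pt (g x) (Q ** R) u ` D = g ` graph_pt x R u ` D"
  by (simp add: graph_pt_rigid_with image_image)

lemma horizontal_frame_rigid_with:
  assumes g: "rigid_with Q g" and R: "horizontal_frame F x R"
  shows "horizontal_frame (g ` F) (g x) (Q ** R)"
proof -
  have "(*v) (Q ** R) ` {v. v$3 = 0} = (*v) Q ` (*v) R ` {v. v$3 = 0}"
    by (simp add: image_image matrix_vector_mul_assoc)
  then show ?thesis
    using R rigid_with_rotation[OF g] unfolding horizontal_frame_def tan_space_rigid_with[OF g]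
    by (simp add: orthogonal_matrix_mul rotation_matrix_def)
qed

lemma ball_rigid_with:
  assumes g: "rigid_with Q g" shows "ball (g x) r = g ` ball x r"
proof -
  obtain h where h: "\<And>x. g (h x) = x" using rigid_with_inverse[OF g] by metis
  show ?thesis
  proof (intro set_eqI iffI)
    fix y assume "y \<in> ball (g x) r"
    then have "h y \<in> ball x r" using rigid_with_dist[OF g, of x "h y"] h by simp
    then show "y \<in> g ` ball x r" using h by (metis imageI)
  qed (auto simp: rigid_with_dist[OF g])
qed

lemma interior_graphs_rigid_with:
  assumes g: "rigid_with Q g" and F: "interior_graphs c0 L0 F r"
  shows "interior_graphs c0 L0 (g ` F) r"
  unfolding interior_graphs_def
proof
  fix y assume "y \<in> g ` F - surf_bd (g ` F)"
  then obtain x where x: "x \<in> F - surf_bd F" "y = g x"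
    unfolding surf_bd_rigid_with[OF g] by blast
  then obtain R u where R: "horizontal_frame F x R" "scaled_C11 L0 r (ball 0 (c0 * r)) u"
    "F \<inter> ball x (c0 * r) \<subseteq> graph_pt x R u ` ball 0 (c0 * r)"
    "\<forall>a \<in> ball 0 (c0 * r / 2).
       (\<forall>t\<in>{0..1}. graph_pt x R u (t *\<^sub>R a) \<notin> surf_bd F) \<longrightarrow> graph_pt x R u a \<in> F"
    using F unfolding interior_graphs_def by blast
  have "g ` F \<inter> ball (g x) (c0 * r) \<subseteq> graph_pt (g x) (Q ** R) u ` ball 0 (c0 * r)"
    using image_mono[OF R(3), of g]
    unfolding ball_rigid_with[OF g] image_graph_pt_rigid_with[OF g]
    by (simp add: image_Int[OF rigid_with_inj[OF g]])
  with horizontal_frame_rigid_with[OF g R(1)] R(2,4)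
  show "\<exists>R u. horizontal_frame (g ` F) y R \<and> scaled_C11 L0 r (ball 0 (c0 * r)) u \<and>
        g ` F \<inter> ball y (c0 * r) \<subseteq> graph_pt y R u ` ball 0 (c0 * r) \<and>
        (\<forall>a \<in> ball 0 (c0 * r / 2).
           (\<forall>t\<in>{0..1}. graph_pt y R u (t *\<^sub>R a) \<notin> surf_bd (g ` F)) \<longrightarrow> graph_pt y R u a \<in> g ` F)"
    unfolding x(2)
    by (intro exI[of _ "Q ** R"] exI[of _ u])
       (simp add: surf_bd_rigid_with[OF g] graph_pt_rigid_with[OF g] rigid_with_mem_image_iff[OF g])
qed

lemma boundary_graphs_rigid_with:
  assumes g: "rigid_with Q g" and F: "boundary_graphs c0 L0 F r"
  shows "boundary_graphs c0 L0 (g ` F) r"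
  unfolding boundary_graphs_def Let_def
proof
  fix y assume "y \<in> surf_bd (g ` F)"
  then obtain x where x: "x \<in> surf_bd F" "y = g x"
    unfolding surf_bd_rigid_with[OF g] by blast
  then obtain R u h where R: "horizontal_frame F x R"
      "scaled_C11 L0 r {- (c0 * r) <..< c0 * r} h"
      "scaled_C11 L0 r {a \<in> ball 0 (c0 * r). h (a$1) \<le> a$2} u"
      "F \<inter> ball x (c0 * r) \<subseteq> graph_pt x R u ` {a \<in> ball 0 (c0 * r). h (a$1) \<le> a$2}"
      "graph_pt x R u ` ({a \<in> ball 0 (c0 * r). h (a$1) \<le> a$2} \<inter> ball 0 (c0 * r / 2)) \<subseteq> F"
      "\<forall>a\<in>{a \<in> ball 0 (c0 * r). h (a$1) \<le> a$2}. graph_pt x R u a \<in> F \<and>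
         (graph_pt x R u a \<in> ball x (c0 * r) \<or> norm a < c0 * r / 2) \<longrightarrow>
         (graph_pt x R u a \<in> surf_bd F \<longleftrightarrow> a$2 = h (a$1))"
    using F unfolding boundary_graphs_def Let_def by blast
  have "g ` F \<inter> ball (g x) (c0 * r) \<subseteq> graph_pt (g x) (Q ** R) u ` {a \<in> ball 0 (c0 * r). h (a$1) \<le> a$2}"
    using image_mono[OF R(4), of g]
    unfolding ball_rigid_with[OF g] image_graph_pt_rigid_with[OF g]
    by (simp add: image_Int[OF rigid_with_inj[OF g]])
  moreover have "graph_pt (g x) (Q ** R) u `
      ({a \<in> ball 0 (c0 * r). h (a$1) \<le> a$2} \<inter> ball 0 (c0 * r / 2)) \<subseteq> g ` F"
    using image_mono[OF R(5), of g] unfolding image_graph_pt_rigid_with[OF g] .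
  moreover have "\<forall>a\<in>{a \<in> ball 0 (c0 * r). h (a$1) \<le> a$2}. graph_pt (g x) (Q ** R) u a \<in> g ` F \<and>
         (graph_pt (g x) (Q ** R) u a \<in> ball (g x) (c0 * r) \<or> norm a < c0 * r / 2) \<longrightarrow>
         (graph_pt (g x) (Q ** R) u a \<in> surf_bd (g ` F) \<longleftrightarrow> a$2 = h (a$1))"
    using R(6) unfolding ball_rigid_with[OF g] graph_pt_rigid_with[OF g] surf_bd_rigid_with[OF g]
      rigid_with_mem_image_iff[OF g] .
  ultimately show "\<exists>R u h. horizontal_frame (g ` F) y R \<and>
        scaled_C11 L0 r {- (c0 * r) <..< c0 * r} h \<and>
        scaled_C11 L0 r {a \<in> ball 0 (c0 * r). h (a$1) \<le> a$2} u \<and>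
        g ` F \<inter> ball y (c0 * r) \<subseteq> graph_pt y R u ` {a \<in> ball 0 (c0 * r). h (a$1) \<le> a$2} \<and>
        graph_pt y R u ` ({a \<in> ball 0 (c0 * r). h (a$1) \<le> a$2} \<inter> ball 0 (c0 * r / 2)) \<subseteq> g ` F \<and>
        (\<forall>a\<in>{a \<in> ball 0 (c0 * r). h (a$1) \<le> a$2}. graph_pt y R u a \<in> g ` F \<and>
                (graph_pt y R u a \<in> ball y (c0 * r) \<or> norm a < c0 * r / 2) \<longrightarrow>
                (graph_pt y R u a \<in> surf_bd (g ` F) \<longleftrightarrow> a$2 = h (a$1)))"
    unfolding x(2) using horizontal_frame_rigid_with[OF g R(1)] R(2,3)
    by (intro exI[of _ "Q ** R"] exI[of _ u] exI[of _ h] conjI)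
qed

lemma inward_conormal_rigid_with:
  assumes g: "rigid_with Q g" and v: "inward_conormal F p v"
  shows "inward_conormal (g ` F) (g p) (Q *v v)"
  using v unfolding inward_conormal_def tan_cone_rigid_with[OF g] surf_bd_rigid_with[OF g]
    normal_space_rigid_with[OF g] rigid_with_norm[OF g] by blast

text \<open>The collar is conjugated: pull a boundary point back by \<open>h\<close>, follow the old
  collar, push forward by \<open>g\<close>.\<close>

lemma conormal_collar_rigid_with:
  assumes g: "rigid_with Q g" and h: "\<And>x. h (g x) = x" "\<And>x. g (h x) = x"
    and C: "conormal_collar c0 L0 F r C"
  shows "conormal_collar c0 L0 (g ` F) r (\<lambda>s p. g (C s (h p)))"
proof -
  \<comment> \<open>\<open>h\<close> is given only as an inverse of \<open>g\<close>; by uniqueness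
    of inverses it is the rigid one.\<close>
  have rh: "rigid_with (transpose Q) h"
  proof -
    obtain k where k: "rigid_with (transpose Q) k" "\<And>x. k (g x) = x"
      using rigid_with_inverse[OF g] by metis
    have "k = h" using k(2)[of "h _"] h(2) by (intro ext) metis
    with k show ?thesis by simp
  qed
  let ?I = "{0..c0 * r}"
  let ?f = "\<lambda>(s, p). C s p"
  let ?f' = "\<lambda>(s, p). g (C s (h p))"
  let ?m = "\<lambda>(s :: real, p). (s, h p)"
  note bd = surf_bd_rigid_with[OF g] and cs = components_rigid_with[OF g]
  note C' = C[unfolded conormal_collar_def]
  note C0 = C'[THEN conjunct1]
  note sub = C'[THEN conjunct2, THEN conjunct1]
  note emb = C'[THEN conjunct2, THEN conjunct2, THEN conjunct1]
  note bil = C'[THEN conjunct2, THEN conjunct2, THEN conjunct2, THEN conjunct1]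
  note sep = C'[THEN conjunct2, THEN conjunct2, THEN conjunct2, THEN conjunct2, THEN conjunct1]
  note der = C'[THEN conjunct2, THEN conjunct2, THEN conjunct2, THEN conjunct2, THEN conjunct2]
  have dom: "?m ` (?I \<times> g ` surf_bd F) = ?I \<times> surf_bd F"
  proof (intro equalityI subsetI)
    fix z assume "z \<in> ?I \<times> surf_bd F"
    then have "z = ?m (fst z, g (snd z))" "(fst z, g (snd z)) \<in> ?I \<times> g ` surf_bd F"
      by (auto simp: h)
    then show "z \<in> ?m ` (?I \<times> g ` surf_bd F)" by (rule image_eqI)
  qed (auto simp: h)
  have img: "?f' ` (?I \<times> g ` surf_bd F) = g ` ?f ` (?I \<times> surf_bd F)"
    unfolding dom[symmetric] by (simp add: image_image case_prod_beta)
  have 1: "\<exists>k. homeomorphism (?I \<times> g ` surf_bd F) (?f' ` (?I \<times> g ` surf_bd F)) ?f' k"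
  proof -
    have "homeomorphism (?I \<times> g ` surf_bd F) (?I \<times> surf_bd F) ?m (\<lambda>(s, p). (s, g p))"
    proof (rule homeomorphismI)
      show "continuous_on (?I \<times> g ` surf_bd F) ?m"
        unfolding case_prod_unfold
        by (intro continuous_intros continuous_on_compose2[OF rigid_with_continuous[OF rh, of UNIV]]) auto
      show "continuous_on (?I \<times> surf_bd F) (\<lambda>(s, p). (s, g p))"
        unfolding case_prod_unfold
        by (intro continuous_intros continuous_on_compose2[OF rigid_with_continuous[OF g, of UNIV]]) auto
    qed (auto simp: h)
    moreover obtain k where "homeomorphism (?I \<times> surf_bd F) (?f ` (?I \<times> surf_bd F)) ?f k"
      using emb by blast
    moreover obtain k' where "homeomorphism (?f ` (?I \<times> surf_bd F)) (g ` ?f ` (?I \<times> surf_bd F)) g k'"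
      using rigid_with_homeomorphism[OF g] .
    ultimately have "homeomorphism (?I \<times> g ` surf_bd F) (g ` ?f ` (?I \<times> surf_bd F))
        (g \<circ> (?f \<circ> ?m)) (((\<lambda>(s, p). (s, g p)) \<circ> k) \<circ> k')"
      by (intro homeomorphism_compose)
    moreover have "g \<circ> (?f \<circ> ?m) = ?f'" by (simp add: fun_eq_iff)
    ultimately show ?thesis unfolding img by auto
  qed
  have 2: "\<exists>C'. (\<forall>z \<in> ?I \<times> UNIV.
             ((\<lambda>(s, t). g (C s (h (c t)))) has_derivative blinfun_apply (C' z)) (at z within ?I \<times> UNIV) \<and>
             norm (C' z) \<le> L0) \<and>
          (L0 / r)-lipschitz_on (?I \<times> UNIV) C' \<and>
          (\<forall>t. inward_conormal (g ` F) (c t) (blinfun_apply (C' (0, t)) (1, 0)))"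
    if B: "B \<in> components (surf_bd F)" and c: "arclength_param c L (g ` B)" for B c L
  proof -
    \<comment> \<open>A parametrization of the moved component pulls back to one of
      \<open>B\<close>, along which the derivative bounds of \<open>C\<close> are known.\<close>
    have "arclength_param (h \<circ> c) L B"
      using arclength_param_rigid_with[OF rh c] by (simp add: image_image h)
    then obtain C' where C': "\<And>z. z \<in> ?I \<times> UNIV \<Longrightarrow> ((\<lambda>(s, t). C s ((h \<circ> c) t)) has_derivative
           blinfun_apply (C' z)) (at z within ?I \<times> UNIV)"
        "\<And>z. z \<in> ?I \<times> UNIV \<Longrightarrow> norm (C' z) \<le> L0"
        "(L0 / r)-lipschitz_on (?I \<times> UNIV) C'"
        "\<And>t. inward_conormal F ((h \<circ> c) t) (blinfun_apply (C' (0, t)) (1, 0))"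
      using der B by metis
    define q where "q = Blinfun ((*v) Q)"
    have q: "blinfun_apply q = (*v) Q"
      unfolding q_def by (intro bounded_linear_Blinfun_apply matrix_vector_mul_bounded_linear)
    \<comment> \<open>The bound \<open>L0\<close> is prescribed, so composition with
      \<open>Q\<close> must not enlarge operator norms; it does not, since \<open>Q\<close>
      preserves lengths.\<close>
    have norm_q: "norm (q o\<^sub>L A) \<le> norm A" for A :: "(real \<times> real) \<Rightarrow>\<^sub>L R3"
      by (intro norm_blinfun_bound) (simp_all add: q rigid_with_norm[OF g] norm_blinfun)
    have "((\<lambda>(s, t). g (C s (h (c t)))) has_derivative blinfun_apply (q o\<^sub>L C' z)) (at z within ?I \<times> UNIV)"
      if "z \<in> ?I \<times> UNIV" for z
    proof -
      have "(g \<circ> (\<lambda>(s, t). C s ((h \<circ> c) t)) has_derivative (*v) Q \<circ> blinfun_apply (C' z)) (at z within ?I \<times> UNIV)"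
        by (intro diff_chain_within C'(1) that rigid_with_has_derivative[OF g])
      moreover have "g \<circ> (\<lambda>(s, t). C s ((h \<circ> c) t)) = (\<lambda>(s, t). g (C s (h (c t))))"
        by (simp add: fun_eq_iff)
      moreover have "(*v) Q \<circ> blinfun_apply (C' z) = blinfun_apply (q o\<^sub>L C' z)"
        by (simp add: fun_eq_iff q)
      ultimately show ?thesis by simp
    qed
    moreover have "norm (q o\<^sub>L C' z) \<le> L0" if "z \<in> ?I \<times> UNIV" for z
      using norm_q C'(2)[OF that] order_trans by blast
    moreover have "(L0 / r)-lipschitz_on (?I \<times> UNIV) (\<lambda>z. q o\<^sub>L C' z)"
    proof (rule lipschitz_onI)
      show "0 \<le> L0 / r" using lipschitz_on_nonneg[OF C'(3)] .
      fix y z :: "real \<times> real" assume yz: "y \<in> ?I \<times> UNIV" "z \<in> ?I \<times> UNIV"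
      have "dist (q o\<^sub>L C' y) (q o\<^sub>L C' z) = norm (q o\<^sub>L (C' y - C' z))"
        by (simp add: dist_norm bounded_bilinear.diff_right[OF bounded_bilinear_blinfun_compose])
      also have "\<dots> \<le> dist (C' y) (C' z)" unfolding dist_norm by (rule norm_q)
      also have "\<dots> \<le> L0 / r * dist y z" using lipschitz_onD[OF C'(3) yz] .
      finally show "dist (q o\<^sub>L C' y) (q o\<^sub>L C' z) \<le> L0 / r * dist y z" .
    qed
    moreover have "inward_conormal (g ` F) (c t) (blinfun_apply (q o\<^sub>L C' (0, t)) (1, 0))" for t
      using inward_conormal_rigid_with[OF g C'(4)[of t]] by (simp add: q h)
    ultimately show ?thesis by (intro exI[of _ "\<lambda>z. q o\<^sub>L C' z"] conjI ballI allI)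
  qed
  show ?thesis
    unfolding conormal_collar_def bd cs
  proof (intro conjI)
    show "\<forall>p\<in>g ` surf_bd F. g (C 0 (h p)) = p" using C0 by (simp add: h)
    show "?f' ` (?I \<times> g ` surf_bd F) \<subseteq> g ` F" unfolding img by (intro image_mono sub)
    show "\<exists>k. homeomorphism (?I \<times> g ` surf_bd F) (?f' ` (?I \<times> g ` surf_bd F)) ?f' k" by (rule 1)
    show "\<forall>B\<in>(`) g ` components (surf_bd F). \<forall>p\<in>B. \<forall>q\<in>B. \<forall>s\<in>?I. \<forall>t\<in>?I.
        min r (\<bar>s - t\<bar> + arc_dist B p q) / L0 \<le> dist (g (C s (h p))) (g (C t (h q))) \<and>
        dist (g (C s (h p))) (g (C t (h q))) \<le> L0 * (\<bar>s - t\<bar> + arc_dist B p q)"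
      unfolding ball_simps(9) h rigid_with_dist[OF g] arc_dist_rigid_with[OF g] by (rule bil)
    show "\<forall>B\<in>(`) g ` components (surf_bd F). \<forall>B'\<in>(`) g ` components (surf_bd F). B \<noteq> B' \<longrightarrow>
        (\<forall>p\<in>B. \<forall>q\<in>B'. \<forall>s\<in>?I. \<forall>t\<in>?I. c0 * r \<le> dist (g (C s (h p))) (g (C t (h q))))"
      unfolding ball_simps(9) h rigid_with_dist[OF g] inj_image_eq_iff[OF rigid_with_inj[OF g]] by (rule sep)
    show "\<forall>B\<in>(`) g ` components (surf_bd F). \<forall>c L. arclength_param c L B \<longrightarrow>
        (\<exists>C'. (\<forall>z\<in>?I \<times> UNIV.
              ((\<lambda>(s, t). g (C s (h (c t)))) has_derivative blinfun_apply (C' z)) (at z within ?I \<times> UNIV) \<and>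
              norm (C' z) \<le> L0) \<and>
           (L0 / r)-lipschitz_on (?I \<times> UNIV) C' \<and>
           (\<forall>t. inward_conormal (g ` F) (c t) (blinfun_apply (C' (0, t)) (1, 0))))"
      unfolding ball_simps(9) using 2 by blast
  qed
qed

lemma rel_thi_ge_rigid_with:
  assumes g: "rigid_with Q g" and F: "rel_thi_ge c0 L0 \<gamma> F r"
  shows "rel_thi_ge c0 L0 (g ` \<gamma>) (g ` F) r"
proof -
  obtain h where h: "\<And>x. h (g x) = x" "\<And>x. g (h x) = x"
    using rigid_with_inverse[OF g] by metis
  obtain C where C: "conormal_collar c0 L0 F r C"
    "\<forall>p \<in> surf_bd F. \<forall>s \<in> {0..c0 * r}. c0 * s \<le> infdist (C s p) (tube_bd \<gamma>)"
    "\<forall>x \<in> F - (\<lambda>(s, p). C s p) ` ({0..c0 * r / 2} \<times> surf_bd F).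
        c0\<^sup>2 / 4 * r \<le> infdist x (tube_bd \<gamma>)"
    using F unfolding rel_thi_ge_def by blast
  have "(\<lambda>(s, p). g (C s (h p))) ` ({0..c0 * r / 2} \<times> g ` surf_bd F) =
      g ` (\<lambda>(s, p). C s p) ` ({0..c0 * r / 2} \<times> surf_bd F)"
  proof -
    have "{0..c0 * r / 2} \<times> g ` surf_bd F = (\<lambda>(s, p). (s, g p)) ` ({0..c0 * r / 2} \<times> surf_bd F)"
      by auto
    then show ?thesis by (simp add: image_image case_prod_beta h)
  qed
  then have "g ` F - (\<lambda>(s, p). g (C s (h p))) ` ({0..c0 * r / 2} \<times> g ` surf_bd F) =
      g ` (F - (\<lambda>(s, p). C s p) ` ({0..c0 * r / 2} \<times> surf_bd F))"
    by (simp add: image_set_diff[OF rigid_with_inj[OF g]])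
  then have "\<forall>x \<in> g ` F - (\<lambda>(s, p). g (C s (h p))) ` ({0..c0 * r / 2} \<times> surf_bd (g ` F)).
        c0\<^sup>2 / 4 * r \<le> infdist x (tube_bd (g ` \<gamma>))"
    using C(3) by (simp add: surf_bd_rigid_with[OF g] tube_bd_rigid_with[OF g] infdist_rigid_with[OF g])
  moreover have "\<forall>p \<in> surf_bd (g ` F). \<forall>s \<in> {0..c0 * r}.
      c0 * s \<le> infdist (g (C s (h p))) (tube_bd (g ` \<gamma>))"
    using C(2) by (simp add: surf_bd_rigid_with[OF g] tube_bd_rigid_with[OF g] infdist_rigid_with[OF g] h)
  ultimately show ?thesis
    unfolding rel_thi_ge_def
    using conormal_collar_rigid_with[OF g h C(1)] F[unfolded rel_thi_ge_def]
      reach_ge_rigid_with[OF g] interior_graphs_rigid_with[OF g] boundary_graphs_rigid_with[OF g]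
    by (intro conjI exI[of _ "\<lambda>s p. g (C s (h p))"]) simp_all
qed

section \<open>Angles and thick curves\<close>

lemma inner_quotient_bounded:
  fixes u v :: R3
  shows "- 1 \<le> u \<bullet> v / (norm u * norm v)" "u \<bullet> v / (norm u * norm v) \<le> 1"
proof -
  have "\<bar>u \<bullet> v\<bar> \<le> norm u * norm v" by (rule Cauchy_Schwarz_ineq2)
  then have "\<bar>u \<bullet> v / (norm u * norm v)\<bar> \<le> 1"
    by (cases "u = 0 \<or> v = 0") (auto simp: divide_le_eq_1_pos)
  then show "- 1 \<le> u \<bullet> v / (norm u * norm v)" "u \<bullet> v / (norm u * norm v) \<le> 1"
    by linarith+
qed

lemma dir_angle_nonneg: "0 \<le> dir_angle u v"
  unfolding dir_angle_def by (intro arccos_lbound inner_quotient_bounded)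

lemma dir_angle_commute: "dir_angle u v = dir_angle v u"
  unfolding dir_angle_def by (simp add: inner_commute mult.commute)

lemma line_angle_le_dir_angle:
  assumes "u \<in> U" "v \<in> V" "u \<noteq> 0" "v \<noteq> 0"
  shows "line_angle U V \<le> dir_angle u v"
  unfolding line_angle_def
  by (rule cInf_lower) (use assms dir_angle_nonneg in \<open>auto intro!: bdd_belowI[of _ 0]\<close>)

text \<open>The chord of the unit circle subtending the angle: both sides are nonnegative and have
  square \<open>2 - 2 * (u \<bullet> v)\<close>.\<close>

lemma norm_diff_eq_sin_dir_angle:
  assumes "norm u = 1" "norm v = 1"
  shows "norm (u - v) = 2 * sin (dir_angle u v / 2)"
proof -
  let ?t = "dir_angle u v"
  have bounds: "0 \<le> ?t" "?t \<le> pi" and cos: "cos ?t = u \<bullet> v"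
    unfolding dir_angle_def using inner_quotient_bounded[of u v] assms
    by (simp_all add: arccos_lbound arccos_ubound)
  have "(norm (u - v))\<^sup>2 = 2 - 2 * (u \<bullet> v)"
    using assms by (simp add: norm_eq_1 power2_norm_eq_inner inner_diff inner_commute)
  also have "\<dots> = (2 * sin (?t / 2))\<^sup>2"
    using cos_double_sin[of "?t / 2"] cos by (simp add: power_mult_distrib)
  finally have "(norm (u - v))\<^sup>2 = (2 * sin (?t / 2))\<^sup>2" .
  moreover have "0 \<le> 2 * sin (?t / 2)" using bounds sin_ge_zero[of "?t / 2"] by simp
  ultimately show ?thesis by (rule power2_eq_imp_eq[OF _ norm_ge_zero])
qed

lemma norm_diff_le_dir_angle:
  assumes "norm u = 1" "norm v = 1" shows "norm (u - v) \<le> dir_angle u v"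
  unfolding norm_diff_eq_sin_dir_angle[OF assms] using sin_x_le_x[of "dir_angle u v / 2"] dir_angle_nonneg[of u v] by simp

text \<open>Half the angle, \<open>x\<close>, is at most \<open>pi / 2 < 2\<close>, and on this
  range the cubic Taylor bound gives \<open>x \<le> 3 * sin x\<close>. The factor \<open>3\<close>
  is a crude substitute for \<open>pi / 2\<close>.\<close>

lemma dir_angle_le_norm_diff:
  assumes "norm u = 1" "norm v = 1" shows "dir_angle u v \<le> 3 * norm (u - v)"
proof -
  define x where "x = dir_angle u v / 2"
  have x: "0 \<le> x" "x \<le> 2"
    using dir_angle_nonneg[of u v] arccos_ubound[OF inner_quotient_bounded, of u v] pi_less_4
    unfolding x_def dir_angle_def by simp_all
  have "\<bar>sin x - (\<Sum>m<3. sin_coeff m * x ^ m)\<bar> \<le> inverse (fact 3) * \<bar>x\<bar> ^ 3"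
    by (rule Maclaurin_sin_bound)
  then have "\<bar>sin x - x\<bar> \<le> x ^ 3 / 6"
    using x by (simp add: sin_coeff_def eval_nat_numeral)
  moreover have "x * x \<le> 2 * 2" using x by (intro mult_mono) auto
  then have "x ^ 3 \<le> 4 * x"
    using x mult_right_mono[of "x * x" 4 x] by (simp add: power3_eq_cube)
  ultimately have "x \<le> 3 * sin x" by linarith
  then show ?thesis unfolding norm_diff_eq_sin_dir_angle[OF assms] x_def by simp
qed

text \<open>A line does not distinguish \<open>v\<close> from \<open>- v\<close>, so closeness up to
  sign is enough.\<close>

lemma line_angle_span_le:
  assumes "norm u = 1" "norm v = 1" "norm (u - v) \<le> e \<or> norm (u + v) \<le> e"
  shows "line_angle (span {u}) (span {v}) \<le> 3 * e"
proof -
  have v: "- v \<in> span {v}" "v \<in> span {v}" "u \<in> span {u}"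
    by (auto simp: span_neg span_base)
  have "u \<noteq> 0" "v \<noteq> 0" using assms by auto
  then have "line_angle (span {u}) (span {v}) \<le> dir_angle u v"
    "line_angle (span {u}) (span {v}) \<le> dir_angle u (- v)"
    using v by (auto intro!: line_angle_le_dir_angle)
  moreover have "dir_angle u v \<le> 3 * norm (u - v)" "dir_angle u (- v) \<le> 3 * norm (u + v)"
    using dir_angle_le_norm_diff[of u v] dir_angle_le_norm_diff[of u "- v"] assms by simp_all
  ultimately show ?thesis using assms(3) by linarith
qed

text \<open>Dropping finitely many terms of an approximating sequence changes neither of its limits,
  so the cone depends only on the set near the point.\<close>

lemma tan_cone_local:
  assumes d: "0 < d" and sub: "S \<inter> ball x d \<subseteq> T"
  shows "tan_cone S x \<subseteq> tan_cone T x"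
proof
  fix v assume "v \<in> tan_cone S x"
  then obtain y t where y: "\<And>n::nat. y n \<in> S" "\<And>n. 0 \<le> t n" "y \<longlonglongrightarrow> x"
      "(\<lambda>n. t n *\<^sub>R (y n - x)) \<longlonglongrightarrow> v"
    unfolding tan_cone_def by blast
  obtain N where N: "\<And>n. N \<le> n \<Longrightarrow> dist (y n) x < d"
    using y(3) d unfolding lim_sequentially by blast
  have "y (n + N) \<in> T" for n
    using N[of "n + N"] y(1)[of "n + N"] sub by (auto simp: dist_commute)
  moreover have "(\<lambda>n. y (n + N)) \<longlonglongrightarrow> x" "(\<lambda>n. t (n + N) *\<^sub>R (y (n + N) - x)) \<longlonglongrightarrow> v"
    using y(3,4)[THEN LIMSEQ_ignore_initial_segment, of N] by auto
  ultimately show "v \<in> tan_cone T x"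
    unfolding tan_cone_def using y(2)
    by (intro CollectI exI[of _ "\<lambda>n. y (n + N)"] exI[of _ "\<lambda>n. t (n + N)"]) simp
qed

section \<open>Arclength parametrizations and their tangent lines\<close>

lemma arclength_paramD:
  assumes "arclength_param c L \<gamma>"
  shows "0 < L" "\<gamma> = range c" "inj_on c {0..<L}" "c (s + L) = c s"
    "(c has_vector_derivative tangent_at c s) (at s)" "norm (tangent_at c s) = 1"
    "continuous_on S c"
proof -
  obtain c' where c': "\<And>s. (c has_vector_derivative c' s) (at s)" "\<And>s. norm (c' s) = 1"
    using assms unfolding arclength_param_def by blast
  have "tangent_at c s = c' s" for s
    unfolding tangent_at_def using c'(1) by (rule vector_derivative_at)
  then show "(c has_vector_derivative tangent_at c s) (at s)" "norm (tangent_at c s) = 1"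
    using c' by simp_all
  show "continuous_on S c"
    using c'(1) has_vector_derivative_continuous continuous_at_imp_continuous_on by metis
qed (use assms in \<open>auto simp: arclength_param_def\<close>)

lemma arclength_param_periodic:
  assumes c: "arclength_param c L \<gamma>" shows "c (s + of_int m * L) = c s"
proof -
  have nat: "c (s + of_nat n * L) = c s" for n s
  proof (induction n)
    case (Suc n)
    have "c (s + of_nat (Suc n) * L) = c ((s + of_nat n * L) + L)" by (simp add: algebra_simps)
    then show ?case using Suc arclength_paramD(4)[OF c] by simp
  qed simp
  show ?thesis
  proof (cases "0 \<le> m")
    case True
    then show ?thesis using nat[of s "nat m"] by simp
  next
    case False
    then show ?thesis using nat[of "s + of_int m * L" "nat (- m)"] by simp
  qed
qed

lemma arclength_param_near:
  assumes c: "arclength_param c L \<gamma>" and x: "x \<in> \<gamma>"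
  obtains t where "a \<le> t" "t < a + L" "c t = x"
proof -
  obtain s where s: "x = c s" using x arclength_paramD(2)[OF c] by blast
  have L: "0 < L" using arclength_paramD(1)[OF c] .
  define m where "m = \<lfloor>(s - a) / L\<rfloor>"
  have "of_int m * L \<le> s - a" "s - a < (of_int m + 1) * L"
    using L floor_divide_lower[OF L, of "s - a"] floor_divide_upper[OF L, of "s - a"]
    by (simp_all add: m_def)
  then show thesis
    using that[of "s + of_int (- m) * L"] arclength_param_periodic[OF c, of s "- m"] s
    by (simp add: algebra_simps)
qed

lemma arclength_param_compact:
  assumes c: "arclength_param c L \<gamma>" shows "compact \<gamma>" "\<gamma> \<noteq> {}"
proof -
  have "\<gamma> = c ` {0..L}"
  proof
    show "\<gamma> \<subseteq> c ` {0..L}"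
    proof
      fix x assume "x \<in> \<gamma>"
      from arclength_param_near[OF c this, of 0] obtain t where "0 \<le> t" "t < L" "c t = x" by auto
      then show "x \<in> c ` {0..L}" by force
    qed
  qed (use arclength_paramD(2)[OF c] in blast)
  then show "compact \<gamma>"
    using compact_continuous_image[OF arclength_paramD(7)[OF c, of "{0..L}"] compact_Icc] by simp
qed (use arclength_paramD(2)[OF c] in blast)

text \<open>Whole periods move \<open>s\<close> into the fundamental interval; \<open>t\<close> then
  lies in that interval or one period beyond, and injectivity applies in both cases.\<close>

lemma arclength_param_inj:
  assumes c: "arclength_param c L \<gamma>" and eq: "c s = c t" and st: "s < t" "t < s + L"
  shows False
proof -
  have L: "0 < L" using arclength_paramD(1)[OF c] .
  define m where "m = \<lfloor>s / L\<rfloor>"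
  have m: "of_int m * L \<le> s" "s < (of_int m + 1) * L"
    using L floor_divide_lower[OF L, of s] floor_divide_upper[OF L, of s] by (simp_all add: m_def)
  define s' where "s' = s - of_int m * L"
  have s': "0 \<le> s'" "s' < L" "c s' = c s"
    using m arclength_param_periodic[OF c, of s "- m"] by (simp_all add: s'_def algebra_simps)
  have t': "c (t - of_int m * L) = c t" "c (t - of_int m * L - L) = c t"
    using arclength_param_periodic[OF c, of t "- m"] arclength_param_periodic[OF c, of t "- m - 1"]
    by (simp_all add: algebra_simps)
  note inj = inj_onD[OF arclength_paramD(3)[OF c]]
  show False
  proof (cases "t - of_int m * L < L")
    case True
    then have "s' = t - of_int m * L"
      using s' t' eq st by (intro inj) (simp_all add: s'_def)
    then show False using st by (simp add: s'_def)
  next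
    case False
    then have "s' = t - of_int m * L - L"
      using s' t' eq st by (intro inj) (simp_all add: s'_def)
    then show False using st by (simp add: s'_def)
  qed
qed

text \<open>The arc of parameters at least \<open>e\<close> away from \<open>s\<close>, modulo the
  period, is compact and misses \<open>c s\<close>, so it keeps a positive distance from it.\<close>

lemma arclength_param_local_inverse:
  assumes c: "arclength_param c L \<gamma>" and e: "0 < e"
  obtains d where "0 < d" "\<And>y. y \<in> \<gamma> \<Longrightarrow> dist y (c s) < d \<Longrightarrow> \<exists>t. \<bar>t - s\<bar> < e \<and> c t = y"
proof -
  have L: "0 < L" using arclength_paramD(1)[OF c] .
  let ?K = "c ` {s + e..s + L - e}"
  have "compact ?K"
    by (intro compact_continuous_image compact_Icc arclength_paramD(7)[OF c])
  moreover have "c s \<notin> ?K"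
    using arclength_param_inj[OF c, of s] e by force
  ultimately obtain d where d: "0 < d" "\<And>y. y \<in> ?K \<Longrightarrow> d \<le> dist (c s) y"
    using separate_point_closed[of ?K "c s"] compact_imp_closed by metis
  show thesis
  proof (rule that[OF d(1)])
    fix y assume y: "y \<in> \<gamma>" "dist y (c s) < d"
    obtain t where t: "s \<le> t" "t < s + L" "c t = y"
      using arclength_param_near[OF c y(1)] by metis
    have "y \<notin> ?K" using d(2)[of y] y(2) by (auto simp: dist_commute)
    then have "t < s + e \<or> s + L - e < t" using t by force
    then show "\<exists>t. \<bar>t - s\<bar> < e \<and> c t = y"
    proof
      assume "t < s + e" then show ?thesis using t by (intro exI[of _ t]) auto
    next
      assume "s + L - e < t"
      then show ?thesis
        using t arclength_param_periodic[OF c, of t "- 1"] by (intro exI[of _ "t - L"]) auto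
    qed
  qed
qed

text \<open>Points of the curve near \<open>c s\<close> have parameters near \<open>s\<close>, so by
  differentiability they leave the tangent line only by an arbitrarily small fraction of their
  distance to \<open>c s\<close>. After rescaling, the limit \<open>w\<close> has no component along
  a normal \<open>n\<close>.\<close>

lemma tan_cone_curve_subset:
  assumes c: "arclength_param c L \<gamma>" and w: "w \<in> tan_cone \<gamma> (c s)"
    and n: "n \<bullet> tangent_at c s = 0"
  shows "w \<bullet> n = 0"
proof -
  let ?v = "tangent_at c s"
  obtain y t where y: "\<And>k::nat. y k \<in> \<gamma>" "\<And>k. 0 \<le> t k" "y \<longlonglongrightarrow> c s"
      "(\<lambda>k. t k *\<^sub>R (y k - c s)) \<longlonglongrightarrow> w"
    using w unfolding tan_cone_def by blast
  have "\<bar>w \<bullet> n\<bar> \<le> e * (2 * norm w * norm n)" if e: "0 < e" "e < 1/2" for e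
  proof -
    have "(c has_derivative (\<lambda>h. h *\<^sub>R ?v)) (at s)"
      using arclength_paramD(5)[OF c, of s] unfolding has_vector_derivative_def .
    then obtain d where d: "0 < d" "\<And>r. norm (r - s) < d \<Longrightarrow>
        norm (c r - c s - (r - s) *\<^sub>R ?v) \<le> e * norm (r - s)"
      using e(1) unfolding has_derivative_at_alt by blast
    obtain d' where d': "0 < d'" "\<And>y. y \<in> \<gamma> \<Longrightarrow> dist y (c s) < d' \<Longrightarrow> \<exists>r. \<bar>r - s\<bar> < d \<and> c r = y"
      using arclength_param_local_inverse[OF c d(1)] by metis
    have est: "\<bar>(z - c s) \<bullet> n\<bar> \<le> e * (2 * norm (z - c s) * norm n)" if z: "z \<in> \<gamma>" "dist z (c s) < d'" for z
    proof -
      obtain r where r: "\<bar>r - s\<bar> < d" "c r = z" using d'(2)[OF z] by blast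
      let ?R = "z - c s - (r - s) *\<^sub>R ?v"
      have R: "norm ?R \<le> e * \<bar>r - s\<bar>" using d(2)[of r] r by simp
      have "\<bar>r - s\<bar> = norm ((r - s) *\<^sub>R ?v)" using arclength_paramD(6)[OF c] by simp
      also have "\<dots> \<le> norm (z - c s) + norm ?R"
        using norm_triangle_ineq4[of "z - c s" ?R] by simp
      finally have "\<bar>r - s\<bar> \<le> norm (z - c s) + e * \<bar>r - s\<bar>" using R by linarith
      \<comment> \<open>The restriction \<open>e < 1/2\<close> lets the error term be absorbed, so
        that twice the chord bounds the parameter distance.\<close>
      moreover have "a \<le> b + e * a \<Longrightarrow> 0 \<le> a \<Longrightarrow> a \<le> 2 * b" for a b
        using mult_right_mono[of e "1/2" a] e by simp
      ultimately have rs: "\<bar>r - s\<bar> \<le> 2 * norm (z - c s)" by simp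
      have "(z - c s) \<bullet> n = ?R \<bullet> n" using n by (simp add: inner_diff_left inner_diff_right inner_commute)
      then have "\<bar>(z - c s) \<bullet> n\<bar> \<le> norm ?R * norm n" using Cauchy_Schwarz_ineq2[of ?R n] by simp
      also have "\<dots> \<le> (e * (2 * norm (z - c s))) * norm n"
        using R rs e by (intro mult_right_mono order_trans[OF R] mult_left_mono) auto
      finally show ?thesis by (simp add: algebra_simps)
    qed
    obtain N where N: "\<And>k. N \<le> k \<Longrightarrow> dist (y k) (c s) < d'"
      using y(3) d'(1) unfolding lim_sequentially by blast
    have "\<bar>(t k *\<^sub>R (y k - c s)) \<bullet> n\<bar> \<le> e * (2 * norm (t k *\<^sub>R (y k - c s)) * norm n)" if "N \<le> k" for k
      using mult_left_mono[OF est[OF y(1)[of k] N[OF that]] y(2)[of k]] y(2)[of k]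
      by (simp only: inner_scaleR_left norm_scaleR abs_mult abs_of_nonneg ac_simps)
    then have "\<forall>\<^sub>F k in sequentially.
        \<bar>(t k *\<^sub>R (y k - c s)) \<bullet> n\<bar> \<le> e * (2 * norm (t k *\<^sub>R (y k - c s)) * norm n)"
      unfolding eventually_sequentially by (intro exI[of _ N]) simp
    moreover have "(\<lambda>k. \<bar>(t k *\<^sub>R (y k - c s)) \<bullet> n\<bar>) \<longlonglongrightarrow> \<bar>w \<bullet> n\<bar>"
      by (intro tendsto_intros y(4))
    moreover have "(\<lambda>k. e * (2 * norm (t k *\<^sub>R (y k - c s)) * norm n)) \<longlonglongrightarrow> e * (2 * norm w * norm n)"
      by (intro tendsto_intros y(4))
    ultimately show ?thesis
      by (intro tendsto_le[OF trivial_limit_sequentially])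
  qed
  note bound = this
  show ?thesis
  proof (rule ccontr)
    assume "w \<bullet> n \<noteq> 0"
    then have pos: "0 < \<bar>w \<bullet> n\<bar>" by simp
    let ?M = "2 * norm w * norm n"
    have "0 < ?M" using bound[of "1/4"] pos by linarith
    define e where "e = min (1/4) (\<bar>w \<bullet> n\<bar> / (2 * ?M))"
    have e: "0 < e" "e < 1/2" using pos \<open>0 < ?M\<close> by (auto simp: e_def)
    have "\<bar>w \<bullet> n\<bar> \<le> e * ?M" by (rule bound[OF e])
    also have "\<dots> \<le> \<bar>w \<bullet> n\<bar> / (2 * ?M) * ?M" using \<open>0 < ?M\<close> by (intro mult_right_mono) (auto simp: e_def)
    also have "\<dots> < \<bar>w \<bullet> n\<bar>" using pos \<open>0 < ?M\<close> by (auto simp: field_simps)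
    finally show False by simp
  qed
qed

text \<open>Difference quotients along \<open>s + 1 / (n + 1)\<close> have nonnegative multipliers,
  as the cone demands, and converge to the derivative.\<close>

lemma tangent_at_mem_tan_cone:
  assumes c: "arclength_param c L \<gamma>"
  shows "tangent_at c s \<in> tan_cone \<gamma> (c s)"
proof -
  let ?h = "\<lambda>n. inverse (real (Suc n))"
  let ?y = "\<lambda>n. c (s + ?h n)"
  have h: "?h \<longlonglongrightarrow> 0" by (rule LIMSEQ_inverse_real_of_nat)
  have "((\<lambda>h. (1 / h) *\<^sub>R (c (s + h) - c s)) \<longlongrightarrow> tangent_at c s) (at 0)"
  proof (rule Lim_transform_eventually[OF _ ])
    have "((\<lambda>h. norm (c (s + h) - c s - h *\<^sub>R tangent_at c s) / norm h) \<longlongrightarrow> 0) (at 0)"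
      using arclength_paramD(5)[OF c, of s] unfolding has_vector_derivative_def has_derivative_at by blast
    then have "((\<lambda>h. (1 / h) *\<^sub>R (c (s + h) - c s - h *\<^sub>R tangent_at c s)) \<longlongrightarrow> 0) (at 0)"
      by (subst tendsto_norm_zero_iff[symmetric]) simp
    from tendsto_add[OF this tendsto_const[of "tangent_at c s"]]
    show "((\<lambda>h. (1 / h) *\<^sub>R (c (s + h) - c s - h *\<^sub>R tangent_at c s) + tangent_at c s)
        \<longlongrightarrow> tangent_at c s) (at 0)" by simp
    show "\<forall>\<^sub>F h in at 0. (1 / h) *\<^sub>R (c (s + h) - c s - h *\<^sub>R tangent_at c s) + tangent_at c s =
        (1 / h) *\<^sub>R (c (s + h) - c s)"
      unfolding eventually_at by (intro exI[of _ 1]) (simp add: scaleR_diff_right)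
  qed
  moreover have "filterlim ?h (at 0) sequentially"
    using h unfolding filterlim_at by (auto intro!: eventuallyI)
  ultimately have "(\<lambda>n. (1 / ?h n) *\<^sub>R (?y n - c s)) \<longlonglongrightarrow> tangent_at c s"
    by (rule filterlim_compose)
  moreover have "?y \<longlonglongrightarrow> c s"
  proof -
    have "(\<lambda>n. s + ?h n) \<longlonglongrightarrow> s + 0" by (intro tendsto_intros h)
    then show ?thesis
      using continuous_on_tendsto_compose[OF arclength_paramD(7)[OF c, of UNIV], of "\<lambda>n. s + ?h n" s] by simp
  qed
  moreover have "?y n \<in> \<gamma> \<and> 0 \<le> 1 / ?h n" for n
    using arclength_paramD(2)[OF c] by simp
  ultimately show ?thesis unfolding tan_cone_def
    by (intro CollectI exI[of _ ?y] exI[of _ "\<lambda>n. 1 / ?h n"]) blast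
qed

lemma tan_space_curve:
  assumes c: "arclength_param c L \<gamma>"
  shows "tan_space \<gamma> (c s) = span {tangent_at c s}"
proof -
  let ?v = "tangent_at c s"
  have v: "norm ?v = 1" by (rule arclength_paramD(6)[OF c])
  have "w \<in> span {?v}" if w: "w \<in> tan_cone \<gamma> (c s)" for w
  proof -
    \<comment> \<open>The part of \<open>w\<close> orthogonal to the tangent is a normal, so
      \<open>w\<close> is orthogonal to it, and hence it is orthogonal to itself.\<close>
    let ?n = "w - (w \<bullet> ?v) *\<^sub>R ?v"
    have n: "?n \<bullet> ?v = 0" using v by (simp add: inner_diff_left norm_eq_1)
    have "?n \<bullet> ?n = w \<bullet> ?n - (w \<bullet> ?v) * (?n \<bullet> ?v)"
      by (simp add: inner_diff_left inner_commute)
    then have "?n = 0" using tan_cone_curve_subset[OF c w n] n by simp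
    then have "w = (w \<bullet> ?v) *\<^sub>R ?v" by simp
    then show ?thesis by (metis span_base span_scale singletonI)
  qed
  then have "span (tan_cone \<gamma> (c s)) \<subseteq> span {?v}" by (intro span_minimal subsetI) auto
  moreover have "span {?v} \<subseteq> span (tan_cone \<gamma> (c s))"
    using tangent_at_mem_tan_cone[OF c] by (intro span_mono) auto
  ultimately show ?thesis unfolding tan_space_def by (rule subset_antisym)
qed

lemma normal_space_curve:
  assumes c: "arclength_param c L \<gamma>"
  shows "u \<in> normal_space \<gamma> (c s) \<longleftrightarrow> u \<bullet> tangent_at c s = 0"
proof
  assume "u \<in> normal_space \<gamma> (c s)"
  then show "u \<bullet> tangent_at c s = 0"
    unfolding normal_space_def tan_space_curve[OF c] orthogonal_comp_def
    by (auto simp: orthogonal_def inner_commute span_base)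
next
  assume "u \<bullet> tangent_at c s = 0"
  then show "u \<in> normal_space \<gamma> (c s)"
    unfolding normal_space_def tan_space_curve[OF c] orthogonal_comp_def
    by (auto simp: orthogonal_def span_singleton inner_commute)
qed

section \<open>Nearest points, the normal tube and Federer's inequality\<close>

text \<open>The squared distance to \<open>z\<close> along the curve has a minimum at
  \<open>p\<close>, so its derivative vanishes there.\<close>

lemma nearest_point_normal:
  assumes c: "arclength_param c L \<gamma>" and p: "p \<in> \<gamma>" and near: "\<And>q. q \<in> \<gamma> \<Longrightarrow> dist z p \<le> dist z q"
  shows "z - p \<in> normal_space \<gamma> p"
proof -
  obtain s where s: "p = c s" using p arclength_paramD(2)[OF c] by blast
  let ?v = "tangent_at c s"
  have "((\<lambda>t. (z - c t) \<bullet> (z - c t)) has_derivative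
      (\<lambda>h. (z - c s) \<bullet> (0 - h *\<^sub>R ?v) + (0 - h *\<^sub>R ?v) \<bullet> (z - c s))) (at s)"
    using arclength_paramD(5)[OF c, of s] unfolding has_vector_derivative_def
    by (intro has_derivative_inner has_derivative_diff has_derivative_const)
  then have "((\<lambda>t. (z - c t) \<bullet> (z - c t)) has_real_derivative - 2 * ((z - c s) \<bullet> ?v)) (at s)"
    by (rule has_derivative_imp_has_field_derivative) (simp add: inner_commute)
  moreover have "(z - c s) \<bullet> (z - c s) \<le> (z - c t) \<bullet> (z - c t)" for t
    using near[of "c t"] s arclength_paramD(2)[OF c]
    by (simp add: dist_norm norm_le)
  ultimately have "- 2 * ((z - c s) \<bullet> ?v) = 0"
    by (intro DERIV_local_min[where d = 1 and x = s and f = "\<lambda>t. (z - c t) \<bullet> (z - c t)"]) auto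
  then show ?thesis unfolding s normal_space_curve[OF c] by simp
qed

lemma nearest_point_exists:
  assumes c: "arclength_param c L \<gamma>"
  obtains p where "p \<in> \<gamma>" "dist z p = infdist z \<gamma>" "z - p \<in> normal_space \<gamma> p"
proof -
  have "closed \<gamma>" "\<gamma> \<noteq> {}"
    using arclength_param_compact[OF c] compact_imp_closed by auto
  then obtain p where p: "p \<in> \<gamma>" "infdist z \<gamma> = dist z p"
    using infdist_attains_inf by metis
  have "z - p \<in> normal_space \<gamma> p"
    using p(2) infdist_le[of _ \<gamma> z] by (intro nearest_point_normal[OF c p(1)]) metis
  then show thesis using p by (intro that) auto
qed

text \<open>The closed normal tube is the set of points within \<open>rho0\<close> of the curve,
  because a nearest point is reached along a normal; its frontier therefore lies at distance exactly
  \<open>rho0\<close>.\<close>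

lemma tube_bd_decomposition:
  assumes c: "arclength_param c L \<gamma>" and x: "x \<in> tube_bd \<gamma>"
  obtains p u where "p \<in> \<gamma>" "u \<in> normal_space \<gamma> p" "norm u = rho0" "x = p + u"
proof -
  have tube: "normal_tube \<gamma> = {x. infdist x \<gamma> \<le> rho0}"
  proof (intro set_eqI iffI)
    fix x assume "x \<in> normal_tube \<gamma>"
    then obtain p u where pu: "p \<in> \<gamma>" "norm u \<le> rho0" "x = p + u" unfolding normal_tube_def by blast
    have "infdist x \<gamma> \<le> dist x p" using pu(1) by (rule infdist_le)
    then show "x \<in> {x. infdist x \<gamma> \<le> rho0}" using pu by (simp add: dist_norm)
  next
    fix x assume x: "x \<in> {x. infdist x \<gamma> \<le> rho0}"
    obtain p where p: "p \<in> \<gamma>" "dist x p = infdist x \<gamma>" "x - p \<in> normal_space \<gamma> p"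
      using nearest_point_exists[OF c] .
    show "x \<in> normal_tube \<gamma>" unfolding normal_tube_def
      using p x by (intro CollectI exI[of _ p] exI[of _ "x - p"]) (simp add: dist_norm)
  qed
  have cont: "continuous_on UNIV (\<lambda>x. infdist x \<gamma>)"
    by (intro continuous_on_infdist continuous_on_id)
  have "closed {x. infdist x \<gamma> \<le> rho0}"
    by (intro closed_Collect_le cont continuous_on_const)
  moreover have "open {x. infdist x \<gamma> < rho0}"
    by (intro open_Collect_less cont continuous_on_const)
  then have "{x. infdist x \<gamma> < rho0} \<subseteq> interior (normal_tube \<gamma>)"
    unfolding tube by (intro interior_maximal) auto
  ultimately have "infdist x \<gamma> \<le> rho0" "\<not> infdist x \<gamma> < rho0"
    using x unfolding tube_bd_def frontier_def tube by auto
  then have "infdist x \<gamma> = rho0" by simp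
  obtain p where p: "p \<in> \<gamma>" "dist x p = infdist x \<gamma>" "x - p \<in> normal_space \<gamma> p"
    using nearest_point_exists[OF c] .
  show thesis
    by (rule that[of p "x - p"]) (use p \<open>infdist x \<gamma> = rho0\<close> in \<open>auto simp: dist_norm\<close>)
qed

text \<open>Federer's inequality: by injectivity of the tube map, \<open>p\<close> is the nearest point of the curve to
  \<open>p + n/2\<close>.\<close>

lemma normal_inner_le:
  assumes c: "arclength_param c L \<gamma>" and T: "1 \<le> Thi \<gamma>" and p: "p \<in> \<gamma>" and q: "q \<in> \<gamma>"
    and n: "n \<in> normal_space \<gamma> p" "norm n = 1"
  shows "(q - p) \<bullet> n \<le> (norm (q - p))\<^sup>2"
proof -
  \<comment> \<open>An embedded open tube of radius above \<open>1/2\<close> admits normal vectors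
    of length \<open>1/2\<close>; testing at this length produces the coefficient \<open>1\<close>
    in the inequality.\<close>
  have "ereal (1/2) < Thi \<gamma>" using T by (rule order_less_le_trans[rotated]) (simp add: one_ereal_def)
  then obtain r where r: "1/2 < r" "embedded_tube \<gamma> r"
    unfolding Thi_def less_SUP_iff by auto
  define z where "z = p + (1/2) *\<^sub>R n"
  obtain p' where p': "p' \<in> \<gamma>" "dist z p' = infdist z \<gamma>" "z - p' \<in> normal_space \<gamma> p'"
    using nearest_point_exists[OF c] .
  have half: "(1/2) *\<^sub>R n \<in> normal_space \<gamma> p"
    using n(1) subspace_orthogonal_comp unfolding normal_space_def by (rule subspace_scale[rotated])
  have zp: "dist z p = 1/2" using n(2) by (simp add: z_def dist_norm)
  have "dist z p' \<le> 1/2" using infdist_le[OF p, of z] zp p'(2) by simp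
  then have "(p, (1/2) *\<^sub>R n) = (p', z - p')"
    using r p p' half n(2) unfolding embedded_tube_def
    by (intro inj_onD[of "\<lambda>(p, u). p + u" _ "(p, (1/2) *\<^sub>R n)" "(p', z - p')"])
       (auto simp: z_def dist_norm)
  then have "p' = p" by simp
  then have "1/2 \<le> dist z q" using infdist_le[OF q, of z] p'(2) zp by simp
  then have "(1/2)\<^sup>2 \<le> (norm ((q - p) - (1/2) *\<^sub>R n))\<^sup>2"
    by (intro power_mono) (simp_all add: z_def dist_norm norm_minus_commute algebra_simps)
  also have "\<dots> = (norm (q - p))\<^sup>2 - (q - p) \<bullet> n + (1/2)\<^sup>2"
    using n(2) unfolding power2_norm_eq_inner
    by (simp add: inner_diff_left inner_diff_right inner_commute norm_eq_1 power2_eq_square)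
  finally show ?thesis by simp
qed

text \<open>Federer's inequality is applied in the direction of the normal component itself, where
  the inner product with the chord is the length of that component.\<close>

lemma normal_component_le:
  assumes c: "arclength_param c L \<gamma>" and T: "1 \<le> Thi \<gamma>" and q: "q \<in> \<gamma>"
  shows "norm ((q - c s) - ((q - c s) \<bullet> tangent_at c s) *\<^sub>R tangent_at c s) \<le> (norm (q - c s))\<^sup>2"
proof (cases "(q - c s) - ((q - c s) \<bullet> tangent_at c s) *\<^sub>R tangent_at c s = 0")
  case False
  let ?w = "q - c s" and ?u = "tangent_at c s"
  let ?n = "?w - (?w \<bullet> ?u) *\<^sub>R ?u"
  have u: "?u \<bullet> ?u = 1" using arclength_paramD(6)[OF c] by (simp add: norm_eq_1)
  have nu: "?n \<bullet> ?u = 0" using u by (simp add: inner_diff_left)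
  have "?w \<bullet> ?n = (?n + (?w \<bullet> ?u) *\<^sub>R ?u) \<bullet> ?n" by simp
  also have "\<dots> = ?n \<bullet> ?n + (?w \<bullet> ?u) * (?n \<bullet> ?u)"
    unfolding inner_add_left inner_scaleR_left inner_commute[of ?u ?n] ..
  finally have wn: "?w \<bullet> ?n = (norm ?n)\<^sup>2" unfolding nu by (simp add: power2_norm_eq_inner)
  have "?n /\<^sub>R norm ?n \<in> normal_space \<gamma> (c s)"
    unfolding normal_space_curve[OF c] using nu by (simp only: inner_scaleR_left mult_zero_right)
  moreover have "norm (?n /\<^sub>R norm ?n) = 1" using False by simp
  moreover have "c s \<in> \<gamma>" using arclength_paramD(2)[OF c] by simp
  ultimately have "?w \<bullet> (?n /\<^sub>R norm ?n) \<le> (norm ?w)\<^sup>2"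
    using normal_inner_le[OF c T _ q] by blast
  moreover have "inverse a * a\<^sup>2 = a" if "a \<noteq> 0" for a :: real
    using that by (simp add: power2_eq_square)
  moreover have "norm ?n \<noteq> 0" using False unfolding norm_eq_zero .
  ultimately show ?thesis unfolding inner_scaleR_right wn by metis
qed simp

text \<open>Intended for \<open>a *\<^sub>R x\<close> and \<open>b *\<^sub>R y\<close> the
  projections of a chord of length \<open>d\<close> to two lines. Their lengths differ by at most
  \<open>2 * d\<^sup>2\<close>, so \<open>a * norm (x - y)\<close> is at most
  \<open>4 * d\<^sup>2\<close>, and \<open>a\<close> is at least \<open>d / 2\<close>.\<close>

lemma unit_vectors_close:
  fixes x y :: R3
  assumes xy: "norm x = 1" "norm y = 1" and ab: "0 \<le> a" "0 \<le> b"
    and d: "0 < d" "d / 2 \<le> a" "norm (a *\<^sub>R x - b *\<^sub>R y) \<le> 2 * d\<^sup>2"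
  shows "norm (x - y) \<le> 8 * d"
proof -
  have "\<bar>b - a\<bar> = \<bar>norm (b *\<^sub>R y) - norm (a *\<^sub>R x)\<bar>" using xy ab by simp
  also have "\<dots> \<le> norm (a *\<^sub>R x - b *\<^sub>R y)"
    using norm_triangle_ineq3[of "b *\<^sub>R y" "a *\<^sub>R x"] by (simp add: norm_minus_commute)
  finally have ba: "\<bar>b - a\<bar> \<le> 2 * d\<^sup>2" using d(3) by simp
  have "a *\<^sub>R (x - y) = (a *\<^sub>R x - b *\<^sub>R y) + (b - a) *\<^sub>R y" by (simp add: algebra_simps)
  then have "a * norm (x - y) = norm ((a *\<^sub>R x - b *\<^sub>R y) + (b - a) *\<^sub>R y)"
    using ab by (metis abs_of_nonneg norm_scaleR)
  also have "\<dots> \<le> norm (a *\<^sub>R x - b *\<^sub>R y) + \<bar>b - a\<bar>"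
    using norm_triangle_ineq[of "a *\<^sub>R x - b *\<^sub>R y" "(b - a) *\<^sub>R y"] xy by simp
  finally have "a * norm (x - y) \<le> 4 * d\<^sup>2" using ba d(3) by simp
  moreover have "d / 2 * norm (x - y) \<le> a * norm (x - y)" using d by (intro mult_right_mono) auto
  ultimately have "d * norm (x - y) \<le> d * (8 * d)" by (simp add: power2_eq_square)
  then show ?thesis using d(1) by (simp add: mult_le_cancel_left_pos)
qed

text \<open>The chord lies within \<open>|q - p|\<^sup>2\<close> of both tangent lines, so these are close up to orientation.\<close>

lemma tangents_close:
  assumes c: "arclength_param c L \<gamma>" and T: "1 \<le> Thi \<gamma>" and d: "dist (c s) (c t) \<le> 1/2"
  shows "norm (tangent_at c s - tangent_at c t) \<le> 8 * dist (c s) (c t) \<or>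
         norm (tangent_at c s + tangent_at c t) \<le> 8 * dist (c s) (c t)"
proof -
  let ?u = "tangent_at c s" and ?v = "tangent_at c t" and ?d = "dist (c s) (c t)"
  have unit: "norm ?u = 1" "norm ?v = 1" using arclength_paramD(6)[OF c] by auto
  show ?thesis
  proof (cases "c s = c t")
    case True
    \<comment> \<open>There is no chord here, but both tangents span the same tangent line, so they
      agree up to sign, as distance \<open>0\<close> requires.\<close>
    then have "?u \<in> span {?v}"
      using tan_space_curve[OF c, of s] tan_space_curve[OF c, of t] by (simp add: span_base)
    then obtain k where k: "?u = k *\<^sub>R ?v" unfolding span_singleton by auto
    then have "\<bar>k\<bar> = 1" using unit by simp
    then have "?u = ?v \<or> ?u = - ?v" unfolding k by (cases "0 \<le> k") auto
    then show ?thesis using True by auto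
  next
    case False
    let ?w = "c t - c s"
    let ?a = "?w \<bullet> ?u" and ?b = "?w \<bullet> ?v"
    have dw: "?d = norm ?w" by (simp add: dist_norm norm_minus_commute)
    have mem: "c s \<in> \<gamma>" "c t \<in> \<gamma>" using arclength_paramD(2)[OF c] by auto
    have a: "norm (?w - ?a *\<^sub>R ?u) \<le> ?d\<^sup>2"
      using normal_component_le[OF c T mem(2), of s] unfolding dw .
    have "norm (- (?w - ?b *\<^sub>R ?v)) \<le> ?d\<^sup>2"
      using normal_component_le[OF c T mem(1), of t] unfolding dist_norm
      by (simp add: inner_diff_left algebra_simps)
    then have b: "norm (?w - ?b *\<^sub>R ?v) \<le> ?d\<^sup>2" by (simp only: norm_minus_cancel)
    have pos: "0 < ?d" using False by simp
    have "?d = norm ((?w - ?a *\<^sub>R ?u) + ?a *\<^sub>R ?u)" by (simp add: dw)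
    also have "\<dots> \<le> ?d\<^sup>2 + \<bar>?a\<bar>"
      using norm_triangle_ineq[of "?w - ?a *\<^sub>R ?u" "?a *\<^sub>R ?u"] a unit by simp
    finally have "?d \<le> ?d\<^sup>2 + \<bar>?a\<bar>" .
    \<comment> \<open>From \<open>?d \<le> 1/2\<close>: the normal part takes at most half of the
      chord, so the tangential part is at least half its length.\<close>
    moreover have "?d\<^sup>2 \<le> ?d / 2" using d pos mult_right_mono[of ?d "1/2" ?d] by (simp add: power2_eq_square)
    ultimately have half: "?d / 2 \<le> \<bar>?a\<bar>" by simp
    \<comment> \<open>Both tangents are oriented along the chord, which makes the coefficients
      nonnegative.\<close>
    define x where "x = (if 0 \<le> ?a then ?u else - ?u)"
    define y where "y = (if 0 \<le> ?b then ?v else - ?v)"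
    have xy: "\<bar>?a\<bar> *\<^sub>R x = ?a *\<^sub>R ?u" "\<bar>?b\<bar> *\<^sub>R y = ?b *\<^sub>R ?v" by (auto simp: x_def y_def)
    have "norm (\<bar>?a\<bar> *\<^sub>R x - \<bar>?b\<bar> *\<^sub>R y) = norm ((?w - ?b *\<^sub>R ?v) - (?w - ?a *\<^sub>R ?u))"
      unfolding xy by (simp add: algebra_simps)
    also have "\<dots> \<le> 2 * ?d\<^sup>2"
      using norm_triangle_ineq4[of "?w - ?b *\<^sub>R ?v" "?w - ?a *\<^sub>R ?u"] a b by simp
    finally have "norm (x - y) \<le> 8 * ?d"
      using unit pos half by (intro unit_vectors_close[where a = "\<bar>?a\<bar>" and b = "\<bar>?b\<bar>"]) (auto simp: x_def y_def)
    moreover have "norm (x - y) = norm (?u - ?v) \<or> norm (x - y) = norm (?u + ?v)"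
      unfolding x_def y_def
      using norm_minus_cancel[of "?u + ?v"] norm_minus_commute[of ?u ?v] by auto
    ultimately show ?thesis by metis
  qed
qed

section \<open>Curves with matching samples\<close>

lemma arclength_param_lipschitz:
  assumes c: "arclength_param c L \<gamma>" shows "dist (c s) (c t) \<le> \<bar>s - t\<bar>"
proof -
  have "norm (c s - c t) \<le> 1 * norm (s - t)"
  proof (rule differentiable_bound[where S = UNIV and f' = "\<lambda>r h. h *\<^sub>R tangent_at c r"])
    show "(c has_derivative (\<lambda>h. h *\<^sub>R tangent_at c r)) (at r)" for r
      using arclength_paramD(5)[OF c] unfolding has_vector_derivative_def .
    show "onorm (\<lambda>h. h *\<^sub>R tangent_at c r) \<le> 1" for r
      using arclength_paramD(6)[OF c, of r] by (intro onorm_le) simp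
  qed auto
  then show ?thesis by (simp add: dist_norm)
qed

text \<open>The net covers the parameter line only modulo the period, while
  \<open>corr_tangents\<close> compares parameters that are really within \<open>e / 2\<close> of a
  sample; hence the shifted parameter \<open>r\<close>.\<close>

lemma cyclic_net_sample:
  assumes c: "arclength_param c L \<gamma>" and net: "cyclic_net L (e / 2) ss"
  obtains i r where "i < length ss" "\<bar>r - ss!i\<bar> \<le> e / 2" "c r = c s" "dist (c r) (c (ss!i)) \<le> e / 2"
proof -
  obtain s0 m where s0: "s0 \<in> set ss" "\<bar>s - (s0 + of_int m * L)\<bar> \<le> e / 2"
    using net unfolding cyclic_net_def by blast
  then obtain i where i: "i < length ss" "ss!i = s0" by (metis in_set_conv_nth)
  show thesis
  proof (rule that[OF i(1)])
    show r: "\<bar>(s - of_int m * L) - ss!i\<bar> \<le> e / 2" using s0(2) i(2) by (simp add: algebra_simps)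
    show "c (s - of_int m * L) = c s"
      using arclength_param_periodic[OF c, of s "- m"] by simp
    show "dist (c (s - of_int m * L)) (c (ss!i)) \<le> e / 2"
      using arclength_param_lipschitz[OF c, of "s - of_int m * L" "ss!i"] r by simp
  qed
qed

text \<open>Each of the three coordinates differs by at most \<open>e\<close>, and their sum bounds
  the Euclidean norm.\<close>

lemma dist_le_if_same_cube:
  assumes e: "0 < e" and eq: "cube_of e x = cube_of e y"
  shows "dist x y \<le> 3 * e"
proof -
  have "\<bar>(x - y)$i\<bar> \<le> e" for i
  proof -
    have "\<lfloor>x$i / e + 1/2\<rfloor> = \<lfloor>y$i / e + 1/2\<rfloor>"
      using arg_cong[OF eq, of "\<lambda>k. k$i"] by (simp add: cube_of_def)
    then have "\<bar>x$i / e - y$i / e\<bar> \<le> 1" by linarith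
    then have "\<bar>x$i - y$i\<bar> / e \<le> 1" using e by (simp add: diff_divide_distrib[symmetric])
    then show ?thesis using e by (simp add: divide_le_eq)
  qed
  then have "(\<Sum>i\<in>UNIV. \<bar>(x - y)$i\<bar>) \<le> (\<Sum>i\<in>(UNIV::3 set). e)" by (intro sum_mono) auto
  then show ?thesis
    using norm_le_l1_cart[of "x - y"] by (simp add: dist_norm)
qed

text \<open>The parameter \<open>r\<close> of the point \<open>c s\<close> may differ from \<open>s\<close> by a multiple of the period.\<close>

definition curves_match :: "real \<Rightarrow> real \<Rightarrow> (real \<Rightarrow> R3) \<Rightarrow> (real \<Rightarrow> R3) \<Rightarrow> bool" where
  "curves_match e \<alpha> c c' \<longleftrightarrow>
     (\<forall>s. \<exists>r t. c r = c s \<and> dist (c r) (c' t) \<le> 4 * e \<and>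
            dir_angle (tangent_at c r) (tangent_at c' t) \<le> \<alpha>)"

text \<open>The bound \<open>4 * e\<close> has room for the step of \<open>e / 2\<close> from a
  point to its sample and the \<open>3 * e\<close> between two samples in the same cube.\<close>

lemma curves_match_if_corr_tangents:
  assumes c: "arclength_param c L \<gamma>" "cyclic_net L (e / 2) ss"
    and c': "arclength_param c' L' \<gamma>'" "length ss' = length ss"
    and cubes: "\<And>i. i < length ss \<Longrightarrow> cube_of e (c (ss!i)) = cube_of e (c' (ss'!i))"
    and corr: "corr_tangents e \<alpha> c ss c' ss'" and e: "0 < e"
  shows "curves_match e \<alpha> c c'"
  unfolding curves_match_def
proof
  fix s
  obtain i r where i: "i < length ss" "\<bar>r - ss!i\<bar> \<le> e / 2" "c r = c s" "dist (c r) (c (ss!i)) \<le> e / 2"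
    using cyclic_net_sample[OF c] .
  have "dist (c (ss!i)) (c' (ss'!i)) \<le> 3 * e" by (rule dist_le_if_same_cube[OF e cubes[OF i(1)]])
  then have "dist (c r) (c' (ss'!i)) \<le> 4 * e"
    using dist_triangle[of "c r" "c' (ss'!i)" "c (ss!i)"] i(4) e by simp
  moreover have "dir_angle (tangent_at c r) (tangent_at c' (ss'!i)) \<le> \<alpha>"
    using corr i(1,2) e unfolding corr_tangents_def by simp
  ultimately show "\<exists>r t. c r = c s \<and> dist (c r) (c' t) \<le> 4 * e \<and>
            dir_angle (tangent_at c r) (tangent_at c' t) \<le> \<alpha>"
    using i(3) by blast
qed

lemma corr_tangents_sym:
  "length ss' = length ss \<Longrightarrow> corr_tangents e \<alpha> c ss c' ss' \<Longrightarrow> corr_tangents e \<alpha> c' ss' c ss"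
  unfolding corr_tangents_def by (simp add: dir_angle_commute)

text \<open>The partner of \<open>x\<close> and the point \<open>y\<close> are both within
  \<open>4 * e\<close> of \<open>x\<close>, hence at most \<open>8 * e\<close> apart on the second
  curve, where the unit tangent changes by at most \<open>64 * e\<close> up to sign. The condition
  \<open>16 * e \<le> 1\<close> keeps this chord within the range of
  \<open>tangents_close\<close>.\<close>

lemma tangents_close_matched:
  assumes c: "arclength_param c L \<gamma>" and c': "arclength_param c' L' \<gamma>'"
    and T: "1 \<le> Thi \<gamma>'" and match: "curves_match e \<alpha> c c'"
    and e: "0 < e" "16 * e \<le> 1"
    and x: "x \<in> \<gamma>" and y: "y \<in> \<gamma>'" and xy: "dist x y \<le> 4 * e"
  obtains u v where "norm u = 1" "norm v = 1" "tan_space \<gamma> x = span {u}" "tan_space \<gamma>' y = span {v}"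
    "norm (u - v) \<le> \<alpha> + 64 * e \<or> norm (u + v) \<le> \<alpha> + 64 * e"
proof -
  obtain s where s: "x = c s" using x arclength_paramD(2)[OF c] by blast
  obtain q where q: "y = c' q" using y arclength_paramD(2)[OF c'] by blast
  obtain r t where rt: "c r = c s" "dist (c r) (c' t) \<le> 4 * e"
      "dir_angle (tangent_at c r) (tangent_at c' t) \<le> \<alpha>"
    using match unfolding curves_match_def by blast
  let ?u = "tangent_at c r" and ?w = "tangent_at c' t" and ?v = "tangent_at c' q"
  have unit: "norm ?u = 1" "norm ?w = 1" "norm ?v = 1"
    using arclength_paramD(6)[OF c] arclength_paramD(6)[OF c'] by auto
  have uw: "norm (?u - ?w) \<le> \<alpha>"
    using norm_diff_le_dir_angle[OF unit(1,2)] rt(3) by simp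
  have d: "dist (c' t) (c' q) \<le> 8 * e"
    using dist_triangle[of "c' t" "c' q" x] rt xy s q by (simp add: dist_commute)
  then have "norm (?w - ?v) \<le> 64 * e \<or> norm (?w + ?v) \<le> 64 * e"
    using tangents_close[OF c' T, of t q] e by linarith
  then have "norm (?u - ?v) \<le> \<alpha> + 64 * e \<or> norm (?u + ?v) \<le> \<alpha> + 64 * e"
    using uw norm_triangle_ineq[of "?u - ?w" "?w - ?v"] norm_triangle_ineq[of "?u - ?w" "?w + ?v"]
    by auto
  moreover have "tan_space \<gamma> x = span {?u}"
    using tan_space_curve[OF c, of r] rt(1) s by simp
  moreover have "tan_space \<gamma>' y = span {?v}"
    using tan_space_curve[OF c', of q] q by simp
  ultimately show thesis using that unit by blast
qed

text \<open>At the matched point itself the angle bound is inherited without loss, since the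
  compared unit tangents span the two lines.\<close>

lemma curves_match_point:
  assumes c: "arclength_param c L \<gamma>" and c': "arclength_param c' L' \<gamma>'"
    and match: "curves_match e \<alpha> c c'" and x: "x \<in> \<gamma>"
  obtains y where "y \<in> \<gamma>'" "dist x y \<le> 4 * e" "line_angle (tan_space \<gamma> x) (tan_space \<gamma>' y) \<le> \<alpha>"
proof -
  obtain s where s: "x = c s" using x arclength_paramD(2)[OF c] by blast
  obtain r t where rt: "c r = c s" "dist (c r) (c' t) \<le> 4 * e"
      "dir_angle (tangent_at c r) (tangent_at c' t) \<le> \<alpha>"
    using match unfolding curves_match_def by blast
  have "tangent_at c r \<noteq> 0" "tangent_at c' t \<noteq> 0"
    using arclength_paramD(6)[OF c, of r] arclength_paramD(6)[OF c', of t] by auto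
  then have "line_angle (tan_space \<gamma> (c r)) (tan_space \<gamma>' (c' t)) \<le> \<alpha>"
    unfolding tan_space_curve[OF c] tan_space_curve[OF c']
    using rt(3) by (intro order_trans[OF line_angle_le_dir_angle]) (auto simp: span_base)
  then show thesis using that[of "c' t"] rt s arclength_paramD(2)[OF c'] by simp
qed

lemma line_angle_commute: "line_angle U V = line_angle V U"
proof -
  have "{dir_angle u v | u v. u \<in> U - {0} \<and> v \<in> V - {0}} = {dir_angle u v | u v. u \<in> V - {0} \<and> v \<in> U - {0}}"
    using dir_angle_commute by blast
  then show ?thesis unfolding line_angle_def by simp
qed

text \<open>A matched point bounds the distance to a nearest point by \<open>4 * e\<close>, in
  either direction, so the tangent estimate covers both nearest-point correspondences. The factor
  \<open>3\<close> passes from chords to angles.\<close>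

lemma cores_close_if_match:
  assumes c: "arclength_param c L \<gamma>" and c': "arclength_param c' L' \<gamma>'"
    and T: "1 \<le> Thi \<gamma>'" and match: "curves_match e \<alpha> c c'" "curves_match e \<alpha> c' c"
    and e: "0 < e" "16 * e \<le> 1" and \<alpha>: "4 * e \<le> \<eta>" "3 * (\<alpha> + 64 * e) \<le> \<eta>"
  shows "cores_close \<eta> \<gamma> \<gamma>'"
proof -
  have near: "\<exists>y\<in>\<gamma>'. dist x y \<le> 4 * e" if "x \<in> \<gamma>" for x
    using curves_match_point[OF c c' match(1) that] by metis
  have near': "\<exists>x\<in>\<gamma>. dist x y \<le> 4 * e" if "y \<in> \<gamma>'" for y
    using curves_match_point[OF c' c match(2) that] dist_commute by metis
  have "line_angle (tan_space \<gamma> x) (tan_space \<gamma>' y) \<le> \<eta>"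
    if x: "x \<in> \<gamma>" and y: "y \<in> \<gamma>'" and xy: "dist x y = infdist x \<gamma>' \<or> dist x y = infdist y \<gamma>" for x y
  proof -
    have "infdist x \<gamma>' \<le> 4 * e" using near[OF x] infdist_le[of _ \<gamma>' x] order_trans by blast
    moreover have "infdist y \<gamma> \<le> 4 * e"
      using near'[OF y] infdist_le[of _ \<gamma> y] order_trans unfolding dist_commute[of _ y] by blast
    ultimately have "dist x y \<le> 4 * e" using xy by auto
    then obtain u v where uv: "norm u = 1" "norm v = 1" "tan_space \<gamma> x = span {u}" "tan_space \<gamma>' y = span {v}"
        "norm (u - v) \<le> \<alpha> + 64 * e \<or> norm (u + v) \<le> \<alpha> + 64 * e"
      using tangents_close_matched[OF c c' T match(1) e x y] by metis
    show ?thesis using line_angle_span_le[OF uv(1,2,5)] \<alpha>(2) uv(3,4) by simp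
  qed
  moreover have "hausdorff_close \<eta> \<gamma> \<gamma>'"
    unfolding hausdorff_close_def using near near' \<alpha>(1) by (meson order_trans)
  ultimately show ?thesis unfolding cores_close_def by blast
qed

text \<open>The normal vector \<open>n\<close> is orthogonal to the tangent at \<open>p\<close>,
  which is close to \<open>w\<close> up to sign, so projecting \<open>n\<close> to the normal plane
  at \<open>p'\<close> moves it only by \<open>\<bar>n \<bullet> w\<bar>\<close>. Since
  \<open>n\<close> has length \<open>1/2\<close>, projection and rescaling each cost at most half of
  \<open>\<alpha> + 64 * e\<close>; the change of core point costs \<open>4 * e\<close>.\<close>

lemma tube_ident_exists:
  assumes c: "arclength_param c L \<gamma>" and c': "arclength_param c' L' \<gamma>'"
    and T: "1 \<le> Thi \<gamma>'" and match: "curves_match e \<alpha> c c'"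
    and e: "0 < e" "16 * e \<le> 1" and \<alpha>: "\<alpha> + 64 * e < 1"
    and x: "x \<in> tube_bd \<gamma>"
  obtains x' where "tube_ident \<gamma> \<gamma>' x x'" "dist x' x \<le> 4 * e + (\<alpha> + 64 * e)"
proof -
  obtain p n where p: "p \<in> \<gamma>" "n \<in> normal_space \<gamma> p" "norm n = rho0" "x = p + n"
    using tube_bd_decomposition[OF c x] .
  obtain p' where p': "p' \<in> \<gamma>'" "dist p p' = infdist p \<gamma>'"
    using nearest_point_exists[OF c'] .
  have pp: "dist p p' \<le> 4 * e"
    using curves_match_point[OF c c' match p(1)] infdist_le[of _ \<gamma>' p] p'(2) order_trans by metis
  obtain u w where uw: "norm u = 1" "norm w = 1" "tan_space \<gamma> p = span {u}" "tan_space \<gamma>' p' = span {w}"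
      "norm (u - w) \<le> \<alpha> + 64 * e \<or> norm (u + w) \<le> \<alpha> + 64 * e"
    using tangents_close_matched[OF c c' T match e p(1) p'(1) pp] .
  have nu: "n \<bullet> u = 0"
    using p(2) unfolding normal_space_def orthogonal_comp_def uw(3)
    by (auto simp: orthogonal_def inner_commute span_base)
  have nw: "\<bar>n \<bullet> w\<bar> \<le> (\<alpha> + 64 * e) / 2"
  proof -
    have "\<bar>n \<bullet> w\<bar> = \<bar>n \<bullet> (u - w)\<bar>" "\<bar>n \<bullet> w\<bar> = \<bar>n \<bullet> (u + w)\<bar>"
      using nu by (simp_all add: inner_diff_right inner_add_right)
    then have "2 * \<bar>n \<bullet> w\<bar> \<le> norm (u - w)" "2 * \<bar>n \<bullet> w\<bar> \<le> norm (u + w)"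
      using Cauchy_Schwarz_ineq2[of n "u - w"] Cauchy_Schwarz_ineq2[of n "u + w"] p(3)
      unfolding rho0_def by simp_all
    with uw(5) show ?thesis by (elim disjE) (simp_all add: field_simps)
  qed
  define v where "v = n - (n \<bullet> w) *\<^sub>R w"
  have w1: "w \<bullet> w = 1" using uw(2) by (simp add: norm_eq_1)
  have vw: "v \<bullet> w = 0" unfolding v_def by (simp add: inner_diff_left w1)
  have v_normal: "v \<in> normal_space \<gamma>' p'"
    unfolding normal_space_def uw(4) orthogonal_comp_def
    using vw by (auto simp: orthogonal_def span_singleton inner_commute)
  have nv: "n - v \<in> tan_space \<gamma>' p'"
    unfolding uw(4) v_def by (simp add: span_base span_scale)
  have nv_le: "norm (n - v) \<le> (\<alpha> + 64 * e) / 2"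
    using nw uw(2) by (simp add: v_def)
  \<comment> \<open>The projection removes less than \<open>1/2\<close>, the length of
    \<open>n\<close>.\<close>
  have "v \<noteq> 0" using nv_le \<alpha> p(3) unfolding rho0_def by auto
  define x' where "x' = p' + (rho0 / norm v) *\<^sub>R v"
  have "tube_ident \<gamma> \<gamma>' x x'"
    unfolding tube_ident_def x'_def using p p' v_normal nv \<open>v \<noteq> 0\<close> by blast
  moreover have "dist x' x \<le> 4 * e + (\<alpha> + 64 * e)"
  proof -
    have "(rho0 / norm v) *\<^sub>R v - v = ((rho0 - norm v) / norm v) *\<^sub>R v"
      using \<open>v \<noteq> 0\<close> by (simp add: diff_divide_distrib algebra_simps)
    then have "norm ((rho0 / norm v) *\<^sub>R v - v) = \<bar>norm n - norm v\<bar>"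
      using \<open>v \<noteq> 0\<close> p(3) by simp
    also have "\<dots> \<le> norm (n - v)" by (rule norm_triangle_ineq3)
    finally have 1: "norm ((rho0 / norm v) *\<^sub>R v - v) \<le> norm (n - v)" .
    have tri: "norm (a + (b + k)) \<le> norm a + (norm b + norm k)" for a b k :: R3
      using norm_triangle_ineq[of a "b + k"] norm_triangle_ineq[of b k] by linarith
    have "x' - x = (p' - p) + (((rho0 / norm v) *\<^sub>R v - v) + (v - n))"
      by (simp add: x'_def p(4))
    then have "norm (x' - x) \<le> norm (p' - p) + (norm ((rho0 / norm v) *\<^sub>R v - v) + norm (v - n))"
      by (simp only: tri)
    then show ?thesis
      using 1 nv_le pp unfolding dist_norm norm_minus_commute[of p p'] norm_minus_commute[of v n]
      by (simp add: field_simps)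
  qed
  ultimately show thesis by (rule that)
qed

text \<open>The other components form a finite union of compact sets, so they miss a ball about
  \<open>x\<close>, and the tangent cone is local.\<close>

lemma tan_space_component:
  assumes fin: "finite (components S)" and comp: "\<And>B. B \<in> components S \<Longrightarrow> compact B"
    and B: "B \<in> components S" and x: "x \<in> B"
  shows "tan_space S x = tan_space B x"
proof -
  let ?R = "\<Union>(components S - {B})"
  have S: "S = B \<union> ?R" using B Union_components[of S] by blast
  have "closed ?R"
    using fin comp by (intro closed_Union) (auto intro: compact_imp_closed)
  moreover have "x \<notin> ?R"
    using B x components_eq[of B S] by blast
  ultimately obtain d where d: "0 < d" "\<forall>y\<in>?R. d \<le> dist x y"
    using separate_point_closed by metis
  have "S \<inter> ball x d \<subseteq> B"
  proof
    fix y assume y: "y \<in> S \<inter> ball x d"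
    then have "y \<notin> ?R" using d(2) by fastforce
    then show "y \<in> B" using y S by blast
  qed
  then have "tan_cone S x \<subseteq> tan_cone B x" by (rule tan_cone_local[OF d(1)])
  moreover have "B \<inter> ball x d \<subseteq> S" using S by blast
  then have "tan_cone B x \<subseteq> tan_cone S x" by (rule tan_cone_local[OF d(1)])
  ultimately show ?thesis unfolding tan_space_def by simp
qed

section \<open>Pairs with the same code\<close>

lemma takeWhile_marked:
  assumes "m \<notin> set u" "R = [] \<or> hd R = m"
  shows "takeWhile (\<lambda>x. x \<noteq> m) (u @ R) = u"
  using assms by (cases R) (auto simp: takeWhile_append)

text \<open>The marker occurs in no block, so every block is what stands before the next marker or
  the end. With the marker \<open>BdStart\<close> this separates the boundary components.\<close>

lemma concat_marked_inject:
  assumes "\<And>x. m \<notin> set (f x)" "\<And>y. m \<notin> set (g y)"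
    and "concat (map (\<lambda>x. m # f x) xs) = concat (map (\<lambda>y. m # g y) ys)"
  shows "map f xs = map g ys"
  using assms(3)
proof (induction xs arbitrary: ys)
  case Nil
  then show ?case by (cases ys) auto
next
  case (Cons x xs)
  then obtain y ys' where ys: "ys = y # ys'" by (cases ys) auto
  let ?R = "concat (map (\<lambda>x. m # f x) xs)" and ?R' = "concat (map (\<lambda>y. m # g y) ys')"
  have R: "?R = [] \<or> hd ?R = m" by (cases xs) auto
  have R': "?R' = [] \<or> hd ?R' = m" by (cases ys') auto
  have eq: "f x @ ?R = g y @ ?R'" using Cons.prems ys by simp
  have "f x = g y"
    using takeWhile_marked[OF assms(1) R, of x] takeWhile_marked[OF assms(2) R', of y] eq by simp
  then show ?case using Cons.IH[of ys'] eq ys by simp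
qed

definition curve_letters where
  "curve_letters S d =
     map (\<lambda>s. Curve (cube_of (eps S) (cpar d s)) (qgam S (tangent_at (cpar d) s))) (csam d)"

definition tri_letters where
  "tri_letters S \<gamma> F d =
     map (\<lambda>f. Tri (cube_of (eps S) (tri_center f)) (qF S (normal_space F (tri_center f)))
                  (Blab S \<gamma> F (f ` std_tri))) (tris d)"

definition bd_letters where
  "bd_letters S p = map (\<lambda>s. Bd (cube_of (eps S) (fst p s)) (qbd S (tangent_at (fst p) s))) (snd (snd p))"

text \<open>Each layer has its own constructors, so filtering recovers it without knowledge of the
  lengths of the other layers. The boundary layer keeps its \<open>BdStart\<close> markers.\<close>

lemma filter_raw_word:
  shows "filter (\<lambda>l. \<exists>k v. l = Curve k v) (raw_word S \<gamma> F d) = curve_letters S d"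
    and "filter (\<lambda>l. \<exists>k l' b. l = Tri k l' b) (raw_word S \<gamma> F d) = tri_letters S \<gamma> F d"
    and "filter (\<lambda>l. l = BdStart \<or> (\<exists>k v. l = Bd k v)) (raw_word S \<gamma> F d) =
           concat (map (\<lambda>p. BdStart # bd_letters S p) (bds d))"
proof -
  define X where "X = [Adj i j. i \<leftarrow> [0..<length (tris d)], j \<leftarrow> [Suc i..<length (tris d)],
               share_edge (tris d ! i) (tris d ! j)]"
  define Y where "Y = [Inc i j (Jlab S \<gamma> F (curve_edge (cpar d) (clen d) (csam d) i) ((tris d ! j) ` std_tri)).
        i \<leftarrow> [0..<length (csam d)], j \<leftarrow> [0..<length (tris d)],
        close_cubes (cube_of (eps S) (cpar d (csam d ! i))) (cube_of (eps S) (tri_center (tris d ! j)))]"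
  define Z where "Z = concat (map (\<lambda>p. BdStart # bd_letters S p) (bds d))"
  have w: "raw_word S \<gamma> F d = curve_letters S d @ tri_letters S \<gamma> F d @ X @ Z @ Y"
    unfolding raw_word_def curve_letters_def tri_letters_def X_def Y_def Z_def bd_letters_def
    by (simp add: case_prod_unfold)
  have X: "\<exists>i j. l = Adj i j" if "l \<in> set X" for l using that unfolding X_def by auto
  have Y: "\<exists>i j b. l = Inc i j b" if "l \<in> set Y" for l using that unfolding Y_def by auto
  have Z: "l = BdStart \<or> (\<exists>k v. l = Bd k v)" if "l \<in> set Z" for l
    using that unfolding Z_def bd_letters_def by (auto split: if_splits)
  have C: "\<exists>k v. l = Curve k v" if "l \<in> set (curve_letters S d)" for l
    using that unfolding curve_letters_def by auto
  have T: "\<exists>k l' b. l = Tri k l' b" if "l \<in> set (tri_letters S \<gamma> F d)" for l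
    using that unfolding tri_letters_def by auto
  have none: "filter P U = []" if "\<And>l. l \<in> set U \<Longrightarrow> \<not> P l" for P and U :: "letter list"
    using that by (simp add: filter_empty_conv)
  have all: "filter P U = U" if "\<And>l. l \<in> set U \<Longrightarrow> P l" for P and U :: "letter list"
    using that by (simp add: filter_id_conv)
  let ?C = "\<lambda>l. \<exists>k v. l = Curve k v" and ?T = "\<lambda>l. \<exists>k l' b. l = Tri k l' b"
  let ?B = "\<lambda>l. l = BdStart \<or> (\<exists>k v. l = Bd k v)"
  have "filter ?C (curve_letters S d) = curve_letters S d" "filter ?C (tri_letters S \<gamma> F d) = []"
    "filter ?C X = []" "filter ?C Z = []" "filter ?C Y = []"
    by (rule all none, auto dest!: C T X Y Z)+
  then show "filter ?C (raw_word S \<gamma> F d) = curve_letters S d" unfolding w by simp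
  have "filter ?T (curve_letters S d) = []" "filter ?T (tri_letters S \<gamma> F d) = tri_letters S \<gamma> F d"
    "filter ?T X = []" "filter ?T Z = []" "filter ?T Y = []"
    by (rule all none, auto dest!: C T X Y Z)+
  then show "filter ?T (raw_word S \<gamma> F d) = tri_letters S \<gamma> F d" unfolding w by simp
  have "filter ?B (curve_letters S d) = []" "filter ?B (tri_letters S \<gamma> F d) = []"
    "filter ?B X = []" "filter ?B Z = Z" "filter ?B Y = []"
    by (rule all none, auto dest!: C T X Y Z)+
  then show "filter ?B (raw_word S \<gamma> F d) = concat (map (\<lambda>p. BdStart # bd_letters S p) (bds d))"
    unfolding w Z_def[symmetric] by simp
qed

text \<open>Only numbers of cells and their cubes are read off; angles between corresponding
  directions are left to the encoding constant.\<close>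

lemma raw_word_eqD:
  assumes eq: "raw_word S \<gamma> F d = raw_word S \<gamma>' F' d'"
  shows "length (csam d') = length (csam d)"
    and "\<And>i. i < length (csam d) \<Longrightarrow>
      cube_of (eps S) (cpar d (csam d ! i)) = cube_of (eps S) (cpar d' (csam d' ! i))"
    and "length (tris d') = length (tris d)"
    and "\<And>k. k < length (tris d) \<Longrightarrow>
      cube_of (eps S) (tri_center (tris d ! k)) = cube_of (eps S) (tri_center (tris d' ! k))"
    and "length (bds d') = length (bds d)"
    and "\<And>j. j < length (bds d) \<Longrightarrow> length (snd (snd (bds d' ! j))) = length (snd (snd (bds d ! j)))"
    and "\<And>j i. j < length (bds d) \<Longrightarrow> i < length (snd (snd (bds d ! j))) \<Longrightarrow>
      cube_of (eps S) (fst (bds d ! j) (snd (snd (bds d ! j)) ! i)) =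
      cube_of (eps S) (fst (bds d' ! j) (snd (snd (bds d' ! j)) ! i))"
proof -
  have C: "curve_letters S d = curve_letters S d'"
    using arg_cong[OF eq, of "filter (\<lambda>l. \<exists>k v. l = Curve k v)"] unfolding filter_raw_word .
  show lenC: "length (csam d') = length (csam d)"
    using arg_cong[OF C, of length] by (simp add: curve_letters_def)
  show "cube_of (eps S) (cpar d (csam d ! i)) = cube_of (eps S) (cpar d' (csam d' ! i))"
    if "i < length (csam d)" for i
    using arg_cong[OF C, of "\<lambda>w. w ! i"] that lenC by (simp add: curve_letters_def)
  have T: "tri_letters S \<gamma> F d = tri_letters S \<gamma>' F' d'"
    using arg_cong[OF eq, of "filter (\<lambda>l. \<exists>k l' b. l = Tri k l' b)"] unfolding filter_raw_word .
  show lenT: "length (tris d') = length (tris d)"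
    using arg_cong[OF T, of length] by (simp add: tri_letters_def)
  show "cube_of (eps S) (tri_center (tris d ! k)) = cube_of (eps S) (tri_center (tris d' ! k))"
    if "k < length (tris d)" for k
    using arg_cong[OF T, of "\<lambda>w. w ! k"] that lenT by (simp add: tri_letters_def)
  have "concat (map (\<lambda>p. BdStart # bd_letters S p) (bds d)) =
      concat (map (\<lambda>p. BdStart # bd_letters S p) (bds d'))"
    using arg_cong[OF eq, of "filter (\<lambda>l. l = BdStart \<or> (\<exists>k v. l = Bd k v))"] unfolding filter_raw_word .
  then have B: "map (bd_letters S) (bds d) = map (bd_letters S) (bds d')"
    by (rule concat_marked_inject[rotated 2]) (auto simp: bd_letters_def)
  show lenB: "length (bds d') = length (bds d)"
    using arg_cong[OF B, of length] by simp
  have Bj: "bd_letters S (bds d ! j) = bd_letters S (bds d' ! j)" if "j < length (bds d)" for j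
    using arg_cong[OF B, of "\<lambda>w. w ! j"] that lenB by simp
  show lenj: "length (snd (snd (bds d' ! j))) = length (snd (snd (bds d ! j)))" if "j < length (bds d)" for j
    using arg_cong[OF Bj[OF that], of length] by (simp add: bd_letters_def)
  show "cube_of (eps S) (fst (bds d ! j) (snd (snd (bds d ! j)) ! i)) =
      cube_of (eps S) (fst (bds d' ! j) (snd (snd (bds d' ! j)) ! i))"
    if "j < length (bds d)" "i < length (snd (snd (bds d ! j)))" for j i
    using arg_cong[OF Bj[OF that(1)], of "\<lambda>w. w ! i"] that(2) lenj[OF that(1)] by (simp add: bd_letters_def)
qed

section \<open>Comparing surfaces and boundary systems\<close>

text \<open>The centre is the average of the three vertices. A diameter controls distances only in a
  bounded set, and boundedness of the curved triangle comes from its Lipschitz bound.\<close>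

lemma triangle_near_center:
  assumes tri: "triangulates A e F fs" and f: "f \<in> set fs" and x: "x \<in> f ` std_tri"
  shows "tri_center f \<in> f ` std_tri" "dist x (tri_center f) \<le> e"
proof -
  have "(\<chi> i. 1/3) = (1/3) *\<^sub>R (0::real^2) + (1/3) *\<^sub>R axis 1 1 + (1/3) *\<^sub>R axis 2 1"
    by (simp add: vec_eq_iff forall_2 axis_def)
  then have "(\<chi> i. 1/3) \<in> std_tri"
    unfolding convex_hull_3 by (intro CollectI exI[of _ "1/3"]) auto
  then show center: "tri_center f \<in> f ` std_tri" unfolding tri_center_def by (rule imageI)
  note shape = tri[unfolded triangulates_def, THEN conjunct2, THEN conjunct1, THEN bspec, OF f]
  then have diam: "diameter (f ` std_tri) \<le> e" by (rule conjunct1)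
  from shape obtain s where s: "\<forall>a\<in>std_tri. \<forall>b\<in>std_tri. s / shape A * dist a b \<le> dist (f a) (f b) \<and>
      dist (f a) (f b) \<le> s * shape A * dist a b"
    by (elim conjE exE)
  have "bounded std_tri" by (intro bounded_convex_hull finite_imp_bounded) auto
  then obtain D where D: "\<And>a b. a \<in> std_tri \<Longrightarrow> b \<in> std_tri \<Longrightarrow> dist a b \<le> D"
    using bounded_two_points by metis
  have "dist (f a) (f b) \<le> \<bar>s * shape A\<bar> * D" if "a \<in> std_tri" "b \<in> std_tri" for a b
  proof -
    have "s * shape A * dist a b \<le> \<bar>s * shape A\<bar> * D"
      using D[OF that] by (intro mult_mono) auto
    then show ?thesis using s that by (meson order_trans)
  qed
  then have "bounded (f ` std_tri)" unfolding bounded_two_points by blast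
  then show "dist x (tri_center f) \<le> e"
    using diameter_bounded_bound[OF _ x center] diam by simp
qed

text \<open>A point is paired with the centre of the triangle in the same position: \<open>e\<close>
  to the centre of its own triangle, then \<open>3 * e\<close> between centres in the same cube. The
  angle bound holds for all pairs of points of corresponding triangles, hence for this one.\<close>

lemma surfaces_close_if_triangulations_match:
  assumes tri: "triangulates A e F fs" "triangulates A e F' fs'" and len: "length fs' = length fs"
    and cubes: "\<And>k. k < length fs \<Longrightarrow> cube_of e (tri_center (fs!k)) = cube_of e (tri_center (fs'!k))"
    and angle: "\<And>k x y. k < length fs \<Longrightarrow> x \<in> (fs!k) ` std_tri \<Longrightarrow> y \<in> (fs'!k) ` std_tri \<Longrightarrow>
        line_angle (normal_space F x) (normal_space F' y) \<le> \<delta>"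
    and e: "0 < e" "4 * e \<le> \<eta>"
  shows "surfaces_close \<eta> \<delta> F F'"
proof -
  have F: "F = (\<Union>f\<in>set fs. f ` std_tri)" and F': "F' = (\<Union>f\<in>set fs'. f ` std_tri)"
    by (fact tri(1)[unfolded triangulates_def, THEN conjunct1] tri(2)[unfolded triangulates_def, THEN conjunct1])+
  have centers: "dist (tri_center (fs!k)) (tri_center (fs'!k)) \<le> 3 * e" if "k < length fs" for k
    by (rule dist_le_if_same_cube[OF e(1) cubes[OF that]])
  have 1: "\<exists>y\<in>F'. dist x y \<le> \<eta> \<and> line_angle (normal_space F x) (normal_space F' y) \<le> \<delta>" if x: "x \<in> F" for x
  proof -
    obtain k where k: "k < length fs" "x \<in> (fs!k) ` std_tri"
      using x unfolding F by (auto simp: in_set_conv_nth)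
    let ?y = "tri_center (fs'!k)"
    have k': "fs!k \<in> set fs" "fs'!k \<in> set fs'" using k(1) len by simp_all
    have y: "?y \<in> (fs'!k) ` std_tri"
      using triangle_near_center(1)[OF tri(2) k'(2)] k(2) by blast
    have "dist x ?y \<le> e + 3 * e"
      using dist_triangle[of x ?y "tri_center (fs!k)"] centers[OF k(1)]
        triangle_near_center(2)[OF tri(1) k'(1) k(2)] by simp
    then show ?thesis using angle[OF k y] y k'(2) e(2) unfolding F' by (intro bexI[of _ ?y]) auto
  qed
  have 2: "\<exists>x\<in>F. dist x y \<le> \<eta> \<and> line_angle (normal_space F x) (normal_space F' y) \<le> \<delta>" if y: "y \<in> F'" for y
  proof -
    obtain k where k: "k < length fs'" "y \<in> (fs'!k) ` std_tri"
      using y unfolding F' by (auto simp: in_set_conv_nth)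
    let ?x = "tri_center (fs!k)"
    have k': "k < length fs" "fs!k \<in> set fs" "fs'!k \<in> set fs'" using k(1) len by simp_all
    have x: "?x \<in> (fs!k) ` std_tri"
      using triangle_near_center(1)[OF tri(1) k'(2)] k(2) by blast
    have "dist ?x y \<le> 3 * e + e"
      using dist_triangle[of ?x y "tri_center (fs'!k)"] centers[OF k'(1)]
        triangle_near_center(2)[OF tri(2) k'(3) k(2)] by (simp add: dist_commute)
    then show ?thesis using angle[OF k'(1) x k(2)] x k'(2) e(2) unfolding F by (intro bexI[of _ ?x]) auto
  qed
  show ?thesis unfolding surfaces_close_def Let_def using 1 2 by blast
qed

text \<open>Matching is known curve by curve, whereas closeness refers to tangent spaces of the
  whole boundary; these agree because there are finitely many components and all are
  compact.\<close>

lemma components_match: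
  fixes bds bds' :: "((real \<Rightarrow> R3) \<times> real \<times> real list) list"
  assumes comps: "set (map (\<lambda>(c, L, ss). range c) bds) = components S"
    and param: "\<And>j. j < length bds \<Longrightarrow> arclength_param (fst (bds!j)) (fst (snd (bds!j))) (range (fst (bds!j)))"
    and comps': "set (map (\<lambda>(c, L, ss). range c) bds') = components S'"
    and param': "\<And>j. j < length bds' \<Longrightarrow> arclength_param (fst (bds'!j)) (fst (snd (bds'!j))) (range (fst (bds'!j)))"
    and len: "length bds' = length bds"
    and match: "\<And>j. j < length bds \<Longrightarrow> curves_match e \<delta> (fst (bds!j)) (fst (bds'!j))"
    and x: "x \<in> S"
  obtains y where "y \<in> S'" "dist x y \<le> 4 * e" "line_angle (tan_space S x) (tan_space S' y) \<le> \<delta>"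
proof -
  have tan: "tan_space T z = tan_space B z"
    if T: "set (map (\<lambda>(c, L, ss). range c) bs) = components T"
      and p: "\<And>j. j < length bs \<Longrightarrow> arclength_param (fst (bs!j)) (fst (snd (bs!j))) (range (fst (bs!j)))"
      and B: "B \<in> components T" "z \<in> B" for T z B and bs :: "((real \<Rightarrow> R3) \<times> real \<times> real list) list"
  proof (rule tan_space_component[OF _ _ B])
    show "finite (components T)" unfolding T[symmetric] by simp
    fix D assume "D \<in> components T"
    then obtain j where "j < length bs" "D = range (fst (bs!j))"
      unfolding T[symmetric] by (auto simp: in_set_conv_nth case_prod_unfold)
    then show "compact D" using arclength_param_compact(1)[OF p] by simp
  qed
  obtain B where B: "B \<in> components S" "x \<in> B" using x Union_components[of S] by blast
  obtain j where j: "j < length bds" "B = range (fst (bds!j))"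
    using B(1) unfolding comps[symmetric] by (auto simp: in_set_conv_nth case_prod_unfold)
  have j': "j < length bds'" using j(1) len by simp
  let ?B' = "range (fst (bds'!j))"
  have "(\<lambda>(c, L, ss). range c) (bds'!j) \<in> components S'"
    unfolding comps'[symmetric] set_map using j' by (intro imageI nth_mem)
  then have B': "?B' \<in> components S'" by (simp add: case_prod_unfold)
  obtain y where y: "y \<in> ?B'" "dist x y \<le> 4 * e" "line_angle (tan_space B x) (tan_space ?B' y) \<le> \<delta>"
    using curves_match_point[OF param[OF j(1)] param'[OF j'] match[OF j(1)]] B(2) unfolding j(2) by metis
  show thesis
  proof (rule that[of y])
    show "y \<in> S'" using y(1) B' Union_components[of S'] by blast
    show "line_angle (tan_space S x) (tan_space S' y) \<le> \<delta>"
      using y(3) tan[OF comps param B] tan[OF comps' param' B' y(1)] by simp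
  qed (rule y(2))
qed

text \<open>A point \<open>y\<close> near \<open>x\<close> also serves for the image
  \<open>x'\<close> of \<open>x\<close> in tube coordinates:
  \<open>4 * e + (\<alpha> + 64 * e)\<close> from \<open>x'\<close> to \<open>x\<close> and
  \<open>4 * e\<close> from \<open>x\<close> to \<open>y\<close> add up to
  \<open>\<alpha> + 72 * e\<close>.\<close>

lemma boundaries_close_if_match:
  assumes c: "arclength_param c L \<gamma>" and c': "arclength_param c' L' \<gamma>'"
    and T: "1 \<le> Thi \<gamma>'" and match: "curves_match e \<alpha> c c'"
    and e: "0 < e" "16 * e \<le> 1" and \<alpha>: "\<alpha> + 64 * e < 1" and \<eta>: "\<alpha> + 72 * e \<le> \<eta>"
    and bd: "surf_bd F \<subseteq> tube_bd \<gamma>"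
    and to: "\<And>x. x \<in> surf_bd F \<Longrightarrow> \<exists>y\<in>surf_bd F'. dist x y \<le> 4 * e \<and>
        line_angle (tan_space (surf_bd F) x) (tan_space (surf_bd F') y) \<le> \<delta>"
    and fro: "\<And>y. y \<in> surf_bd F' \<Longrightarrow> \<exists>x\<in>surf_bd F. dist x y \<le> 4 * e \<and>
        line_angle (tan_space (surf_bd F) x) (tan_space (surf_bd F') y) \<le> \<delta>"
  shows "boundaries_close \<eta> \<delta> \<gamma> F \<gamma>' F'"
proof -
  have ident: "\<exists>x'. tube_ident \<gamma> \<gamma>' x x' \<and> dist x' y \<le> \<eta>"
    if x: "x \<in> surf_bd F" and xy: "dist x y \<le> 4 * e" for x y
  proof -
    obtain x' where x': "tube_ident \<gamma> \<gamma>' x x'" "dist x' x \<le> 4 * e + (\<alpha> + 64 * e)"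
      using tube_ident_exists[OF c c' T match e \<alpha>] x bd by blast
    have "dist x' y \<le> \<eta>" using dist_triangle[of x' y x] x'(2) xy \<eta> by simp
    then show ?thesis using x'(1) by blast
  qed
  show ?thesis unfolding boundaries_close_def Let_def
  proof (intro conjI ballI)
    fix x assume x: "x \<in> surf_bd F"
    from to[OF x] obtain y where "y \<in> surf_bd F'" "dist x y \<le> 4 * e"
        "line_angle (tan_space (surf_bd F) x) (tan_space (surf_bd F') y) \<le> \<delta>" by blast
    then show "\<exists>y\<in>surf_bd F'. (\<exists>x'. tube_ident \<gamma> \<gamma>' x x' \<and> dist x' y \<le> \<eta>) \<and>
        line_angle (tan_space (surf_bd F) x) (tan_space (surf_bd F') y) \<le> \<delta>"
      using ident[OF x] by blast
  next
    fix y assume y: "y \<in> surf_bd F'"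
    from fro[OF y] obtain x where "x \<in> surf_bd F" "dist x y \<le> 4 * e"
        "line_angle (tan_space (surf_bd F) x) (tan_space (surf_bd F') y) \<le> \<delta>" by blast
    then show "\<exists>x\<in>surf_bd F. (\<exists>x'. tube_ident \<gamma> \<gamma>' x x' \<and> dist x' y \<le> \<eta>) \<and>
        line_angle (tan_space (surf_bd F) x) (tan_space (surf_bd F') y) \<le> \<delta>"
      using ident[of x y] by blast
  qed
qed

lemma ess_type_eq_if_same_code:
  assumes enc: "encoding_constant c0 L0 A Cenc" and stab: "stability_constants c0 L0 cst dst"
    and S: "valid_scheme A S" "dgam S \<le> eps S" "dF S \<le> dst / (8 * max 4 (2 * Cenc))"
    and pos: "0 < \<Delta>" "0 < \<tau>" and e: "eps S \<le> min 1 (min cst dst) / (1000 * Cenc) * min 1 \<tau>"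
    and win: "window_pair c0 L0 \<Delta> \<tau> \<gamma> F" "window_pair c0 L0 \<Delta> \<tau> \<gamma>' F'"
    and code: "encoded_type A S \<gamma> F w" "encoded_type A S \<gamma>' F' w"
  shows "ess_type \<gamma> F = ess_type \<gamma>' F'"
proof -
  have C1: "1 \<le> Cenc" using enc unfolding encoding_constant_def by blast
  have cst: "0 < cst" "0 < dst" using stab unfolding stability_constants_def by blast+
  let ?e = "eps S"
  have e0: "0 < ?e" using S(1) unfolding valid_scheme_def by blast
  obtain g d where gd: "encodes A S \<gamma> F g d w" using code(1) unfolding encoded_type_def raw_words_def by blast
  obtain g' d' where gd': "encodes A S \<gamma>' F' g' d' w" using code(2) unfolding encoded_type_def raw_words_def by blast
  have rigid: "rigid g" "rigid g'" using gd gd' unfolding encodes_def normalizes_def by blast+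
  obtain Q Q' where Q: "rigid_with Q g" "rigid_with Q' g'"
    using rigid[THEN rigid_imp_rigid_with] by blast
  let ?\<gamma> = "g ` \<gamma>" and ?\<gamma>' = "g' ` \<gamma>'" and ?F = "g ` F" and ?F' = "g' ` F'"
  have adm: "admissible A S ?\<gamma> ?F d" "admissible A S ?\<gamma>' ?F' d'"
    using gd gd' unfolding encodes_def by blast+
  have eq: "raw_word S ?\<gamma> ?F d = raw_word S ?\<gamma>' ?F' d'"
    using gd gd' unfolding encodes_def by simp
  note parse = raw_word_eqD[OF eq]
  define \<alpha> where "\<alpha> = Cenc * (dgam S + ?e)"
  define \<delta> where "\<delta> = Cenc * (dF S + ?e / \<tau>)"
  \<comment> \<open>The largest demand on \<open>\<eta>\<close> is
    \<open>3 * (\<alpha> + 64 * ?e)\<close>, which is at most \<open>198 * (Cenc * ?e)\<close>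
    because \<open>\<alpha> \<le> 2 * (Cenc * ?e)\<close> and \<open>1 \<le> Cenc\<close>.\<close>
  define \<eta> where "\<eta> = 200 * (Cenc * ?e)"
  have close: "corr_tangents ?e \<alpha> (cpar d) (csam d) (cpar d') (csam d')"
    and close_tri: "\<forall>k < length (tris d). \<forall>x \<in> (tris d ! k) ` std_tri. \<forall>y \<in> (tris d' ! k) ` std_tri.
             line_angle (normal_space ?F x) (normal_space ?F' y) \<le> \<delta>"
    and close_bd: "\<forall>j < length (bds d). corr_tangents ?e \<delta>
               (fst (bds d ! j)) (snd (snd (bds d ! j))) (fst (bds d' ! j)) (snd (snd (bds d' ! j)))"
    using enc[unfolded encoding_constant_def, THEN conjunct2, rule_format, of S \<Delta> \<tau> \<gamma> F \<gamma>' F' w g d g' d']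
      S(1) pos win code gd gd' unfolding \<alpha>_def \<delta>_def by blast+
  have c: "arclength_param (cpar d) (clen d) ?\<gamma>" "cyclic_net (clen d) (?e / 2) (csam d)"
    and c': "arclength_param (cpar d') (clen d') ?\<gamma>'" "cyclic_net (clen d') (?e / 2) (csam d')"
    and tri: "triangulates A ?e ?F (tris d)" "triangulates A ?e ?F' (tris d')"
    using adm unfolding admissible_def by blast+
  have Ce: "?e \<le> Cenc * ?e" using C1 e0 by simp
  \<comment> \<open>The product \<open>Cenc * ?e\<close> is bounded in three ways: absolutely for
    the smallness conditions, through \<open>cst\<close> for \<open>\<eta>\<close>, and through
    \<open>dst\<close> relative to \<open>\<tau>\<close> for \<open>\<delta>\<close>.\<close>
  have "Cenc * ?e \<le> Cenc * (min 1 (min cst dst) / (1000 * Cenc) * min 1 \<tau>)"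
    using e C1 by (intro mult_left_mono) auto
  also have "\<dots> = min 1 (min cst dst) / 1000 * min 1 \<tau>" using C1 by simp
  finally have Ce_le: "Cenc * ?e \<le> min 1 (min cst dst) / 1000 * min 1 \<tau>" .
  have "min 1 (min cst dst) / 1000 * min 1 \<tau> \<le> 1 / 1000 * 1"
    using pos by (intro mult_mono) auto
  with Ce_le have Ce1: "Cenc * ?e \<le> 1 / 1000" by simp
  have "min 1 (min cst dst) / 1000 * min 1 \<tau> \<le> cst / 1000 * min 1 \<tau>"
    using pos by (intro mult_right_mono) auto
  with Ce_le have Ce2: "Cenc * ?e \<le> cst / 1000 * min 1 \<tau>" by simp
  have "min 1 (min cst dst) / 1000 * min 1 \<tau> \<le> dst / 1000 * \<tau>"
    using pos cst by (intro mult_mono) auto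
  with Ce_le have Ce3: "Cenc * ?e \<le> dst / 1000 * \<tau>" by simp
  have \<alpha>: "\<alpha> \<le> 2 * (Cenc * ?e)"
    using S(2) C1 mult_left_mono[of "dgam S + ?e" "2 * ?e" Cenc] unfolding \<alpha>_def by simp
  have \<eta>: "\<eta> \<le> cst * min 1 \<tau>"
  proof -
    have "0 \<le> cst * min 1 \<tau>" using cst pos by simp
    then show ?thesis using Ce2 unfolding \<eta>_def by simp
  qed
  have \<delta>: "\<delta> \<le> dst"
  proof -
    \<comment> \<open>The maximum is at least \<open>2 * Cenc\<close>, so quantization contributes
      at most \<open>dst / 16\<close> to \<open>\<delta>\<close>; the mesh adds at most
      \<open>dst / 1000\<close>.\<close>
    have "dF S \<le> dst / (16 * Cenc)"
    proof -
      have "dst / (8 * max 4 (2 * Cenc)) \<le> dst / (16 * Cenc)"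
        using cst C1 by (intro divide_left_mono) auto
      then show ?thesis using S(3) by simp
    qed
    then have "Cenc * dF S \<le> Cenc * (dst / (16 * Cenc))" using C1 by (intro mult_left_mono) auto
    then have "Cenc * dF S \<le> dst / 16" using C1 by simp
    moreover have "Cenc * ?e / \<tau> \<le> dst / 1000"
      using Ce3 pos by (simp add: pos_divide_le_eq)
    ultimately show ?thesis using cst unfolding \<delta>_def by (simp add: distrib_left)
  qed
  have small: "16 * ?e \<le> 1" "\<alpha> + 64 * ?e < 1" "4 * ?e \<le> \<eta>" "3 * (\<alpha> + 64 * ?e) \<le> \<eta>" "\<alpha> + 72 * ?e \<le> \<eta>"
  proof -
    have "a + 64 * b < 1" "4 * b \<le> 200 * x" "3 * (a + 64 * b) \<le> 200 * x" "a + 72 * b \<le> 200 * x" "16 * b \<le> 1"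
      if "a \<le> 2 * x" "b \<le> x" "x \<le> 1 / 1000" "0 < b" for a b x :: real
      using that by simp_all
    from this[OF \<alpha> Ce Ce1 e0] show "16 * ?e \<le> 1" "\<alpha> + 64 * ?e < 1" "4 * ?e \<le> \<eta>"
        "3 * (\<alpha> + 64 * ?e) \<le> \<eta>" "\<alpha> + 72 * ?e \<le> \<eta>"
      unfolding \<eta>_def by simp_all
  qed
  have match: "curves_match ?e \<alpha> (cpar d) (cpar d')"
    using curves_match_if_corr_tangents[OF c c'(1) parse(1,2) close e0] .
  have match': "curves_match ?e \<alpha> (cpar d') (cpar d)"
    using parse(1,2) by (intro curves_match_if_corr_tangents[OF c' c(1) _ _ corr_tangents_sym[OF parse(1) close] e0]) simp_all
  have thick: "1 \<le> Thi ?\<gamma>" "1 \<le> Thi ?\<gamma>'"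
    using win Thi_rigid_with[OF Q(1), of \<gamma>] Thi_rigid_with[OF Q(2), of \<gamma>'] unfolding window_pair_def by simp_all
  have cores: "cores_close \<eta> ?\<gamma> ?\<gamma>'"
    by (rule cores_close_if_match[OF c(1) c'(1) thick(2) match match' e0 small(1,3,4)])
  have surfs: "surfaces_close \<eta> \<delta> ?F ?F'"
    by (rule surfaces_close_if_triangulations_match[OF tri parse(3,4) close_tri[rule_format] e0 small(3)])
  have proper: "proper_C11_surface ?\<gamma> ?F" "proper_C11_surface ?\<gamma>' ?F'"
    using win proper_C11_surface_rigid_with[OF Q(1)] proper_C11_surface_rigid_with[OF Q(2)]
    unfolding window_pair_def by simp_all
  have bd_comps: "set (map (\<lambda>(c, L, ss). range c) (bds d)) = components (surf_bd ?F)"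
      "set (map (\<lambda>(c, L, ss). range c) (bds d')) = components (surf_bd ?F')"
    using adm unfolding admissible_def by blast+
  have bd_param: "arclength_param (fst (bds d!j)) (fst (snd (bds d!j))) (range (fst (bds d!j)))"
      "cyclic_net (fst (snd (bds d!j))) (?e / 2) (snd (snd (bds d!j)))"
    if "j < length (bds d)" for j
    using adm(1) nth_mem[OF that] unfolding admissible_def by (auto simp: case_prod_unfold)
  have bd_param': "arclength_param (fst (bds d'!j)) (fst (snd (bds d'!j))) (range (fst (bds d'!j)))"
      "cyclic_net (fst (snd (bds d'!j))) (?e / 2) (snd (snd (bds d'!j)))"
    if "j < length (bds d')" for j
    using adm(2) nth_mem[OF that] unfolding admissible_def by (auto simp: case_prod_unfold)
  have bd_match: "curves_match ?e \<delta> (fst (bds d!j)) (fst (bds d'!j))"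
    "curves_match ?e \<delta> (fst (bds d'!j)) (fst (bds d!j))" if j: "j < length (bds d)" for j
  proof -
    have j': "j < length (bds d')" using j parse(5) by simp
    show "curves_match ?e \<delta> (fst (bds d!j)) (fst (bds d'!j))"
      using curves_match_if_corr_tangents[OF bd_param[OF j] bd_param'(1)[OF j'] parse(6)[OF j] parse(7)[OF j]]
        close_bd j e0 by blast
    show "curves_match ?e \<delta> (fst (bds d'!j)) (fst (bds d!j))"
      using curves_match_if_corr_tangents[OF bd_param'[OF j'] bd_param(1)[OF j] parse(6)[OF j, symmetric]]
        corr_tangents_sym[OF parse(6)[OF j]] close_bd j e0 parse(6)[OF j] parse(7)[OF j] by simp
  qed
  have bd: "boundaries_close \<eta> \<delta> ?\<gamma> ?F ?\<gamma>' ?F'"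
  proof (rule boundaries_close_if_match[OF c(1) c'(1) thick(2) match e0 small(1,2,5)])
    show "surf_bd ?F \<subseteq> tube_bd ?\<gamma>" using proper(1) unfolding proper_C11_surface_def by blast
    show "\<exists>y\<in>surf_bd ?F'. dist x y \<le> 4 * ?e \<and>
        line_angle (tan_space (surf_bd ?F) x) (tan_space (surf_bd ?F') y) \<le> \<delta>" if x: "x \<in> surf_bd ?F" for x
      using components_match[OF bd_comps(1) bd_param(1) bd_comps(2) bd_param'(1) parse(5) bd_match(1) x] by metis
    show "\<exists>x\<in>surf_bd ?F. dist x y \<le> 4 * ?e \<and>
        line_angle (tan_space (surf_bd ?F) x) (tan_space (surf_bd ?F') y) \<le> \<delta>" if y: "y \<in> surf_bd ?F'" for y
    proof -
      obtain x where "x \<in> surf_bd ?F" "dist y x \<le> 4 * ?e"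
          "line_angle (tan_space (surf_bd ?F') y) (tan_space (surf_bd ?F) x) \<le> \<delta>"
        using components_match[OF bd_comps(2) bd_param'(1) bd_comps(1) bd_param(1) parse(5)[symmetric] _ y]
          bd_match(2) parse(5) by metis
      then show ?thesis by (intro bexI[of _ x]) (simp_all add: dist_commute line_angle_commute)
    qed
  qed
  have curves: "C11_closed_curve ?\<gamma>" "C11_closed_curve ?\<gamma>'"
    unfolding C11_closed_curve_def using c(1) c'(1) by blast+
  have rel: "rel_thi_ge c0 L0 ?\<gamma> ?F \<tau>" "rel_thi_ge c0 L0 ?\<gamma>' ?F' \<tau>"
    using win rel_thi_ge_rigid_with[OF Q(1)] rel_thi_ge_rigid_with[OF Q(2)] unfolding window_pair_def by simp_all
  note isotopy = stab[unfolded stability_constants_def, THEN conjunct2, THEN conjunct2,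
      THEN spec[of _ \<tau>], THEN spec[of _ ?\<gamma>], THEN spec[of _ ?F], THEN spec[of _ ?\<gamma>'],
      THEN spec[of _ ?F'], THEN spec[of _ \<eta>], THEN spec[of _ \<delta>], THEN mp]
  have "\<exists>H. ambient_isotopy H \<and> H 1 ` Some ` ?\<gamma> = Some ` ?\<gamma>' \<and> H 1 ` Some ` ?F = Some ` ?F' \<and>
      (\<forall>t\<in>{0..1}. proper_pair (H t ` Some ` ?\<gamma>) (H t ` Some ` ?F))"
    by (intro isotopy conjI pos curves thick proper rel \<eta> \<delta> cores surfs bd)
  then have "isotopic_pairs (Some ` ?\<gamma>, Some ` ?F) (Some ` ?\<gamma>', Some ` ?F')"
    unfolding isotopic_pairs_def fst_conv snd_conv by (elim exE conjE) (intro exI conjI)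
  \<comment> \<open>Each pair is isotopic to its normalized copy, and the two normalized copies are
    isotopic to each other.\<close>
  then have "isotopic_pairs (Some ` \<gamma>, Some ` F) (Some ` \<gamma>', Some ` F')"
    by (rule isotopic_pairs_trans[OF isotopic_pairs_trans[OF isotopic_pairs_rigid[OF rigid(1)]]
        isotopic_pairs_sym[OF isotopic_pairs_rigid[OF rigid(2)]]])
  then show ?thesis by (rule ess_type_eq_if_isotopic)
qed

section \<open>Codes and types of rigidly equivalent pairs\<close>

lemma rigid_compose: "rigid g \<Longrightarrow> rigid h \<Longrightarrow> rigid (g \<circ> h)"
proof -
  assume "rigid g" "rigid h"
  then obtain Q a R b where Q: "rotation_matrix Q" "g = (\<lambda>x. Q *v x + a)"
    and R: "rotation_matrix R" "h = (\<lambda>x. R *v x + b)"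
    unfolding rigid_def by blast
  have "rotation_matrix (Q ** R)"
    using Q(1) R(1) by (simp add: rotation_matrix_def orthogonal_matrix_mul det_mul)
  moreover have "g \<circ> h = (\<lambda>x. (Q ** R) *v x + (Q *v b + a))"
    by (simp add: Q R fun_eq_iff matrix_vector_right_distrib matrix_vector_mul_assoc)
  ultimately show ?thesis unfolding rigid_def by blast
qed

text \<open>A normalization of the moved pair, preceded by \<open>g\<close>, normalizes the original
  pair and leads to the same sets to be discretized.\<close>

lemma raw_words_rigid_subset:
  assumes "rigid g" shows "raw_words A S (g ` \<gamma>) (g ` F) \<subseteq> raw_words A S \<gamma> F"
proof
  fix w assume "w \<in> raw_words A S (g ` \<gamma>) (g ` F)"
  then obtain h d where "encodes A S (g ` \<gamma>) (g ` F) h d w" unfolding raw_words_def by blast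
  then have "encodes A S \<gamma> F (h \<circ> g) d w"
    using rigid_compose[OF _ assms] unfolding encodes_def normalizes_def by (simp add: image_comp)
  then show "w \<in> raw_words A S \<gamma> F" unfolding raw_words_def by blast
qed

lemma raw_words_rigid:
  assumes "rigid g" shows "raw_words A S (g ` \<gamma>) (g ` F) = raw_words A S \<gamma> F"
proof (rule subset_antisym[OF raw_words_rigid_subset[OF assms]])
  obtain Q where Q: "rigid_with Q g" using rigid_imp_rigid_with[OF assms] by blast
  obtain h where h: "rigid_with (transpose Q) h" "\<And>x. h (g x) = x" using rigid_with_inverse[OF Q] by metis
  have "h = (\<lambda>x. transpose Q *v x + h 0)" using h(1) unfolding rigid_with_def by blast
  then have "rigid h" using h(1) unfolding rigid_with_def rigid_def by blast
  from raw_words_rigid_subset[OF this, of A S "g ` \<gamma>" "g ` F"]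
  show "raw_words A S \<gamma> F \<subseteq> raw_words A S (g ` \<gamma>) (g ` F)" by (simp add: image_image h(2))
qed

text \<open>Elements of \<open>Zess\<close> are rigid classes, so a code may be given for a
  representative other than the one known to satisfy the window conditions.\<close>

lemma encoded_type_rigid:
  "rigid g \<Longrightarrow> encoded_type A S (g ` \<gamma>) (g ` F) w \<longleftrightarrow> encoded_type A S \<gamma> F w"
  unfolding encoded_type_def by (simp add: raw_words_rigid)

lemma ess_type_rigid: "rigid g \<Longrightarrow> ess_type (g ` \<gamma>) (g ` F) = ess_type \<gamma> F"
  by (rule ess_type_eq_if_isotopic) (rule isotopic_pairs_sym, rule isotopic_pairs_rigid)

theorem theorem13p16:
  fixes c0 L0 Cenc cst dst :: real and A :: enc_consts
  assumes "0 < c0" and "c0 < 1" and "1 \<le> L0"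
    and "valid_consts A"
    and "encoding_constant c0 L0 A Cenc"
    and "stability_constants c0 L0 cst dst"
  shows "\<exists>c1>0. \<forall>S \<Delta> \<tau>.
    valid_scheme A S \<and> dgam S \<le> eps S \<and> dF S \<le> dst / (8 * max 4 (2 * Cenc)) \<and>
    0 < \<Delta> \<and> 0 < \<tau> \<and> eps S \<le> c1 * min 1 \<tau> \<longrightarrow>
      (\<forall>\<Lambda>>0. \<forall>K\<in>knot_types. \<forall>P\<in>Zess c0 L0 \<Lambda> \<Delta> \<tau> K. \<forall>(\<gamma>, F)\<in>P. \<forall>w.
         encoded_type A S \<gamma> F w \<longrightarrow> characteristic c0 L0 A S \<Delta> \<tau> w (ess_type \<gamma> F)) \<and>
      (\<forall>\<T> \<T>'. visible c0 L0 \<Delta> \<tau> \<T> \<and> visible c0 L0 \<Delta> \<tau> \<T>' \<and> \<T> \<noteq> \<T>' \<longrightarrow>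
         \<not> (\<exists>w. realized_code c0 L0 A S \<Delta> \<tau> \<T> w \<and> realized_code c0 L0 A S \<Delta> \<tau> \<T>' w)) \<and>
      (\<forall>\<T> w. visible c0 L0 \<Delta> \<tau> \<T> \<and> realized_code c0 L0 A S \<Delta> \<tau> \<T> w \<longrightarrow>
         characteristic c0 L0 A S \<Delta> \<tau> w \<T>)"
proof -
  have C1: "1 \<le> Cenc" using assms(5) unfolding encoding_constant_def by blast
  have cst: "0 < cst" "0 < dst" using assms(6) unfolding stability_constants_def by blast+
  \<comment> \<open>Small enough that \<open>200 * Cenc * eps S\<close> stays below
    \<open>cst * min 1 \<tau>\<close>, that the mesh part of the surface angle takes only a small
    share of \<open>dst\<close>, and that the absolute smallness conditions hold.\<close>
  define c1 where "c1 = min 1 (min cst dst) / (1000 * Cenc)"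
  have "0 < c1" using C1 cst unfolding c1_def by simp
  \<comment> \<open>All three claims reduce to this one, for a representative that is itself in the
    window.\<close>
  have recognize: "characteristic c0 L0 A S \<Delta> \<tau> w (ess_type \<gamma> F)"
    if "valid_scheme A S" "dgam S \<le> eps S" "dF S \<le> dst / (8 * max 4 (2 * Cenc))"
      "0 < \<Delta>" "0 < \<tau>" "eps S \<le> c1 * min 1 \<tau>"
      and win: "window_pair c0 L0 \<Delta> \<tau> \<gamma> F" and code: "encoded_type A S \<gamma> F w"
    for S \<Delta> \<tau> \<gamma> F w
    unfolding characteristic_def
  proof (intro allI impI, elim conjE)
    fix \<gamma>' F' assume "window_pair c0 L0 \<Delta> \<tau> \<gamma>' F'" "encoded_type A S \<gamma>' F' w"
    from ess_type_eq_if_same_code[OF assms(5,6) that(1-5) that(6)[unfolded c1_def] this(1) win this(2) code]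
    show "ess_type \<gamma>' F' = ess_type \<gamma> F" .
  qed
  show ?thesis
  proof (intro exI[of _ c1] conjI allI impI \<open>0 < c1\<close>, goal_cases)
    case (1 S \<Delta> \<tau>)
    have "characteristic c0 L0 A S \<Delta> \<tau> w (ess_type \<gamma> F)"
      if P: "P \<in> Zess c0 L0 \<Lambda> \<Delta> \<tau> K" "(\<gamma>, F) \<in> P" and w: "encoded_type A S \<gamma> F w" for \<Lambda> K P \<gamma> F w
    proof -
      \<comment> \<open>\<open>P\<close> is a whole rigid class; code and type of the given
        representative are carried over to the one in the window.\<close>
      obtain \<gamma>0 F0 where "P = rigid_class \<gamma>0 F0" and win: "window_pair c0 L0 \<Delta> \<tau> \<gamma>0 F0"
        using P(1) unfolding Zess_def by blast
      then obtain g where g: "rigid g" "\<gamma> = g ` \<gamma>0" "F = g ` F0"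
        using P(2) unfolding rigid_class_def by blast
      have "encoded_type A S \<gamma>0 F0 w" using w unfolding g(2,3) encoded_type_rigid[OF g(1)] .
      then show ?thesis
        unfolding g(2,3) ess_type_rigid[OF g(1)] using 1 by (intro recognize win) auto
    qed
    then show ?case by blast
  next
    case (2 S \<Delta> \<tau> T T')
    show ?case
    proof
      assume "\<exists>w. realized_code c0 L0 A S \<Delta> \<tau> T w \<and> realized_code c0 L0 A S \<Delta> \<tau> T' w"
      then obtain w \<gamma> F \<gamma>' F' where
        "window_pair c0 L0 \<Delta> \<tau> \<gamma> F" "ess_type \<gamma> F = T" "encoded_type A S \<gamma> F w"
        and pair': "window_pair c0 L0 \<Delta> \<tau> \<gamma>' F'" "ess_type \<gamma>' F' = T'" "encoded_type A S \<gamma>' F' w"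
        unfolding realized_code_def by blast
      \<comment> \<open>The code determines the type \<open>T\<close> of the first pair, and the
        second pair carries the same code.\<close>
      then have "characteristic c0 L0 A S \<Delta> \<tau> w T" using 2(1) recognize by blast
      then have "T = T'" using pair' unfolding characteristic_def by blast
      then show False using 2(2) by blast
    qed
  next
    case (3 S \<Delta> \<tau> T w)
    then obtain \<gamma> F where "window_pair c0 L0 \<Delta> \<tau> \<gamma> F" "ess_type \<gamma> F = T" "encoded_type A S \<gamma> F w"
      unfolding realized_code_def by blast
    then show ?case using 3(1) recognize by blast
  qed
qed

end
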